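(* Let $n\ge1$. Exceptional collections for the quiver of type $\mathbb A_n$ with straight orientation are in bijection with lattice paths of height $n$. The edges of the lattice path are given by the vertices (nodes and leaves) of the ternary tree corresponding to the exceptional collection, beginning with the vertical edge $R$ (the root) followed by the other vertices in lexicographic order of their labels, where leaves of the tree give the $2n+1$ horizontal edges and nodes give the $n$ vertical edges. Thus the $n$ vertical edges correspond to the objects of the exceptional collection. Furthermore, the relatively injective objects are those vertical edges whose first coordinates are even integers.
   Context: **Lattice paths.** A lattice path of height $n$ is a path from $(0,0)$ to $(2n+1,n)$ whose edges are unit steps up or right between points with integer coordinates, such that $x\le2y$ at all points except at the last step, where $x=2y+1$ is reached. **Exceptional collections.** The quiver is $1\to2\to\cdots\to n$ over a field $\Bbbk$; modules are finite dimensional up to isomorphism. For $0\le i<j\le n$, $M_{i,j}$ is the indecomposable module with support $(i,j]=\{i+1,\dots,j\}$. An exceptional sequence is a sequence $(E_1,\dots,E_n)$ of indecomposable modules with $\mathrm{Ext}^1(E_p,E_p)=0$ and $\mathrm{Hom}(E_p,E_q)=0=\mathrm{Ext}^1(E_p,E_q)$ for all $q<p$; an exceptional collection (set) is a set of $n$ modules which can be so ordered. $E_p$ is relatively injective if it is an injective object of ${}^\perp(E_1\oplus\cdots\oplus E_{p-1})$, where ${}^\perp V$ is the full subcategory of modules $W$ with $\mathrm{Hom}(W,V)=0=\mathrm{Ext}^1(W,V)$; this does not depend on the chosen ordering of the collection. **Ternary tree.** The strand diagram of an exceptional collection is the graph with vertex set $\{0,\dots,n\}$ and an edge (strand) $c(i,j)$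 for each object $M_{i,j}$; it is a tree. A strand $c(i,j)$, $i<j$, is oriented to the right if the unique path from $0$ to $j$ passes through $i$, and to the left otherwise. The rooted ternary tree of the collection has nodes the objects of the collection; its root is $R=c(0,k)$ with $k$ maximal such that $M_{0,k}$ is in the collection, and the three ordered children of a node $X=c(i,j)$ ($i<j$) are $Xa,Xb,Xc$: - if $X$ is oriented to the right: $Xa=c(i,x)$ with $i<x<j$ maximal; $Xb=c(y,j)$ the longest strand with $i<y<j$; $Xc=c(j,z)$ with $z>j$ maximal; - if $X$ is oriented to the left: $Xa=c(x,j)$ with $i<x<j$ minimal; $Xb=c(i,y)$ the longest strand with $i<y<j$; $Xc=c(z,i)$ the longest strand with $z<i$; in each case among strands of the diagram, and if no such strand exists the child is a leaf. The children of $R$ are also written $A=Ra$, $B=Rb$, $C=Rc$. Every vertex (node or leaf) other than $R$ is thus labeled by a nonempty word in $a,b,c$, the path from $R$ to it, and lexicographic order is with respect to $a<b<c$, a word preceding its extensions. *)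

theory Defs
  imports "Jordan_Normal_Form.Matrix" "HOL-Library.List_Lexorder"
begin

section \<open>Representations of the linearly oriented quiver\<close>

text \<open>
  Finite dimensional modules over the path algebra of \<open>1 \<rightarrow> 2 \<rightarrow> \<dots> \<rightarrow> n\<close> are, up to isomorphism,
  representations of the quiver on coordinate spaces: a dimension at each vertex \<open>v \<in> {1..n}\<close>
  and a matrix for each arrow \<open>v \<rightarrow> v + 1\<close>.  Entries outside these ranges are junk, which all
  notions below ignore.
\<close>

datatype 'k rep = Rep (rdim: "nat \<Rightarrow> nat") (arrow: "nat \<Rightarrow> 'k mat")

definition is_rep :: "nat \<Rightarrow> 'k rep \<Rightarrow> bool" where
  "is_rep n M \<longleftrightarrow> (\<forall>v\<in>{1..<n}. arrow M v \<in> carrier_mat (rdim M (v + 1)) (rdim M v))"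

definition rep_hom :: "nat \<Rightarrow> 'k::field rep \<Rightarrow> 'k rep \<Rightarrow> (nat \<Rightarrow> 'k mat) set" where
  "rep_hom n M N = {f. (\<forall>v\<in>{1..n}. f v \<in> carrier_mat (rdim N v) (rdim M v)) \<and>
     (\<forall>v\<in>{1..<n}. f (v + 1) * arrow M v = arrow N v * f v)}"

definition hom_eq :: "nat \<Rightarrow> (nat \<Rightarrow> 'k mat) \<Rightarrow> (nat \<Rightarrow> 'k mat) \<Rightarrow> bool" where
  "hom_eq n f g \<longleftrightarrow> (\<forall>v\<in>{1..n}. f v = g v)"

definition hom_comp :: "(nat \<Rightarrow> 'k::field mat) \<Rightarrow> (nat \<Rightarrow> 'k mat) \<Rightarrow> nat \<Rightarrow> 'k mat"
  (infixl "\<circ>\<^sub>r" 70) where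
  "g \<circ>\<^sub>r f = (\<lambda>v. g v * f v)"

definition hom_id :: "'k::field rep \<Rightarrow> nat \<Rightarrow> 'k mat" where
  "hom_id M = (\<lambda>v. 1\<^sub>m (rdim M v))"

definition hom_zero :: "'k::field rep \<Rightarrow> 'k rep \<Rightarrow> nat \<Rightarrow> 'k mat" where
  "hom_zero M N = (\<lambda>v. 0\<^sub>m (rdim N v) (rdim M v))"

definition rep_iso :: "nat \<Rightarrow> 'k::field rep \<Rightarrow> 'k rep \<Rightarrow> bool" where
  "rep_iso n M N \<longleftrightarrow> (\<exists>f\<in>rep_hom n M N. \<exists>g\<in>rep_hom n N M.
     hom_eq n (g \<circ>\<^sub>r f) (hom_id M) \<and> hom_eq n (f \<circ>\<^sub>r g) (hom_id N))"

definition iso_class :: "nat \<Rightarrow> 'k::field rep \<Rightarrow> 'k rep set" where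
  "iso_class n M = {N. is_rep n N \<and> rep_iso n M N}"

definition is_zero_rep :: "nat \<Rightarrow> 'k rep \<Rightarrow> bool" where
  "is_zero_rep n M \<longleftrightarrow> (\<forall>v\<in>{1..n}. rdim M v = 0)"

definition direct_sum :: "'k::field rep list \<Rightarrow> 'k rep" where
  "direct_sum Ms = Rep (\<lambda>v. \<Sum>M\<leftarrow>Ms. rdim M v) (\<lambda>v. diag_block_mat (map (\<lambda>M. arrow M v) Ms))"

definition indecomposable :: "nat \<Rightarrow> 'k::field rep \<Rightarrow> bool" where
  "indecomposable n M \<longleftrightarrow> is_rep n M \<and> \<not> is_zero_rep n M \<and>
     (\<forall>A B. is_rep n A \<longrightarrow> is_rep n B \<longrightarrow> rep_iso n M (direct_sum [A, B]) \<longrightarrow>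
        is_zero_rep n A \<or> is_zero_rep n B)"

definition hom_vanishes :: "nat \<Rightarrow> 'k::field rep \<Rightarrow> 'k rep \<Rightarrow> bool" where
  "hom_vanishes n M N \<longleftrightarrow> (\<forall>f\<in>rep_hom n M N. hom_eq n f (hom_zero M N))"

text \<open>Exactness of \<open>0 \<rightarrow> N \<rightarrow> E \<rightarrow> M \<rightarrow> 0\<close>, with maps \<open>f\<close> and \<open>g\<close>.\<close>

definition short_exact ::
  "nat \<Rightarrow> 'k::field rep \<Rightarrow> (nat \<Rightarrow> 'k mat) \<Rightarrow> 'k rep \<Rightarrow> (nat \<Rightarrow> 'k mat) \<Rightarrow> 'k rep \<Rightarrow> bool" where
  "short_exact n N f E g M \<longleftrightarrow>
     f \<in> rep_hom n N E \<and> g \<in> rep_hom n E M \<and>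
     (\<forall>v\<in>{1..n}.
        inj_on (\<lambda>x. f v *\<^sub>v x) (carrier_vec (rdim N v)) \<and>
        (\<lambda>x. f v *\<^sub>v x) ` carrier_vec (rdim N v)
          = {x \<in> carrier_vec (rdim E v). g v *\<^sub>v x = 0\<^sub>v (rdim M v)} \<and>
        (\<lambda>x. g v *\<^sub>v x) ` carrier_vec (rdim E v) = carrier_vec (rdim M v))"

text \<open>Vanishing of \<open>Ext\<^sup>1(M, N)\<close> in the sense of Yoneda: every extension of \<open>M\<close> by \<open>N\<close> splits.\<close>

definition ext_vanishes :: "nat \<Rightarrow> 'k::field rep \<Rightarrow> 'k rep \<Rightarrow> bool" where
  "ext_vanishes n M N \<longleftrightarrow>
     (\<forall>E f g. is_rep n E \<longrightarrow> short_exact n N f E g M \<longrightarrow>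
        (\<exists>s\<in>rep_hom n M E. hom_eq n (g \<circ>\<^sub>r s) (hom_id M)))"

text \<open>The module \<open>M\<^sub>i\<^sub>,\<^sub>j\<close> with support \<open>(i, j]\<close>.\<close>

definition interval_rep :: "nat \<times> nat \<Rightarrow> 'k::field rep" where
  "interval_rep = (\<lambda>(i, j).
     let d = (\<lambda>v. if i < v \<and> v \<le> j then 1 else 0) in
     Rep d (\<lambda>v. if i < v \<and> v + 1 \<le> j then 1\<^sub>m 1 else 0\<^sub>m (d (v + 1)) (d v)))"


section \<open>Exceptional collections and relatively injective objects\<close>

text \<open>Sequences are lists, so positions are counted from 0.\<close>

definition exceptional_seq :: "nat \<Rightarrow> 'k::field rep list \<Rightarrow> bool" where
  "exceptional_seq n Es \<longleftrightarrow> length Es = n \<and>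
     (\<forall>p<n. indecomposable n (Es ! p) \<and> ext_vanishes n (Es ! p) (Es ! p) \<and>
        (\<forall>q<p. hom_vanishes n (Es ! p) (Es ! q) \<and> ext_vanishes n (Es ! p) (Es ! q)))"

text \<open>A collection is a set of isomorphism classes.\<close>

definition collection_of :: "nat \<Rightarrow> 'k::field rep list \<Rightarrow> 'k rep set set" where
  "collection_of n Es = iso_class n ` set Es"

definition exceptional_collections :: "nat \<Rightarrow> 'k::field rep set set set" where
  "exceptional_collections n = {collection_of n Es | Es. exceptional_seq n Es}"

definition left_perp :: "nat \<Rightarrow> 'k::field rep \<Rightarrow> 'k rep set" where
  "left_perp n V = {W. is_rep n W \<and> hom_vanishes n W V \<and> ext_vanishes n W V}"

text \<open>Monomorphisms and injective objects of the full subcategory on a class \<open>C\<close> of objects.\<close>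

definition mono_in :: "nat \<Rightarrow> 'k::field rep set \<Rightarrow> 'k rep \<Rightarrow> 'k rep \<Rightarrow> (nat \<Rightarrow> 'k mat) \<Rightarrow> bool" where
  "mono_in n C X Y m \<longleftrightarrow> m \<in> rep_hom n X Y \<and>
     (\<forall>Z\<in>C. \<forall>g\<in>rep_hom n Z X. \<forall>h\<in>rep_hom n Z X.
        hom_eq n (m \<circ>\<^sub>r g) (m \<circ>\<^sub>r h) \<longrightarrow> hom_eq n g h)"

definition injective_in :: "nat \<Rightarrow> 'k::field rep set \<Rightarrow> 'k rep \<Rightarrow> bool" where
  "injective_in n C I \<longleftrightarrow> I \<in> C \<and>
     (\<forall>X\<in>C. \<forall>Y\<in>C. \<forall>m. mono_in n C X Y m \<longrightarrow>
        (\<forall>h\<in>rep_hom n X I. \<exists>h'\<in>rep_hom n Y I. hom_eq n (h' \<circ>\<^sub>r m) h))"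

definition relatively_injective :: "nat \<Rightarrow> 'k::field rep list \<Rightarrow> nat \<Rightarrow> bool" where
  "relatively_injective n Es p \<longleftrightarrow> injective_in n (left_perp n (direct_sum (take p Es))) (Es ! p)"


section \<open>Strand diagrams and ternary trees\<close>

text \<open>The strand \<open>c(i, j)\<close> is the pair \<open>(i, j)\<close> with \<open>i < j\<close>; a diagram is a set of strands.\<close>

definition strands :: "nat \<Rightarrow> 'k::field rep set set \<Rightarrow> (nat \<times> nat) set" where
  "strands n S = {(i, j). i < j \<and> j \<le> n \<and> iso_class n (interval_rep (i, j)) \<in> S}"

definition simple_path :: "(nat \<times> nat) set \<Rightarrow> nat \<Rightarrow> nat \<Rightarrow> nat list \<Rightarrow> bool" where
  "simple_path D u v p \<longleftrightarrow> p \<noteq> [] \<and> hd p = u \<and> last p = v \<and> distinct p \<and>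
     (\<forall>t. Suc t < length p \<longrightarrow> (p ! t, p ! Suc t) \<in> D \<or> (p ! Suc t, p ! t) \<in> D)"

definition oriented_right :: "(nat \<times> nat) set \<Rightarrow> nat \<times> nat \<Rightarrow> bool" where
  "oriented_right D = (\<lambda>(i, j). i \<in> set (THE p. simple_path D 0 j p))"

definition pick :: "(nat set \<Rightarrow> nat) \<Rightarrow> (nat \<Rightarrow> nat \<times> nat) \<Rightarrow> nat set \<Rightarrow> (nat \<times> nat) option" where
  "pick sel c A = (if A = {} then None else Some (c (sel A)))"

datatype letter = La | Lb | Lc

fun letter_rank :: "letter \<Rightarrow> nat" where
  "letter_rank La = 0"
| "letter_rank Lb = 1"
| "letter_rank Lc = 2"

instantiation letter :: linorder
begin

definition less_eq_letter :: "letter \<Rightarrow> letter \<Rightarrow> bool" where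
  "x \<le> y \<longleftrightarrow> letter_rank x \<le> letter_rank y"

definition less_letter :: "letter \<Rightarrow> letter \<Rightarrow> bool" where
  "x < y \<longleftrightarrow> letter_rank x < letter_rank y"

instance
proof
  fix x y :: letter
  show "x \<le> y \<Longrightarrow> y \<le> x \<Longrightarrow> x = y"
    by (cases x; cases y) (auto simp: less_eq_letter_def)
qed (auto simp: less_eq_letter_def less_letter_def)

end

text \<open>\<open>None\<close> means that the child is a leaf.\<close>

fun child_right :: "(nat \<times> nat) set \<Rightarrow> nat \<times> nat \<Rightarrow> letter \<Rightarrow> (nat \<times> nat) option" where
  "child_right D (i, j) La = pick Max (\<lambda>x. (i, x)) {x. i < x \<and> x < j \<and> (i, x) \<in> D}"
| "child_right D (i, j) Lb = pick Min (\<lambda>y. (y, j)) {y. i < y \<and> y < j \<and> (y, j) \<in> D}"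
| "child_right D (i, j) Lc = pick Max (\<lambda>z. (j, z)) {z. j < z \<and> (j, z) \<in> D}"

fun child_left :: "(nat \<times> nat) set \<Rightarrow> nat \<times> nat \<Rightarrow> letter \<Rightarrow> (nat \<times> nat) option" where
  "child_left D (i, j) La = pick Min (\<lambda>x. (x, j)) {x. i < x \<and> x < j \<and> (x, j) \<in> D}"
| "child_left D (i, j) Lb = pick Max (\<lambda>y. (i, y)) {y. i < y \<and> y < j \<and> (i, y) \<in> D}"
| "child_left D (i, j) Lc = pick Min (\<lambda>z. (z, i)) {z. z < i \<and> (z, i) \<in> D}"

definition child :: "(nat \<times> nat) set \<Rightarrow> nat \<times> nat \<Rightarrow> letter \<Rightarrow> (nat \<times> nat) option" where
  "child D X = (if oriented_right D X then child_right D X else child_left D X)"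

definition root :: "(nat \<times> nat) set \<Rightarrow> nat \<times> nat" where
  "root D = (0, Max {k. (0, k) \<in> D})"

text \<open>
  The strand reached from the root \<open>R\<close> along the word \<open>w\<close>, read from left to right; the empty
  word is \<open>R\<close> itself.
\<close>

definition strand_at :: "(nat \<times> nat) set \<Rightarrow> letter list \<Rightarrow> (nat \<times> nat) option" where
  "strand_at D w = foldl (\<lambda>X l. Option.bind X (\<lambda>Y. child D Y l)) (Some (root D)) w"

definition nodes :: "(nat \<times> nat) set \<Rightarrow> letter list set" where
  "nodes D = {w. strand_at D w \<noteq> None}"

definition leaves :: "(nat \<times> nat) set \<Rightarrow> letter list set" where
  "leaves D = {w @ [l] | w l. w \<in> nodes D \<and> w @ [l] \<notin> nodes D}"

text \<open>The order on words is the one of \<open>List_Lexorder\<close>, where a word precedes its extensions.\<close>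

definition tree_vertices :: "(nat \<times> nat) set \<Rightarrow> letter list list" where
  "tree_vertices D = [] # sorted_list_of_set ((nodes D \<union> leaves D) - {[]})"


section \<open>Lattice paths\<close>

text \<open>A path starting at the origin is given by its list of unit steps.\<close>

datatype step = Horizontal | Vertical

text \<open>The point reached after the first \<open>k\<close> steps, which is the start of edge number \<open>k\<close>.\<close>

definition point :: "step list \<Rightarrow> nat \<Rightarrow> nat \<times> nat" where
  "point P k = (count_list (take k P) Horizontal, count_list (take k P) Vertical)"

definition lattice_paths :: "nat \<Rightarrow> step list set" where
  "lattice_paths n = {P. point P (length P) = (2 * n + 1, n) \<and>
     (\<forall>k<length P. fst (point P k) \<le> 2 * snd (point P k))}"

definition path_of :: "nat \<Rightarrow> 'k::field rep set set \<Rightarrow> step list" where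
  "path_of n S = map (\<lambda>w. if w \<in> nodes (strands n S) then Vertical else Horizontal)
     (tree_vertices (strands n S))"

definition edges_of_kind :: "step \<Rightarrow> step list \<Rightarrow> nat set" where
  "edges_of_kind s P = {k. k < length P \<and> P ! k = s}"

text \<open>The object (isomorphism class) at the tree node which gives edge number \<open>k\<close>.\<close>

definition edge_object :: "nat \<Rightarrow> 'k::field rep set set \<Rightarrow> nat \<Rightarrow> 'k rep set" where
  "edge_object n S k =
     iso_class n (interval_rep (the (strand_at (strands n S) (tree_vertices (strands n S) ! k))))"

end

(*
A representation W satisfies Hom(W, M_{i,j}) = 0 = Ext^1(W, M_{i,j}) exactly if the map W_i -> W_j
is invertible (with W_0 = 0).  For W = M_{k,l} this says that i and j are both inside or both
outside (k, l], which rules out crossing strands and orders the strands at a vertex v cyclically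
as v-1, ..., 0, n, ..., v+1; a polygon of strands would turn this into a cycle of constraints.
Hence an exceptional collection decomposes at the longest strand at an end of an interval into
three collections on smaller intervals, which is the recursion of ternary trees, and conversely
every ternary tree is realized.  Preorder traversal encodes ternary trees as lattice paths, and
as a ternary tree has an odd number of leaves, the first coordinate of the edge of a node is even
iff the letter b occurs an even number of times in its label, i.e. iff its strand is oriented to
the right.

If the strand c(i, j) of E_p is oriented to the right, then the strands before it identify W_i
with some W_x, where x = 0 or c(x, z) precedes E_p for some z > j; so W_i is a natural direct
summand of W_j for W in the left perpendicular category, and functionals on W_j / W_i extend
along monomorphisms.  If it is oriented to the left, the vertices which the strand separates from
0 form an interval [u, u'] with u' < j, and M_{i,j} -> M_{u-1,j} is a nonsplit monomorphism.
*)

theory Submission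
  imports Defs
begin

section \<open>Noncrossing trees\<close>

text \<open>Two reductions shape the proof. An ordering of the collection is never normalised: it is
  kept as an arbitrary rank function, while the decomposition and the injectivity criterion are
  statements about the set of strands alone, so they hold for every admissible ordering at once. On
  the module side everything is expressed by functionals: a homomorphism W -> M_{i,j} is a
  functional on W_j that kills the image of W_i, and an extension is obstructed by a functional on
  W_i that does not factor through W_i -> W_j. Hence Hom and Ext^1 vanish together iff composition
  with W_i -> W_j is bijective on functionals. The number n enters by counting. At most q - p
  strands fit on the vertices p, ..., q, and the pieces of the decomposition use this bound up
  exactly; so n strands on 0, ..., n leave no slack and every piece is full again. A last obstacle
  is that monomorphisms are tested only inside the perpendicular category. The kernel of such a map,
  taken vertex by vertex, satisfies the same invertibility conditions, so it belongs to the category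
  and has to vanish.\<close>

text \<open>For W the interval module of Y and X = (i, j) this is invertibility of W_i -> W_j, that
  is, left orthogonality of the module of Y to that of X. The vertex 0 never lies in a half-open
  support, in accordance with W_0 = 0.\<close>

definition perp :: "nat \<times> nat \<Rightarrow> nat \<times> nat \<Rightarrow> bool" where
  "perp Y X \<longleftrightarrow> (fst X \<in> {fst Y<..snd Y} \<longleftrightarrow> snd X \<in> {fst Y<..snd Y})"

definition strands_in :: "nat \<Rightarrow> nat \<Rightarrow> (nat \<times> nat) set" where
  "strands_in p q = {(i, j). p \<le> i \<and> i < j \<and> j \<le> q}"

text \<open>Here r is the position in an exceptional sequence. A rank function restricts to subsets
  of D without renumbering, and the recursion produces subsets that need not be complete
  collections.\<close>

definition excs :: "(nat \<times> nat \<Rightarrow> nat) \<Rightarrow> (nat \<times> nat) set \<Rightarrow> bool" where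
  "excs r D \<longleftrightarrow> inj_on r D \<and> (\<forall>X\<in>D. \<forall>Y\<in>D. r X < r Y \<longrightarrow> perp Y X)"

lemma excs_subset: "excs r D \<Longrightarrow> D' \<subseteq> D \<Longrightarrow> excs r D'"
  unfolding excs_def by (meson inj_on_subset subsetD)

lemma excs_before:
  assumes "excs r D" "X \<in> D" "Y \<in> D" "\<not> perp X Y" "X \<noteq> Y"
  shows "r X < r Y"
  using assms unfolding excs_def inj_on_def by (metis linorder_neqE_nat)

lemma finite_strands_in: "finite (strands_in p q)"
  by (rule finite_subset[of _ "{..q} \<times> {..q}"]) (auto simp: strands_in_def)

text \<open>Each of two crossing strands has exactly one end of the other in its half-open support,
  so each would have to precede the other.\<close>

lemma excs_noncrossing:
  assumes "excs r D" "(i, j) \<in> D" "(k, l) \<in> D" "i < k" "k < j" "j < l"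
  shows False
proof -
  have "r (i, j) < r (k, l)" "r (k, l) < r (i, j)"
    using assms by (auto intro!: excs_before[of r D] simp: perp_def)
  then show False by simp
qed

lemma finite_max_obtains:
  fixes f :: "'a \<Rightarrow> nat"
  assumes "finite C" "C \<noteq> {}"
  obtains e where "e \<in> C" "\<And>e'. e' \<in> C \<Longrightarrow> f e' \<le> f e"
proof -
  have "Max (f ` C) \<in> f ` C" using assms by simp
  then obtain e where "e \<in> C" "f e = Max (f ` C)" by force
  then show thesis using that[of e] Max_ge[of "f ` C"] assms by auto
qed

text \<open>
  Otherwise the maximal strands below \<open>(p, k)\<close> would form a polygon with it, whose edges the
  exceptional order arranges cyclically.
\<close>

lemma exists_cut:
  assumes D: "excs r D" and R: "(p, k) \<in> D" and pk: "p < k"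
  obtains x where "p \<le> x" "x < k"
    "\<And>s t. (s, t) \<in> D \<inter> strands_in p k - {(p, k)} \<Longrightarrow> t \<le> x \<or> x < s"
proof (rule ccontr)
  assume "\<not> thesis"
  define D' where "D' = D \<inter> strands_in p k - {(p, k)}"
  from \<open>\<not> thesis\<close> that have cov: "\<exists>s t. (s, t) \<in> D' \<and> s \<le> x \<and> x < t" if "p \<le> x" "x < k" for x
    unfolding D'_def using that by (meson not_le)
  \<comment> \<open>By \<open>cov\<close> every gap between x and x + 1 is spanned by a strand of
    D'. Those not contained in a larger one are the sides of the polygon.\<close>
  define Mx where "Mx = {(s, t) \<in> D'. \<forall>(s', t') \<in> D'. s' \<le> s \<and> t \<le> t' \<longrightarrow> (s', t') = (s, t)}"
  have fin: "finite D'"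
    unfolding D'_def using finite_strands_in by blast
  have covM: "\<exists>s t. (s, t) \<in> Mx \<and> s \<le> x \<and> x < t" if x: "p \<le> x" "x < k" for x
  proof -
    let ?C = "{(s, t) \<in> D'. s \<le> x \<and> x < t}"
    have ne: "?C \<noteq> {}" and f: "finite ?C"
      using cov[OF x] fin by (auto intro: finite_subset[OF _ fin])
    \<comment> \<open>The longest strand over the gap is maximal, because a strand containing it is
      over the gap as well.\<close>
    obtain e where e: "e \<in> ?C" "\<And>e'. e' \<in> ?C \<Longrightarrow> snd e' - fst e' \<le> snd e - fst e"
      using finite_max_obtains[OF f ne, of "\<lambda>e. snd e - fst e"] by blast
    have "e \<in> Mx"
    proof -
      { fix s' t' assume a: "(s', t') \<in> D'" "s' \<le> fst e" "snd e \<le> t'"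
        then have "(s', t') \<in> ?C" using e(1) by auto
        then have "t' - s' \<le> snd e - fst e" using e(2) by fastforce
        moreover have "fst e < snd e" using e(1) by (auto simp: D'_def strands_in_def)
        ultimately have "(s', t') = e" using a by (cases e) auto }
      then show ?thesis unfolding Mx_def using e(1) by (cases e) auto
    qed
    then show ?thesis using e(1) by (cases e) auto
  qed
  have MD: "Mx \<subseteq> D'" by (auto simp: Mx_def)
  have finM: "finite Mx" using fin MD finite_subset by blast
  have neM: "Mx \<noteq> {}" using covM[of p] pk by auto
  \<comment> \<open>The side that comes last in the exceptional order. Going around the polygon from
    it will produce a later side.\<close>
  obtain e where e: "e \<in> Mx" "\<And>e'. e' \<in> Mx \<Longrightarrow> r e' \<le> r e"
    using finite_max_obtains[OF finM neM, of r] by blast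
  obtain s t where st: "e = (s, t)" by fastforce
  have eD: "(s, t) \<in> D'" using e(1) st MD by auto
  then have sD: "(s, t) \<in> D" "p \<le> s" "s < t" "t \<le> k" "(s, t) \<noteq> (p, k)"
    by (auto simp: D'_def strands_in_def)
  \<comment> \<open>Otherwise the side over the gap at t starts exactly at t: starting earlier, it
    would contain (s, t) or cross it. But then it comes after (s, t).\<close>
  have "t = k"
  proof (rule ccontr)
    assume "t \<noteq> k"
    then have tk: "p \<le> t" "t < k" using sD by auto
    obtain s' t' where s': "(s', t') \<in> Mx" "s' \<le> t" "t < t'" using covM[OF tk] by blast
    then have sD': "(s', t') \<in> D'" using MD by auto
    have a: "\<not> s' \<le> s" using e(1) st s' sD' unfolding Mx_def by auto
    have b: "\<not> s' < t"
    proof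
      assume "s' < t"
      then show False
        using excs_noncrossing[OF D, of s t s' t'] sD s'(3) sD' a by (simp add: D'_def)
    qed
    have "s' = t" using a b s'(2) by linarith
    then have "r (s, t) < r (s', t')"
      using sD' s' sD by (intro excs_before[OF D]) (auto simp: D'_def perp_def)
    then show False using e(2)[OF s'(1)] st by simp
  qed
  \<comment> \<open>Closing the cycle: a strand that ends at k precedes the longer (p, k), and (p,
    k) precedes the shorter side that starts at p.\<close>
  then have "r (s, t) < r (p, k)"
    using sD R by (intro excs_before[OF D]) (auto simp: perp_def)
  moreover obtain s0 t0 where s0: "(s0, t0) \<in> Mx" "s0 \<le> p" "p < t0" using covM[of p] pk by blast
  then have "(s0, t0) \<in> D'" using MD by auto
  then have "s0 = p" "t0 < k" "(s0, t0) \<in> D" using s0 by (auto simp: D'_def strands_in_def)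
  then have "r (p, k) < r (s0, t0)"
    using R s0 by (intro excs_before[OF D]) (auto simp: perp_def)
  ultimately show False using e(2)[OF s0(1)] st by simp
qed

text \<open>With (p, k) the longest strand at p, a strand straddling k would cross it or be longer
  at p. What lies below (p, k) is separated by the cut between x and x + 1. The three pieces become
  the subtrees a, b and c.\<close>

lemma split_right:
  assumes D: "excs r D" and sub: "D \<subseteq> strands_in p q" and ne: "(p, k0) \<in> D"
  obtains k x where "p \<le> x" "x < k" "k \<le> q" "(p, k) \<in> D"
    "D = insert (p, k) (D \<inter> strands_in p x \<union> D \<inter> strands_in (x + 1) k \<union> D \<inter> strands_in k q)"
proof -
  have fin: "finite {k. (p, k) \<in> D}"
    by (rule finite_subset[of _ "{..q}"]) (use sub in \<open>auto simp: strands_in_def\<close>)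
  define k where "k = Max {k. (p, k) \<in> D}"
  have kD: "(p, k) \<in> D" and kmax: "\<And>k'. (p, k') \<in> D \<Longrightarrow> k' \<le> k"
    using Max_in[OF fin] Max_ge[OF fin] ne unfolding k_def by auto
  have pk: "p < k" "k \<le> q" using kD sub by (auto simp: strands_in_def)
  obtain x where x: "p \<le> x" "x < k"
    and cut: "\<And>s t. (s, t) \<in> D \<inter> strands_in p k - {(p, k)} \<Longrightarrow> t \<le> x \<or> x < s"
    using exists_cut[OF D kD pk(1)] by blast
  have "D \<subseteq> insert (p, k) (D \<inter> strands_in p x \<union> D \<inter> strands_in (x + 1) k \<union> D \<inter> strands_in k q)"
  proof (rule subrelI)
    fix s t assume st: "(s, t) \<in> D"
    then have b: "p \<le> s" "s < t" "t \<le> q" using sub by (auto simp: strands_in_def)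
    have "\<not> (s < k \<and> k < t)"
      using excs_noncrossing[OF D kD st] kmax st b
      by (metis le_neq_implies_less not_le)
    then show "(s, t) \<in> insert (p, k) (D \<inter> strands_in p x \<union> D \<inter> strands_in (x + 1) k \<union> D \<inter> strands_in k q)"
      using cut[of s t] st b by (auto simp: strands_in_def)
  qed
  then show thesis using that[OF x pk(2) kD] kD by blast
qed

text \<open>The mirror image of \<open>split_right\<close>. As \<open>perp\<close> treats the two
  ends of an interval differently, it is proved directly and not by reflection.\<close>

lemma split_left:
  assumes D: "excs r D" and sub: "D \<subseteq> strands_in p q" and ne: "(k0, q) \<in> D"
  obtains k x where "p \<le> k" "k \<le> x" "x < q" "(k, q) \<in> D"
    "D = insert (k, q) (D \<inter> strands_in p k \<union> D \<inter> strands_in k x \<union> D \<inter> strands_in (x + 1) q)"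
proof -
  define k where "k = (LEAST k. (k, q) \<in> D)"
  have kD: "(k, q) \<in> D" and kmin: "\<And>k'. (k', q) \<in> D \<Longrightarrow> k \<le> k'"
    using LeastI[of "\<lambda>k. (k, q) \<in> D"] Least_le[of "\<lambda>k. (k, q) \<in> D"] ne unfolding k_def by auto
  have pk: "p \<le> k" "k < q" using kD sub by (auto simp: strands_in_def)
  obtain x where x: "k \<le> x" "x < q"
    and cut: "\<And>s t. (s, t) \<in> D \<inter> strands_in k q - {(k, q)} \<Longrightarrow> t \<le> x \<or> x < s"
    using exists_cut[OF D kD pk(2)] by blast
  have "D \<subseteq> insert (k, q) (D \<inter> strands_in p k \<union> D \<inter> strands_in k x \<union> D \<inter> strands_in (x + 1) q)"
  proof (rule subrelI)
    fix s t assume st: "(s, t) \<in> D"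
    then have b: "p \<le> s" "s < t" "t \<le> q" using sub by (auto simp: strands_in_def)
    have "\<not> (s < k \<and> k < t)"
      using excs_noncrossing[OF D st kD] kmin st b
      by (metis le_neq_implies_less not_le)
    then show "(s, t) \<in> insert (k, q) (D \<inter> strands_in p k \<union> D \<inter> strands_in k x \<union> D \<inter> strands_in (x + 1) q)"
      using cut[of s t] st b by (auto simp: strands_in_def)
  qed
  then show thesis using that[OF pk(1) x kD] kD by blast
qed

lemma card_parts_le:
  assumes "finite A" "finite B" "finite C" "D = insert X (A \<union> B \<union> C)"
  shows "card D \<le> 1 + card A + card B + card C"
proof -
  have "card D \<le> Suc (card (A \<union> B \<union> C))" using assms by (simp add: card_insert_if)
  also have "\<dots> \<le> 1 + card A + card B + card C"
    using card_Un_le[of "A \<union> B" C] card_Un_le[of A B] by simp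
  finally show ?thesis .
qed

lemma card_excs_le:
  assumes "excs r D" "D \<subseteq> strands_in p q"
  shows "card D \<le> q - p"
  using assms
proof (induction "q - p" arbitrary: D p q rule: less_induct)
  case less
  show ?case
  proof (cases "\<exists>k. (p, k) \<in> D")
    case False
    then have sub: "D \<subseteq> strands_in (Suc p) q"
      using less.prems(2) by (auto simp: strands_in_def subset_iff) (metis le_neq_implies_less Suc_leI)
    show ?thesis
    proof (cases "p < q")
      case True
      then have "card D \<le> q - Suc p" using less.hyps[OF _ less.prems(1) sub] by simp
      then show ?thesis by simp
    next
      case False
      then have "D = {}" using sub by (auto simp: strands_in_def)
      then show ?thesis by simp
    qed
  next
    case True
    then obtain k0 where "(p, k0) \<in> D" by blast
    from split_right[OF less.prems this] obtain k x where x: "p \<le> x" "x < k" "k \<le> q"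
      and eq: "D = insert (p, k) (D \<inter> strands_in p x \<union> D \<inter> strands_in (x + 1) k \<union> D \<inter> strands_in k q)"
      by metis
    have "card D \<le> 1 + card (D \<inter> strands_in p x) + card (D \<inter> strands_in (x + 1) k) + card (D \<inter> strands_in k q)"
      using eq finite_strands_in by (intro card_parts_le) auto
    moreover have "card (D \<inter> strands_in p' q') \<le> q' - p'" if "q' - p' < q - p" for p' q'
      using that excs_subset[OF less.prems(1)] by (intro less.hyps) auto
    from this[of x p] this[of k "x+1"] this[of q k]
    have "card (D \<inter> strands_in p x) \<le> x - p" "card (D \<inter> strands_in (x + 1) k) \<le> k - (x + 1)"
      "card (D \<inter> strands_in k q) \<le> q - k" using x by auto
    ultimately show ?thesis using x by linarith
  qed
qed

section \<open>Ternary trees drawn as arcs on consecutive vertices\<close>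

datatype tern = Leaf | Node tern tern tern

primrec nnodes :: "tern \<Rightarrow> nat" where
  "nnodes Leaf = 0"
| "nnodes (Node a b c) = nnodes a + nnodes b + nnodes c + 1"

text \<open>To the left the subtraction is truncated at 0; the hypothesis
  \<open>r \<or> nnodes T \<le> v\<close> of later lemmas keeps blocks within the natural
  numbers.\<close>

definition far :: "bool \<Rightarrow> nat \<Rightarrow> nat \<Rightarrow> nat" where
  "far r v m = (if r then v + m else v - m)"

definition strand :: "nat \<times> nat \<Rightarrow> nat \<times> nat" where
  "strand = (\<lambda>(u, w). (min u w, max u w))"

text \<open>
  A tree with base vertex \<open>v\<close> occupies the \<open>nnodes T + 1\<close> consecutive vertices to the right
  (\<open>r = True\<close>) or to the left of \<open>v\<close>; each strand is recorded as an arc pointing away from the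
  vertex \<open>0\<close>.
\<close>

primrec arcs :: "bool \<Rightarrow> nat \<Rightarrow> tern \<Rightarrow> (nat \<times> nat) set" where
  "arcs r v Leaf = {}"
| "arcs r v (Node a b c) = (let w = far r v (Suc (nnodes a + nnodes b)) in
     insert (v, w) (arcs r v a \<union> arcs (\<not> r) w b \<union> arcs r w c))"

definition cover :: "bool \<Rightarrow> nat \<Rightarrow> tern \<Rightarrow> nat set" where
  "cover r v T = (if r then {v..v + nnodes T} else {v - nnodes T..v})"

definition diagram :: "bool \<Rightarrow> nat \<Rightarrow> tern \<Rightarrow> (nat \<times> nat) set" where
  "diagram r v T = strand ` arcs r v T"

lemma diagram_Leaf [simp]: "diagram r v Leaf = {}"
  by (simp add: diagram_def)

lemma diagram_Node:
  "diagram r v (Node a b c) = (let w = far r v (Suc (nnodes a + nnodes b)) in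
     insert (strand (v, w)) (diagram r v a \<union> diagram (\<not> r) w b \<union> diagram r w c))"
  by (simp add: diagram_def Let_def image_Un)

text \<open>Both directions are proved together because the subtree b hangs at the far end of the
  root strand and is drawn in the opposite direction.\<close>

lemma excs_imp_diagram:
  assumes "excs r D" "D \<subseteq> strands_in p q" "p \<le> q" "card D = q - p"
  shows "(\<exists>T. nnodes T = q - p \<and> diagram True p T = D) \<and> (\<exists>T. nnodes T = q - p \<and> diagram False q T = D)"
  using assms
proof (induction "q - p" arbitrary: D p q rule: less_induct)
  case less
  show ?case
  proof (cases "p = q")
    case True
    then have "D = {}" using less.prems(2) by (auto simp: strands_in_def)
    then show ?thesis using True by (auto intro!: exI[of _ Leaf])
  next
    case False
    then have pq: "p < q" using less.prems by simp
    note le = card_excs_le[OF excs_subset[OF less.prems(1) Int_lower1] Int_lower2]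
    have IH: "(\<exists>T. nnodes T = q' - p' \<and> diagram True p' T = D \<inter> strands_in p' q') \<and>
              (\<exists>T. nnodes T = q' - p' \<and> diagram False q' T = D \<inter> strands_in p' q')"
      if "q' - p' < q - p" "p' \<le> q'" "card (D \<inter> strands_in p' q') = q' - p'" for p' q'
      using that excs_subset[OF less.prems(1)] by (intro less.hyps) auto
    \<comment> \<open>Otherwise all q - p strands would lie on the vertices p + 1, ..., q, too few
      by \<open>card_excs_le\<close>.\<close>
    have "\<exists>k. (p, k) \<in> D"
    proof (rule ccontr)
      assume "\<not> ?thesis"
      then have "D \<subseteq> strands_in (Suc p) q"
        using less.prems(2) by (auto simp: strands_in_def subset_iff) (metis le_neq_implies_less Suc_leI)
      then show False using card_excs_le[OF less.prems(1), of "Suc p" q] pq less.prems(4) by simp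
    qed
    moreover have "\<exists>k. (k, q) \<in> D"
    proof (rule ccontr)
      assume "\<not> ?thesis"
      then have "t \<noteq> q" if "(s, t) \<in> D" for s t using that by auto
      then have "t \<le> q - 1" if "(s, t) \<in> D" for s t
        using that less.prems(2) by (fastforce simp: strands_in_def)
      then have "D \<subseteq> strands_in p (q - 1)"
        using less.prems(2) by (auto simp: strands_in_def)
      then show False using card_excs_le[OF less.prems(1), of p "q - 1"] pq less.prems(4) by simp
    qed
    ultimately obtain k1 k2 where k12: "(p, k1) \<in> D" "(k2, q) \<in> D" by blast
    have R: "\<exists>T. nnodes T = q - p \<and> diagram True p T = D"
    proof -
      from split_right[OF less.prems(1,2) k12(1)] obtain k x where x: "p \<le> x" "x < k" "k \<le> q"
        and eq: "D = insert (p, k) (D \<inter> strands_in p x \<union> D \<inter> strands_in (x + 1) k \<union> D \<inter> strands_in k q)"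
        by metis
      have "card D \<le> 1 + card (D \<inter> strands_in p x) + card (D \<inter> strands_in (x + 1) k) + card (D \<inter> strands_in k q)"
        using eq finite_strands_in by (intro card_parts_le) auto
      \<comment> \<open>The upper bounds for the pieces add up to \<open>card D\<close>, so each of
        them is attained.\<close>
      then have c: "card (D \<inter> strands_in p x) = x - p" "card (D \<inter> strands_in (x + 1) k) = k - (x + 1)"
        "card (D \<inter> strands_in k q) = q - k"
        using le[of p x] le[of "x+1" k] le[of k q] x less.prems(4) by linarith+
      have lt: "x - p < q - p" "k - (x + 1) < q - p" "q - k < q - p" using x by arith+
      obtain a where a: "nnodes a = x - p" "diagram True p a = D \<inter> strands_in p x"
        using IH[OF lt(1) _ c(1)] x by auto
      obtain b where b: "nnodes b = k - (x + 1)" "diagram False k b = D \<inter> strands_in (x + 1) k"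
        using IH[OF lt(2) _ c(2)] x by auto
      obtain c' where c': "nnodes c' = q - k" "diagram True k c' = D \<inter> strands_in k q"
        using IH[OF lt(3) _ c(3)] x by auto
      \<comment> \<open>The block of a fills p, ..., x and that of b fills x + 1, ..., k, hence the
        distance \<open>nnodes a + nnodes b + 1\<close> from p to k.\<close>
      have "far True p (Suc (nnodes a + nnodes b)) = k" using a b x by (simp add: far_def)
      then have "diagram True p (Node a b c') =
          insert (p, k) (D \<inter> strands_in p x \<union> D \<inter> strands_in (x + 1) k \<union> D \<inter> strands_in k q)"
        using a(2) b(2) c'(2) x by (simp add: diagram_Node strand_def Un_ac)
      moreover have "nnodes (Node a b c') = q - p"
        using a(1) b(1) c'(1) x by simp
      ultimately show ?thesis using eq by (intro exI[of _ "Node a b c'"]) simp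
    qed
    have L: "\<exists>T. nnodes T = q - p \<and> diagram False q T = D"
    proof -
      from split_left[OF less.prems(1,2) k12(2)] obtain k x where x: "p \<le> k" "k \<le> x" "x < q"
        and eq: "D = insert (k, q) (D \<inter> strands_in p k \<union> D \<inter> strands_in k x \<union> D \<inter> strands_in (x + 1) q)"
        by metis
      have "card D \<le> 1 + card (D \<inter> strands_in p k) + card (D \<inter> strands_in k x) + card (D \<inter> strands_in (x + 1) q)"
        using eq finite_strands_in by (intro card_parts_le) auto
      then have c: "card (D \<inter> strands_in p k) = k - p" "card (D \<inter> strands_in k x) = x - k"
        "card (D \<inter> strands_in (x + 1) q) = q - (x + 1)"
        using le[of p k] le[of "x+1" q] le[of k x] x less.prems(4) by linarith+
      have lt: "k - p < q - p" "x - k < q - p" "q - (x + 1) < q - p" using x by arith+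
      obtain a where a: "nnodes a = q - (x + 1)" "diagram False q a = D \<inter> strands_in (x + 1) q"
        using IH[OF lt(3) _ c(3)] x by auto
      obtain b where b: "nnodes b = x - k" "diagram True k b = D \<inter> strands_in k x"
        using IH[OF lt(2) _ c(2)] x by auto
      obtain c' where c': "nnodes c' = k - p" "diagram False k c' = D \<inter> strands_in p k"
        using IH[OF lt(1) _ c(1)] x by auto
      have "far False q (Suc (nnodes a + nnodes b)) = k" using a b x by (simp add: far_def)
      then have "diagram False q (Node a b c') =
          insert (k, q) (D \<inter> strands_in p k \<union> D \<inter> strands_in k x \<union> D \<inter> strands_in (x + 1) q)"
        using a(2) b(2) c'(2) x by (simp add: diagram_Node strand_def Un_ac)
      moreover have "nnodes (Node a b c') = q - p"
        using a(1) b(1) c'(1) x by simp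
      ultimately show ?thesis using eq by (intro exI[of _ "Node a b c'"]) simp
    qed
    show ?thesis using R L by blast
  qed
qed

text \<open>That no arc ends in the base v is what makes v the root of the tree of arcs.\<close>

lemma arcs_cover:
  assumes "(u, x) \<in> arcs r v T" "r \<or> nnodes T \<le> v"
  shows "u \<in> cover r v T" "x \<in> cover r v T" "x \<noteq> v" "u \<noteq> x"
proof -
  have "u \<in> cover r v T \<and> x \<in> cover r v T \<and> x \<noteq> v \<and> u \<noteq> x"
    using assms
  proof (induction T arbitrary: r v)
    case (Node a b c)
    define w where "w = far r v (Suc (nnodes a + nnodes b))"
    have val: "r \<or> nnodes a \<le> v" "\<not> r \<or> nnodes b \<le> w" "r \<or> nnodes c \<le> w"
      using Node.prems(2) by (auto simp: w_def far_def)
    have "(u, x) = (v, w) \<or> (u, x) \<in> arcs r v a \<or> (u, x) \<in> arcs (\<not> r) w b \<or> (u, x) \<in> arcs r w c"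
      using Node.prems(1) by (auto simp: Let_def w_def)
    then consider "(u, x) = (v, w)" | "(u, x) \<in> arcs r v a" | "(u, x) \<in> arcs (\<not> r) w b"
      | "(u, x) \<in> arcs r w c" by blast
    then show ?case
    proof cases
      case 1
      then show ?thesis using Node.prems(2)
        by (cases r) (auto simp: w_def far_def cover_def)
    next
      case 2
      then show ?thesis using Node.IH(1)[OF 2 val(1)] Node.prems(2)
        by (cases r) (auto simp: w_def far_def cover_def)
    next
      case 3
      then show ?thesis using Node.IH(2)[OF 3 val(2)] Node.prems(2)
        by (cases r) (auto simp: w_def far_def cover_def)
    next
      case 4
      then show ?thesis using Node.IH(3)[OF 4 val(3)] Node.prems(2)
        by (cases r) (auto simp: w_def far_def cover_def)
    qed
  qed simp
  then show "u \<in> cover r v T" "x \<in> cover r v T" "x \<noteq> v" "u \<noteq> x" by auto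
qed

lemma diagram_cover:
  assumes "X \<in> diagram r v T" "r \<or> nnodes T \<le> v"
  shows "fst X \<in> cover r v T" "snd X \<in> cover r v T" "fst X < snd X"
proof -
  obtain u x where X: "X = strand (u, x)" "(u, x) \<in> arcs r v T"
    using assms(1) by (auto simp: diagram_def)
  show "fst X \<in> cover r v T" "snd X \<in> cover r v T" "fst X < snd X"
    using arcs_cover[OF X(2) assms(2)] by (auto simp: X(1) strand_def min_def max_def)
qed

text \<open>The block of \<open>T\<close> based at \<open>v\<close> meets the rest of the diagram \<open>D\<close> only in \<open>v\<close>.\<close>

definition block :: "(nat \<times> nat) set \<Rightarrow> bool \<Rightarrow> nat \<Rightarrow> tern \<Rightarrow> bool" where
  "block D r v T \<longleftrightarrow> (r \<or> nnodes T \<le> v) \<and> diagram r v T \<subseteq> D \<and>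
     (\<forall>X\<in>D. fst X \<in> cover r v T - {v} \<or> snd X \<in> cover r v T - {v} \<longrightarrow> X \<in> diagram r v T)"

text \<open>The vertex sets of the three subtrees are disjoint except for w, the common base of b
  and c, and (v, w) meets each of them at most in its base. So a strand that touches one subtree off
  its base cannot belong to another part.\<close>

lemma block_sub:
  assumes "block D r v (Node a b c)"
  defines "w \<equiv> far r v (Suc (nnodes a + nnodes b))"
  shows "block D r v a" "block D (\<not> r) w b" "block D r w c"
proof -
  note B = assms(1)[unfolded block_def]
  have val: "r \<or> nnodes a \<le> v" "\<not> r \<or> nnodes b \<le> w" "r \<or> nnodes c \<le> w"
    using B by (auto simp: w_def far_def)
  have sub: "strand (v, w) \<in> D" "diagram r v a \<subseteq> D" "diagram (\<not> r) w b \<subseteq> D" "diagram r w c \<subseteq> D"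
    using B by (auto simp: diagram_Node Let_def w_def)
  have cov: "cover r v a \<inter> cover (\<not> r) w b = {}" "cover r v a \<inter> cover r w c = {}"
     "cover (\<not> r) w b \<inter> cover r w c \<subseteq> {w}" "w \<notin> cover r v a" "v \<notin> cover (\<not> r) w b" "v \<notin> cover r w c"
     "cover r v a \<subseteq> cover r v (Node a b c)" "cover (\<not> r) w b \<subseteq> cover r v (Node a b c)"
     "cover r w c \<subseteq> cover r v (Node a b c)"
    using B by (cases r; auto simp: w_def far_def cover_def)+
  have parts: "X = strand (v, w) \<or> X \<in> diagram r v a \<or> X \<in> diagram (\<not> r) w b \<or> X \<in> diagram r w c"
    if "X \<in> D" "fst X \<in> cover r v (Node a b c) - {v} \<or> snd X \<in> cover r v (Node a b c) - {v}" for X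
    using B that by (auto simp: diagram_Node Let_def w_def)
  have ends: "fst (strand (v, w)) \<in> {v, w}" "snd (strand (v, w)) \<in> {v, w}"
    by (auto simp: strand_def min_def max_def)
  have nin: "X \<notin> diagram r v a" if "fst X \<notin> cover r v a \<or> snd X \<notin> cover r v a" for X
    using that diagram_cover[of X r v a] val by blast
  have nin': "X \<notin> diagram (\<not> r) w b" if "fst X \<notin> cover (\<not> r) w b \<or> snd X \<notin> cover (\<not> r) w b" for X
    using that diagram_cover[of X "\<not> r" w b] val by blast
  have nin'': "X \<notin> diagram r w c" if "fst X \<notin> cover r w c \<or> snd X \<notin> cover r w c" for X
    using that diagram_cover[of X r w c] val by blast
  have "X \<in> diagram r v a"
    if X: "X \<in> D" "fst X \<in> cover r v a - {v} \<or> snd X \<in> cover r v a - {v}" for X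
  proof -
    have "X \<noteq> strand (v, w)" using X(2) cov ends by auto
    moreover have "X \<notin> diagram (\<not> r) w b" using X(2) cov by (intro nin') auto
    moreover have "X \<notin> diagram r w c" using X(2) cov by (intro nin'') auto
    moreover have "X = strand (v, w) \<or> X \<in> diagram r v a \<or> X \<in> diagram (\<not> r) w b \<or> X \<in> diagram r w c"
      using X cov by (intro parts) auto
    ultimately show ?thesis by blast
  qed
  then show "block D r v a" unfolding block_def using val(1) sub(2) by blast
  have "X \<in> diagram (\<not> r) w b"
    if X: "X \<in> D" "fst X \<in> cover (\<not> r) w b - {w} \<or> snd X \<in> cover (\<not> r) w b - {w}" for X
  proof -
    have "X \<noteq> strand (v, w)" using X(2) cov ends by auto
    moreover have "X \<notin> diagram r v a" using X(2) cov by (intro nin) auto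
    moreover have "X \<notin> diagram r w c" using X(2) cov by (intro nin'') auto
    moreover have "X = strand (v, w) \<or> X \<in> diagram r v a \<or> X \<in> diagram (\<not> r) w b \<or> X \<in> diagram r w c"
      using X cov by (intro parts) auto
    ultimately show ?thesis by blast
  qed
  then show "block D (\<not> r) w b" unfolding block_def using val(2) sub(3) by blast
  have "X \<in> diagram r w c"
    if X: "X \<in> D" "fst X \<in> cover r w c - {w} \<or> snd X \<in> cover r w c - {w}" for X
  proof -
    have "X \<noteq> strand (v, w)" using X(2) cov ends by auto
    moreover have "X \<notin> diagram r v a" using X(2) cov by (intro nin) auto
    moreover have "X \<notin> diagram (\<not> r) w b" using X(2) cov by (intro nin') auto
    moreover have "X = strand (v, w) \<or> X \<in> diagram r v a \<or> X \<in> diagram (\<not> r) w b \<or> X \<in> diagram r w c"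
      using X cov by (intro parts) auto
    ultimately show ?thesis by blast
  qed
  then show "block D r w c" unfolding block_def using val(3) sub(4) by blast
qed

section \<open>Reading the children of a node off the diagram\<close>

primrec root_strand :: "bool \<Rightarrow> nat \<Rightarrow> tern \<Rightarrow> (nat \<times> nat) option" where
  "root_strand r v Leaf = None"
| "root_strand r v (Node a b c) = Some (strand (v, far r v (Suc (nnodes a + nnodes b))))"

text \<open>Among the strands at v the root strand of the block is the longest: the strands of a end
  before w, and those of b and c do not contain v.\<close>

lemma pick_right:
  assumes B: "block D True v T"
  shows "pick Max (\<lambda>x. (v, x)) {x. v < x \<and> x \<le> v + nnodes T \<and> (v, x) \<in> D} = root_strand True v T"
proof (cases T)
  case Leaf
  then have "{x. v < x \<and> x \<le> v + nnodes T \<and> (v, x) \<in> D} = {}" by auto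
  then show ?thesis using Leaf by (simp add: pick_def)
next
  case (Node a b c)
  let ?A = "{x. v < x \<and> x \<le> v + nnodes T \<and> (v, x) \<in> D}"
  define w where "w = v + (Suc (nnodes a + nnodes b))"
  have "strand (v, w) \<in> D" using B by (simp add: block_def Node diagram_Node far_def w_def Let_def)
  then have wA: "w \<in> ?A" using Node by (auto simp: w_def strand_def)
  have le: "x \<le> w" if "x \<in> ?A" for x
  proof -
    have "(v, x) \<in> diagram True v T" using B that by (auto simp: block_def cover_def)
    then consider "(v, x) = strand (v, w)" | "(v, x) \<in> diagram True v a" | "(v, x) \<in> diagram False w b"
      | "(v, x) \<in> diagram True w c"
      by (auto simp: Node diagram_Node far_def w_def Let_def)
    then show ?thesis
    proof cases
      case 1 then show ?thesis by (auto simp: strand_def w_def)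
    next
      case 2 then show ?thesis using diagram_cover[OF 2] by (auto simp: cover_def w_def)
    next
      case 3 then show ?thesis using diagram_cover[OF 3] by (auto simp: cover_def w_def)
    next
      case 4 then show ?thesis using diagram_cover[OF 4] by (auto simp: cover_def w_def)
    qed
  qed
  have "Max ?A = w" using wA le by (intro Max_eqI) (auto intro: finite_subset[of _ "{..w}"])
  moreover have "?A \<noteq> {}" using wA by blast
  ultimately have "pick Max (\<lambda>x. (v, x)) ?A = Some (v, w)" by (simp only: pick_def if_False)
  then show ?thesis by (simp add: Node far_def w_def strand_def)
qed

lemma pick_left:
  assumes B: "block D False v T"
  shows "pick Min (\<lambda>x. (x, v)) {x. v - nnodes T \<le> x \<and> x < v \<and> (x, v) \<in> D} = root_strand False v T"
proof (cases T)
  case Leaf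
  then have "{x. v - nnodes T \<le> x \<and> x < v \<and> (x, v) \<in> D} = {}" by auto
  then show ?thesis using Leaf by (simp add: pick_def)
next
  case (Node a b c)
  let ?A = "{x. v - nnodes T \<le> x \<and> x < v \<and> (x, v) \<in> D}"
  define w where "w = v - (Suc (nnodes a + nnodes b))"
  have val: "nnodes T \<le> v" using B by (simp add: block_def)
  have "strand (v, w) \<in> D" using B by (simp add: block_def Node diagram_Node far_def w_def Let_def)
  moreover have lt: "w < v" "v - nnodes T \<le> w" using Node val by (auto simp: w_def)
  ultimately have wA: "w \<in> ?A" by (simp add: strand_def)
  have le: "w \<le> x" if "x \<in> ?A" for x
  proof -
    have "(x, v) \<in> diagram False v T" using B that by (auto simp: block_def cover_def)
    then consider "(x, v) = strand (v, w)" | "(x, v) \<in> diagram False v a" | "(x, v) \<in> diagram True w b"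
      | "(x, v) \<in> diagram False w c"
      by (auto simp: Node diagram_Node far_def w_def Let_def)
    then show ?thesis
    proof cases
      case 1 then show ?thesis by (auto simp: strand_def w_def)
    next
      case 2 then show ?thesis using diagram_cover[OF 2] val Node by (auto simp: cover_def w_def)
    next
      case 3 then show ?thesis using diagram_cover[OF 3] val Node by (auto simp: cover_def w_def)
    next
      case 4
      have "nnodes c \<le> w" using val Node by (simp add: w_def)
      then show ?thesis using diagram_cover(2)[OF 4] lt by (simp add: cover_def)
    qed
  qed
  have "Min ?A = w" using wA le by (intro Min_eqI) (auto intro: finite_subset[of _ "{..v}"])
  moreover have "?A \<noteq> {}" using wA by blast
  ultimately have "pick Min (\<lambda>x. (x, v)) ?A = Some (w, v)" by (simp only: pick_def if_False)
  then show ?thesis by (simp add: Node far_def w_def strand_def)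
qed

text \<open>\<open>child\<close> searches all of D. The block property confines each search to the
  vertices of one subtree, where \<open>pick_right\<close> and \<open>pick_left\<close> find the
  root strand.\<close>

lemma child_block:
  assumes B: "block D r v (Node a b c)"
  defines "w \<equiv> far r v (Suc (nnodes a + nnodes b))"
  assumes R: "oriented_right D (strand (v, w)) = r"
  shows "child D (strand (v, w)) La = root_strand r v a"
    "child D (strand (v, w)) Lb = root_strand (\<not> r) w b"
    "child D (strand (v, w)) Lc = root_strand r w c"
proof -
  note bs = block_sub[OF B, folded w_def]
  have "child D (strand (v, w)) La = root_strand r v a \<and>
    child D (strand (v, w)) Lb = root_strand (\<not> r) w b \<and>
    child D (strand (v, w)) Lc = root_strand r w c"
  proof (cases r)
    case True
    have w: "w = v + (Suc (nnodes a + nnodes b))" using True by (simp add: w_def far_def)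
    have st: "strand (v, w) = (v, w)" using w by (simp add: strand_def)
    have ba: "block D True v a" and bb: "block D False w b" and bc: "block D True w c"
      using bs True by auto
    \<comment> \<open>A strand from v that ends beyond a but before w would touch the block of b off
      its base, hence belong to it, although v is not a vertex of b.\<close>
    have dba: "x \<le> v + nnodes a" if "x < w" "(v, x) \<in> D" for x
    proof (rule ccontr)
      assume "\<not> ?thesis"
      then have "(v, x) \<in> diagram False w b" using bb that w by (auto simp: block_def cover_def)
      from diagram_cover[OF this] bb w show False by (auto simp: block_def cover_def)
    qed
    have dbb: "w - nnodes b \<le> y" if "v < y" "(y, w) \<in> D" for y
    proof (rule ccontr)
      assume "\<not> ?thesis"
      then have "(y, w) \<in> diagram True v a" using ba that w by (auto simp: block_def cover_def)
      from diagram_cover[OF this] w show False by (auto simp: cover_def)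
    qed
    have dbc: "z \<le> w + nnodes c" if "w < z" "(w, z) \<in> D" for z
    proof -
      have "(w, z) \<in> diagram True v (Node a b c)" using B that w True by (auto simp: block_def cover_def)
      from diagram_cover[OF this] w show ?thesis by (auto simp: cover_def)
    qed
    have "{x. v < x \<and> x < w \<and> (v, x) \<in> D} = {x. v < x \<and> x \<le> v + nnodes a \<and> (v, x) \<in> D}"
      using dba w by auto
    moreover have "{y. v < y \<and> y < w \<and> (y, w) \<in> D} = {y. w - nnodes b \<le> y \<and> y < w \<and> (y, w) \<in> D}"
      using dbb w by auto
    moreover have "{z. w < z \<and> (w, z) \<in> D} = {z. w < z \<and> z \<le> w + nnodes c \<and> (w, z) \<in> D}"
      using dbc by auto
    ultimately show ?thesis
      using R True st pick_right[OF ba] pick_left[OF bb] pick_right[OF bc] by (simp add: child_def)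
  next
    case False
    have v: "nnodes a + nnodes b + nnodes c + 1 \<le> v" using B False by (simp add: block_def)
    have w: "w = v - (Suc (nnodes a + nnodes b))" using False by (simp add: w_def far_def)
    have wv: "w + nnodes a + nnodes b + 1 = v" "nnodes c \<le> w" using v w by auto
    have st: "strand (v, w) = (w, v)" using wv by (simp add: strand_def)
    have ba: "block D False v a" and bb: "block D True w b" and bc: "block D False w c"
      using bs False by auto
    have dba: "v - nnodes a \<le> x" if "w < x" "(x, v) \<in> D" for x
    proof (rule ccontr)
      assume "\<not> ?thesis"
      then have "(x, v) \<in> diagram True w b" using bb that wv by (auto simp: block_def cover_def)
      from diagram_cover[OF this] wv show False by (auto simp: block_def cover_def)
    qed
    have dbb: "y \<le> w + nnodes b" if "y < v" "(w, y) \<in> D" for y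
    proof (rule ccontr)
      assume "\<not> ?thesis"
      then have "(w, y) \<in> diagram False v a" using ba that wv by (auto simp: block_def cover_def)
      from diagram_cover[OF this] wv show False by (auto simp: cover_def)
    qed
    have dbc: "w - nnodes c \<le> z" if "z < w" "(z, w) \<in> D" for z
    proof -
      have "(z, w) \<in> diagram False v (Node a b c)" using B that wv False by (auto simp: block_def cover_def)
      from diagram_cover[OF this] wv show ?thesis by (auto simp: cover_def)
    qed
    have "{x. w < x \<and> x < v \<and> (x, v) \<in> D} = {x. v - nnodes a \<le> x \<and> x < v \<and> (x, v) \<in> D}"
      using dba wv by auto
    moreover have "{y. w < y \<and> y < v \<and> (w, y) \<in> D} = {y. w < y \<and> y \<le> w + nnodes b \<and> (w, y) \<in> D}"
      using dbb wv by auto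
    moreover have "{z. z < w \<and> (z, w) \<in> D} = {z. w - nnodes c \<le> z \<and> z < w \<and> (z, w) \<in> D}"
      using dbc by auto
    ultimately show ?thesis
      using R False st pick_left[OF ba] pick_right[OF bb] pick_left[OF bc] by (simp add: child_def)
  qed
  then show "child D (strand (v, w)) La = root_strand r v a"
    "child D (strand (v, w)) Lb = root_strand (\<not> r) w b"
    "child D (strand (v, w)) Lc = root_strand r w c" by auto
qed

section \<open>Orientation of strands through paths from 0\<close>

lemma arcs_unique_parent:
  assumes "(u, x) \<in> arcs r v T" "(u', x) \<in> arcs r v T" "r \<or> nnodes T \<le> v"
  shows "u = u'"
  using assms
proof (induction T arbitrary: r v)
  case (Node a b c)
  define w where "w = far r v (Suc (nnodes a + nnodes b))"
  have val: "r \<or> nnodes a \<le> v" "\<not> r \<or> nnodes b \<le> w" "r \<or> nnodes c \<le> w"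
    using Node.prems by (auto simp: w_def far_def)
  have cov: "cover r v a \<inter> cover (\<not> r) w b = {}" "cover r v a \<inter> cover r w c = {}"
     "cover (\<not> r) w b \<inter> cover r w c \<subseteq> {w}" "w \<notin> cover r v a"
    using Node.prems(3) by (cases r; auto simp: w_def far_def cover_def)+
  have E: "y = v \<and> x = w \<or> (y, x) \<in> arcs r v a \<and> x \<in> cover r v a
      \<or> (y, x) \<in> arcs (\<not> r) w b \<and> x \<in> cover (\<not> r) w b - {w}
      \<or> (y, x) \<in> arcs r w c \<and> x \<in> cover r w c - {w}"
    if "(y, x) \<in> arcs r v (Node a b c)" for y
    using that arcs_cover[of y x r v a] arcs_cover[of y x "\<not> r" w b] arcs_cover[of y x r w c] val
    by (auto simp: Let_def w_def)
  show ?case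
    using E[OF Node.prems(1)] E[OF Node.prems(2)] cov
      Node.IH(1)[of r v, OF _ _ val(1)] Node.IH(2)[of "\<not> r" w, OF _ _ val(2)] Node.IH(3)[of r w, OF _ _ val(3)]
    by blast
qed simp

text \<open>Together with \<open>arcs_unique_parent\<close> this makes the arcs a tree directed away
  from v.\<close>

lemma arcs_reach:
  assumes "x \<in> cover r v T" "r \<or> nnodes T \<le> v"
  shows "(v, x) \<in> (arcs r v T)\<^sup>*"
  using assms
proof (induction T arbitrary: r v)
  case Leaf
  then show ?case by (cases r) (auto simp: cover_def)
next
  case (Node a b c)
  define w where "w = far r v (Suc (nnodes a + nnodes b))"
  have val: "r \<or> nnodes a \<le> v" "\<not> r \<or> nnodes b \<le> w" "r \<or> nnodes c \<le> w"
    using Node.prems by (auto simp: w_def far_def)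
  let ?A = "arcs r v (Node a b c)"
  have sub: "arcs r v a \<subseteq> ?A" "arcs (\<not> r) w b \<subseteq> ?A" "arcs r w c \<subseteq> ?A" "(v, w) \<in> ?A"
    by (auto simp: w_def Let_def)
  have "x \<in> cover r v a \<or> x \<in> cover (\<not> r) w b \<or> x \<in> cover r w c"
    using Node.prems by (cases r) (auto simp: w_def far_def cover_def)
  then consider "x \<in> cover r v a" | "x \<in> cover (\<not> r) w b" | "x \<in> cover r w c" by blast
  then show ?case
  proof cases
    case 1
    then show ?thesis using Node.IH(1)[OF _ val(1)] rtrancl_mono[OF sub(1)] by blast
  next
    case 2
    then have "(w, x) \<in> ?A\<^sup>*" using Node.IH(2)[OF _ val(2)] rtrancl_mono[OF sub(2)] by blast
    then show ?thesis using sub(4) by (meson converse_rtrancl_into_rtrancl)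
  next
    case 3
    then have "(w, x) \<in> ?A\<^sup>*" using Node.IH(3)[OF _ val(3)] rtrancl_mono[OF sub(3)] by blast
    then show ?thesis using sub(4) by (meson converse_rtrancl_into_rtrancl)
  qed
qed

lemma simple_path_snoc:
  assumes "simple_path D u x (p @ [x])" "p \<noteq> []"
  shows "simple_path D u (last p) p" "(last p, x) \<in> D \<or> (x, last p) \<in> D" "x \<notin> set p"
proof -
  have e: "((p @ [x]) ! t, (p @ [x]) ! Suc t) \<in> D \<or> ((p @ [x]) ! Suc t, (p @ [x]) ! t) \<in> D"
    if "Suc t < length (p @ [x])" for t
    using assms(1) that unfolding simple_path_def by blast
  have "(p ! t, p ! Suc t) \<in> D \<or> (p ! Suc t, p ! t) \<in> D" if "Suc t < length p" for t
    using e[of t] that by (simp add: nth_append)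
  then show "simple_path D u (last p) p"
    using assms unfolding simple_path_def by auto
  show "(last p, x) \<in> D \<or> (x, last p) \<in> D"
    using e[of "length p - 1"] assms(2) by (cases p rule: rev_cases) (auto simp: nth_append)
  show "x \<notin> set p" using assms(1) by (simp add: simple_path_def)
qed

lemma simple_path_prefix:
  assumes "simple_path D u y (p @ x # q)"
  shows "simple_path D u x (p @ [x])"
proof -
  have e: "((p @ x # q) ! t, (p @ x # q) ! Suc t) \<in> D \<or> ((p @ x # q) ! Suc t, (p @ x # q) ! t) \<in> D"
    if "Suc t < length (p @ x # q)" for t
    using assms that unfolding simple_path_def by blast
  have "((p @ [x]) ! t, (p @ [x]) ! Suc t) \<in> D \<or> ((p @ [x]) ! Suc t, (p @ [x]) ! t) \<in> D"
    if "Suc t < length (p @ [x])" for t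
  proof -
    have "(p @ [x]) ! t = (p @ x # q) ! t" "(p @ [x]) ! Suc t = (p @ x # q) ! Suc t"
      using that by (auto simp: nth_append nth_Cons')
    then show ?thesis using e[of t] that by simp
  qed
  moreover have "hd (p @ [x]) = hd (p @ x # q)" by (cases p) auto
  ultimately show ?thesis using assms unfolding simple_path_def by auto
qed

text \<open>The definite description in \<open>oriented_right\<close> calls for existence and
  uniqueness of simple paths from 0. Both follow once a simple path from 0 is known to traverse
  every arc forwards, and then the orientation of a strand is the direction of its arc.\<close>

lemma oriented_right_iff:
  assumes D: "D = strand ` O'"
    and irr: "\<And>u x. (u, x) \<in> O' \<Longrightarrow> x \<noteq> 0 \<and> u \<noteq> x"
    and par: "\<And>u u' x. (u, x) \<in> O' \<Longrightarrow> (u', x) \<in> O' \<Longrightarrow> u = u'"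
    and reach: "\<And>u x. (u, x) \<in> O' \<Longrightarrow> (0, u) \<in> O'\<^sup>*"
    and ux: "(u, x) \<in> O'"
  shows "oriented_right D (strand (u, x)) \<longleftrightarrow> u < x"
proof -
  have DO: "(a, b) \<in> D \<Longrightarrow> (a, b) \<in> O' \<or> (b, a) \<in> O'" for a b
    unfolding D by (auto simp: strand_def min_def max_def split: if_splits)
  have OD: "(a, b) \<in> O' \<Longrightarrow> (a, b) \<in> D \<or> (b, a) \<in> D" for a b
    unfolding D by (force simp: strand_def min_def max_def image_iff)
  \<comment> \<open>A backward last step would lead from \<open>last p\<close> to its parent y. By
    induction the path had entered \<open>last p\<close> from its only parent, so y would occur
    twice; and 0 has no parent.\<close>
  have step: "(last p, y) \<in> O'" if "simple_path D 0 y (p @ [y])" "p \<noteq> []" for p y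
    using that
  proof (induction p arbitrary: y rule: length_induct)
    case (1 p)
    note s = simple_path_snoc[OF 1(2,3)]
    show ?case
    proof (rule ccontr)
      assume n: "\<not> ?thesis"
      then have yl: "(y, last p) \<in> O'" using s(2) DO by blast
      obtain q where q: "p = q @ [last p]" using 1(3) by (metis append_butlast_last_id)
      have "q \<noteq> []"
      proof
        assume "q = []"
        then have "last p = hd p" using q by (metis append_Nil list.sel(1))
        then have "last p = 0" using s(1) by (simp add: simple_path_def)
        then show False using irr[OF yl] by simp
      qed
      moreover have "length q < length p" using q by (metis length_append_singleton lessI)
      moreover have "simple_path D 0 (last p) (q @ [last p])" using s(1) q by simp
      ultimately have "(last q, last p) \<in> O'" using 1(1) by blast
      then have "y = last q" using par yl by blast
      then show False using s(3) \<open>q \<noteq> []\<close> q by (metis Un_iff last_in_set set_append)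
    qed
  qed
  \<comment> \<open>Read from the end, each predecessor on a simple path is the parent of its
    successor.\<close>
  have unique: "p = q" if "simple_path D 0 y p" "simple_path D 0 y q" for p q y
    using that
  proof (induction p arbitrary: y q rule: length_induct)
    case (1 p)
    from 1(2,3) obtain p' q' where pq: "p = p' @ [y]" "q = q' @ [y]"
      unfolding simple_path_def by (metis append_butlast_last_id)
    show ?case
    proof (cases "p' = [] \<or> q' = []")
      case True
      then have "y = 0" using 1(2,3) pq by (auto simp: simple_path_def)
      then have "p' = [] \<and> q' = []" using step[of y p'] step[of y q'] irr 1(2,3) pq by blast
      then show ?thesis using pq by simp
    next
      case False
      then have "(last p', y) \<in> O'" "(last q', y) \<in> O'" using step 1(2,3) pq by blast+
      then have l: "last p' = last q'" using par by blast
      have "simple_path D 0 (last p') p'" "simple_path D 0 (last p') q'"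
        using simple_path_snoc(1)[of D 0 y p'] simple_path_snoc(1)[of D 0 y q'] 1(2,3) pq False l by auto
      then show ?thesis using 1(1) pq by simp
    qed
  qed
  have ex: "\<exists>p. simple_path D 0 y p" if "(0, y) \<in> O'\<^sup>*" for y
    using that
  proof (induction rule: rtrancl_induct)
    case base
    show ?case by (rule exI[of _ "[0]"]) (simp add: simple_path_def)
  next
    case (step y z)
    then obtain p where p: "simple_path D 0 y p" by blast
    show ?case
    \<comment> \<open>If z already lies on the path, the path is cut off there instead of being
      prolonged.\<close>
    proof (cases "z \<in> set p")
      case True
      then obtain p1 p2 where "p = p1 @ z # p2" by (meson split_list)
      then show ?thesis using simple_path_prefix[of D 0 y p1 z p2] p by blast
    next
      case False
      have e: "(y, z) \<in> D \<or> (z, y) \<in> D" using OD step.hyps by blast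
      have "simple_path D 0 z (p @ [z])"
        unfolding simple_path_def
      proof (intro conjI allI impI)
        fix t assume t: "Suc t < length (p @ [z])"
        show "((p @ [z]) ! t, (p @ [z]) ! Suc t) \<in> D \<or> ((p @ [z]) ! Suc t, (p @ [z]) ! t) \<in> D"
        proof (cases "Suc t < length p")
          case True
          then show ?thesis using p by (simp add: simple_path_def nth_append)
        next
          case f: False
          then have "Suc t = length p" using t by simp
          then have "p ! t = y" using p unfolding simple_path_def
            by (metis diff_Suc_1 last_conv_nth)
          then show ?thesis using \<open>Suc t = length p\<close> e by (simp add: nth_append)
        qed
      qed (use p False in \<open>auto simp: simple_path_def\<close>)
      then show ?thesis by blast
    qed
  qed
  have the: "(THE p. simple_path D 0 y p) = p" if "simple_path D 0 y p" for y p
    using unique that by blast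
  have x0: "x \<noteq> 0" "u \<noteq> x" using irr[OF ux] by auto
  show ?thesis
  proof (cases "u < x")
    case True
    obtain p where p: "simple_path D 0 x p"
      using ex[of x] reach[OF ux] ux by (meson rtrancl.rtrancl_into_rtrancl)
    then obtain p' where p': "p = p' @ [x]"
      unfolding simple_path_def by (metis append_butlast_last_id)
    then have "p' \<noteq> []" using p x0 by (auto simp: simple_path_def)
    then have "last p' = u" using step p p' par ux by blast
    then have "u \<in> set p" using p' \<open>p' \<noteq> []\<close> by auto
    then show ?thesis using True the[OF p] by (simp add: oriented_right_def strand_def)
  next
    case False
    then have lt: "x < u" using x0 by simp
    obtain p where p: "simple_path D 0 u p" using ex[of u] reach[OF ux] by blast
    \<comment> \<open>Here the strand is (x, u) with its arc running from u to x. A path through x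
      would enter x from its parent u and thus contain u before its end u.\<close>
    have "x \<notin> set p"
    proof
      assume "x \<in> set p"
      then obtain p1 p2 where pp: "p = p1 @ x # p2" by (meson split_list)
      have sp: "simple_path D 0 x (p1 @ [x])" using simple_path_prefix p pp by blast
      then have "p1 \<noteq> []" using x0 by (auto simp: simple_path_def)
      then have "last p1 = u" using step[OF sp] par ux by blast
      then have "u \<in> set p1" using \<open>p1 \<noteq> []\<close> by auto
      moreover have "last p = u" "distinct p" using p by (auto simp: simple_path_def)
      then have "u \<in> set p2" using pp x0 by (cases "p2 = []") auto
      ultimately show False using \<open>distinct p\<close> pp by auto
    qed
    then show ?thesis using lt False the[OF p] by (simp add: oriented_right_def strand_def)
  qed
qed

lemma oriented_right_diagram:
  assumes "(u, x) \<in> arcs True 0 T"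
  shows "oriented_right (diagram True 0 T) (strand (u, x)) \<longleftrightarrow> u < x"
proof (rule oriented_right_iff[OF diagram_def _ _ _ assms])
  show "y \<noteq> 0 \<and> t \<noteq> y" if "(t, y) \<in> arcs True 0 T" for t y
    using arcs_cover[OF that] by auto
  show "t = t'" if "(t, y) \<in> arcs True 0 T" "(t', y) \<in> arcs True 0 T" for t t' y
    using arcs_unique_parent[OF that] by auto
  show "(0, t) \<in> (arcs True 0 T)\<^sup>*" if "(t, y) \<in> arcs True 0 T" for t y
    using arcs_reach[OF arcs_cover(1)[OF that]] by auto
qed

lemma block_whole: "block (diagram True 0 T) True 0 T"
  by (simp add: block_def)

section \<open>Ternary trees, words and lattice paths\<close>

primrec preorder :: "tern \<Rightarrow> letter list list" where
  "preorder Leaf = [[]]"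
| "preorder (Node a b c) =
     [] # map ((#) La) (preorder a) @ map ((#) Lb) (preorder b) @ map ((#) Lc) (preorder c)"

primrec node_words :: "tern \<Rightarrow> letter list set" where
  "node_words Leaf = {}"
| "node_words (Node a b c) =
     insert [] ((#) La ` node_words a \<union> (#) Lb ` node_words b \<union> (#) Lc ` node_words c)"

primrec code :: "tern \<Rightarrow> step list" where
  "code Leaf = [Horizontal]"
| "code (Node a b c) = Vertical # code a @ code b @ code c"

text \<open>The counterpart of \<open>strand_at\<close> along the tree, where base and direction are
  known and no diagram has to be searched.\<close>

primrec strand_in :: "tern \<Rightarrow> bool \<Rightarrow> nat \<Rightarrow> letter list \<Rightarrow> (nat \<times> nat) option" where
  "strand_in Leaf = (\<lambda>r v w. None)"
| "strand_in (Node a b c) = (\<lambda>r v w. let x = far r v (Suc (nnodes a + nnodes b)) in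
     case w of [] \<Rightarrow> Some (strand (v, x))
     | l # u \<Rightarrow> (case l of La \<Rightarrow> strand_in a r v u | Lb \<Rightarrow> strand_in b (\<not> r) x u | Lc \<Rightarrow> strand_in c r x u))"

lemma strand_in_Nil: "strand_in T r v [] = root_strand r v T"
  by (cases T) (auto simp: Let_def)

lemma foldl_child_None: "foldl (\<lambda>X l. Option.bind X (\<lambda>Y. child D Y l)) None w = None"
  by (induction w) auto

text \<open>Stated for an arbitrary block, so that the induction can descend into the three
  subtrees. The hypothesis on orientations is inherited because the arcs of a subtree are arcs of
  the block.\<close>

lemma foldl_child_block:
  assumes "block D r v T"
    and "\<And>u x. (u, x) \<in> arcs r v T \<Longrightarrow> oriented_right D (strand (u, x)) \<longleftrightarrow> u < x"
  shows "foldl (\<lambda>X l. Option.bind X (\<lambda>Y. child D Y l)) (root_strand r v T) w = strand_in T r v w"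
  using assms
proof (induction T arbitrary: r v w)
  case Leaf
  then show ?case by (simp add: foldl_child_None)
next
  case (Node a b c)
  define x where "x = far r v (Suc (nnodes a + nnodes b))"
  note B = block_sub[OF Node.prems(1), folded x_def]
  have sub: "arcs r v a \<subseteq> arcs r v (Node a b c)" "arcs (\<not> r) x b \<subseteq> arcs r v (Node a b c)"
    "arcs r x c \<subseteq> arcs r v (Node a b c)" "(v, x) \<in> arcs r v (Node a b c)"
    by (auto simp: x_def Let_def)
  have "v < x \<longleftrightarrow> r" using Node.prems(1) by (auto simp: x_def far_def block_def)
  then have R: "oriented_right D (strand (v, x)) = r" using Node.prems(2)[OF sub(4)] by simp
  note ch = child_block[OF Node.prems(1), folded x_def, OF R]
  have rs: "root_strand r v (Node a b c) = Some (strand (v, x))" by (simp add: x_def)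
  have si: "strand_in (Node a b c) r v (La # u) = strand_in a r v u"
    "strand_in (Node a b c) r v (Lb # u) = strand_in b (\<not> r) x u"
    "strand_in (Node a b c) r v (Lc # u) = strand_in c r x u" for u
    by (simp_all add: Let_def x_def)
  have IH: "foldl (\<lambda>X l. Option.bind X (\<lambda>Y. child D Y l)) (root_strand r v a) u = strand_in a r v u"
    "foldl (\<lambda>X l. Option.bind X (\<lambda>Y. child D Y l)) (root_strand (\<not> r) x b) u = strand_in b (\<not> r) x u"
    "foldl (\<lambda>X l. Option.bind X (\<lambda>Y. child D Y l)) (root_strand r x c) u = strand_in c r x u" for u
    using Node.IH(1)[OF B(1)] Node.IH(2)[OF B(2)] Node.IH(3)[OF B(3)] Node.prems(2) sub
    by (meson subsetD)+
  show ?case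
  proof (cases w)
    case Nil
    then show ?thesis by (simp add: strand_in_Nil del: strand_in.simps)
  next
    case (Cons l u)
    then show ?thesis
      by (cases l) (simp_all only: foldl_Cons rs si IH ch bind.simps)
  qed
qed

lemma root_diagram:
  "T \<noteq> Leaf \<Longrightarrow> Some (root (diagram True 0 T)) = root_strand True 0 T"
proof -
  assume T: "T \<noteq> Leaf"
  let ?D = "diagram True 0 T"
  have "(0, x) \<in> ?D \<longleftrightarrow> 0 < x \<and> x \<le> 0 + nnodes T \<and> (0, x) \<in> ?D" for x
    using diagram_cover[of "(0, x)" True 0 T] by (auto simp: cover_def)
  then have "{x. (0, x) \<in> ?D} = {x. 0 < x \<and> x \<le> 0 + nnodes T \<and> (0, x) \<in> ?D}" by blast
  moreover note pick_right[OF block_whole, of T]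
  moreover have "root_strand True 0 T \<noteq> None" using T by (cases T) auto
  ultimately show ?thesis by (auto simp: root_def pick_def split: if_splits)
qed

lemma strand_at_diagram:
  assumes "T \<noteq> Leaf"
  shows "strand_at (diagram True 0 T) w = strand_in T True 0 w"
  unfolding strand_at_def root_diagram[OF assms]
  by (rule foldl_child_block[OF block_whole oriented_right_diagram])

lemma strand_in_neq_None: "strand_in T r v w \<noteq> None \<longleftrightarrow> w \<in> node_words T"
  by (induction T arbitrary: r v w) (auto simp: Let_def split: list.splits letter.splits)

lemma nodes_diagram: "T \<noteq> Leaf \<Longrightarrow> nodes (diagram True 0 T) = node_words T"
  by (simp add: nodes_def strand_at_diagram strand_in_neq_None del: not_None_eq)

primrec leaf_words :: "tern \<Rightarrow> letter list set" where
  "leaf_words Leaf = {[]}"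
| "leaf_words (Node a b c) =
     (#) La ` leaf_words a \<union> (#) Lb ` leaf_words b \<union> (#) Lc ` leaf_words c"

lemma set_preorder: "set (preorder T) = node_words T \<union> leaf_words T"
  by (induction T) auto

text \<open>The form in which \<open>leaves\<close> describes a leaf: a vertex that is no node but
  whose parent is one. The alternative w = [] concerns only the tree \<open>Leaf\<close>.\<close>

lemma leaf_words_iff:
  "w \<in> leaf_words T \<longleftrightarrow> w \<notin> node_words T \<and> (w = [] \<or> butlast w \<in> node_words T)"
proof (induction T arbitrary: w)
  case (Node a b c)
  show ?case
  proof (cases w)
    case (Cons l u)
    then show ?thesis using Node[of u] by (cases l; cases "u = []") (auto simp: image_iff)
  qed auto
qed simp

lemma leaves_diagram:
  assumes "T \<noteq> Leaf"
  shows "leaves (diagram True 0 T) = leaf_words T"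
proof -
  have "[] \<in> node_words T" using assms by (cases T) auto
  then show ?thesis
    unfolding leaves_def nodes_diagram[OF assms]
    by (auto simp: leaf_words_iff) (metis append_butlast_last_id)
qed

lemma node_words_subset: "node_words T \<subseteq> set (preorder T)"
  unfolding set_preorder by simp

lemma map_Cons_sorted_wrt: "sorted_wrt (<) (map ((#) (l::letter)) ws) \<longleftrightarrow> sorted_wrt (<) ws"
  by (simp add: sorted_wrt_map)

text \<open>As a word precedes its extensions and a < b < c, lexicographic order is preorder
  traversal.\<close>

lemma sorted_preorder: "sorted_wrt (<) (preorder T)"
  by (induction T) (auto simp: sorted_wrt_append map_Cons_sorted_wrt less_letter_def)

lemma tree_vertices_diagram:
  assumes "T \<noteq> Leaf"
  shows "tree_vertices (diagram True 0 T) = preorder T"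
proof -
  obtain ws where ws: "preorder T = [] # ws" by (cases T) auto
  have s: "sorted_wrt (<) ([] # ws)" using sorted_preorder[of T] ws by simp
  then have "sorted ws" "distinct ws" "[] \<notin> set ws" by (auto simp: strict_sorted_iff)
  moreover have "(nodes (diagram True 0 T) \<union> leaves (diagram True 0 T)) - {[]} = set ws"
    unfolding nodes_diagram[OF assms] leaves_diagram[OF assms] set_preorder[symmetric]
    using calculation(3) by (auto simp: ws)
  ultimately show ?thesis
    unfolding tree_vertices_def ws by (simp add: sorted_list_of_set.idem_if_sorted_distinct)
qed

lemma code_conv_preorder:
  "map (\<lambda>w. if w \<in> node_words T then Vertical else Horizontal) (preorder T) = code T"
proof (induction T)
  case (Node a b c)
  have "(\<lambda>w. if w \<in> node_words (Node a b c) then Vertical else Horizontal) \<circ> (#) La =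
      (\<lambda>w. if w \<in> node_words a then Vertical else Horizontal)"
    "(\<lambda>w. if w \<in> node_words (Node a b c) then Vertical else Horizontal) \<circ> (#) Lb =
      (\<lambda>w. if w \<in> node_words b then Vertical else Horizontal)"
    "(\<lambda>w. if w \<in> node_words (Node a b c) then Vertical else Horizontal) \<circ> (#) Lc =
      (\<lambda>w. if w \<in> node_words c then Vertical else Horizontal)"
    by (auto simp: fun_eq_iff)
  then show ?case using Node by (simp del: node_words.simps) simp
qed simp

lemma count_code: "count_list (code T) Horizontal = 2 * nnodes T + 1" "count_list (code T) Vertical = nnodes T"
  by (induction T) auto

lemma length_preorder: "length (preorder T) = length (code T)"
  by (metis code_conv_preorder length_map)

lemma length_code: "length (code T) = 3 * nnodes T + 1"
  by (induction T) auto

lemma distinct_preorder: "distinct (preorder T)"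
  using sorted_preorder strict_sorted_iff by blast

lemma finite_node_words: "finite (node_words T)"
  using node_words_subset finite_subset by blast

lemma card_node_words: "card (node_words T) = nnodes T"
proof (induction T)
  case (Node a b c)
  have "card (node_words (Node a b c)) =
     Suc (card ((#) La ` node_words a \<union> (#) Lb ` node_words b \<union> (#) Lc ` node_words c))"
    using finite_node_words by (simp add: card_insert_if image_iff)
  also have "card ((#) La ` node_words a \<union> (#) Lb ` node_words b \<union> (#) Lc ` node_words c) =
     card ((#) La ` node_words a) + card ((#) Lb ` node_words b) + card ((#) Lc ` node_words c)"
    using finite_node_words by (subst card_Un_disjoint; auto)+
  also have "\<dots> = nnodes a + nnodes b + nnodes c"
    using Node by (simp add: card_image)
  finally show ?case by simp
qed simp

lemma strand_in_image: "(\<lambda>w. the (strand_in T r v w)) ` node_words T = diagram r v T"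
proof (induction T arbitrary: r v)
  case (Node a b c)
  define x where "x = far r v (Suc (nnodes a + nnodes b))"
  have "(\<lambda>w. the (strand_in (Node a b c) r v w)) ` node_words (Node a b c) =
     insert (strand (v, x)) ((\<lambda>w. the (strand_in a r v w)) ` node_words a \<union>
       (\<lambda>w. the (strand_in b (\<not> r) x w)) ` node_words b \<union> (\<lambda>w. the (strand_in c r x w)) ` node_words c)"
    by (simp add: x_def Let_def image_Un image_image)
  then show ?case by (simp add: Node diagram_Node x_def Let_def)
qed simp

definition word_right :: "letter list \<Rightarrow> bool" where
  "word_right w \<longleftrightarrow> even (count_list w Lb)"

text \<open>Only the letter b reverses the direction, so the direction at w is r reversed once for
  each b. The pair (i, j) is sorted, hence it is the arc itself or its reverse.\<close>

lemma strand_in_arcs: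
  assumes "strand_in T r v w = Some (i, j)" "r \<or> nnodes T \<le> v"
  shows "if r = word_right w then (i, j) \<in> arcs r v T else (j, i) \<in> arcs r v T"
  using assms
proof (induction T arbitrary: r v w)
  case (Node a b c)
  define x where "x = far r v (Suc (nnodes a + nnodes b))"
  have val: "r \<or> nnodes a \<le> v" "\<not> r \<or> nnodes b \<le> x" "r \<or> nnodes c \<le> x"
    using Node.prems(2) by (auto simp: x_def far_def)
  have sub: "arcs r v a \<subseteq> arcs r v (Node a b c)" "arcs (\<not> r) x b \<subseteq> arcs r v (Node a b c)"
    "arcs r x c \<subseteq> arcs r v (Node a b c)" "(v, x) \<in> arcs r v (Node a b c)"
    by (auto simp: x_def Let_def)
  have lt: "if r then v < x else x < v" using Node.prems(2) by (auto simp: x_def far_def)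
  show ?case
  proof (cases w)
    case Nil
    then show ?thesis using Node.prems(1) sub(4) lt
      by (auto simp: strand_in_Nil word_right_def strand_def x_def simp del: arcs.simps strand_in.simps split: if_splits)
  next
    case (Cons l u)
    show ?thesis
    proof (cases l)
      case La
      then have "strand_in a r v u = Some (i, j)" using Node.prems(1) Cons by (simp add: Let_def)
      from Node.IH(1)[OF this val(1)] show ?thesis
        using Cons La sub(1) by (auto simp: word_right_def split: if_splits)
    next
      case Lb
      then have "strand_in b (\<not> r) x u = Some (i, j)" using Node.prems(1) Cons by (simp add: Let_def x_def)
      from Node.IH(2)[OF this val(2)] show ?thesis
        using Cons Lb sub(2) by (auto simp: word_right_def split: if_splits)
    next
      case Lc
      then have "strand_in c r x u = Some (i, j)" using Node.prems(1) Cons by (simp add: Let_def x_def)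
      from Node.IH(3)[OF this val(3)] show ?thesis
        using Cons Lc sub(3) by (auto simp: word_right_def split: if_splits)
    qed
  qed
qed simp

section \<open>Prefix codes of ternary trees and lattice paths\<close>

text \<open>Unique readability of prefix notation. The arbitrary tails let the induction run through
  the codes of a, b and c one after another.\<close>

lemma code_prefix_free:
  "code T @ xs = code T' @ ys \<Longrightarrow> T = T' \<and> xs = ys"
proof (induction T arbitrary: T' xs ys)
  case Leaf
  then show ?case by (cases T') auto
next
  case (Node a b c)
  from Node.prems obtain a' b' c' where T': "T' = Node a' b' c'" by (cases T') auto
  have e: "code a @ (code b @ code c @ xs) = code a' @ (code b' @ code c' @ ys)"
    using Node.prems T' by simp
  from Node.IH(1)[OF e] have a: "a = a'" and e: "code b @ (code c @ xs) = code b' @ (code c' @ ys)" by auto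
  from Node.IH(2)[OF e] have b: "b = b'" and e: "code c @ xs = code c' @ ys" by auto
  from Node.IH(3)[OF e] show ?case using a b T' by simp
qed

lemma inj_code: "inj code"
  using code_prefix_free[of _ "[]" _ "[]"] by (auto intro!: injI)

text \<open>This is 2y - x at the end point. In a prefix code, weight plus one is the number of
  trees still to be read: a node turns one such tree into three, a leaf removes one.\<close>

definition weight :: "step list \<Rightarrow> int" where
  "weight P = 2 * int (count_list P Vertical) - int (count_list P Horizontal)"

lemma weight_simps [simp]:
  "weight [] = 0" "weight (Horizontal # P) = weight P - 1" "weight (Vertical # P) = weight P + 2"
  "weight (P @ Q) = weight P + weight Q"
  by (auto simp: weight_def)

text \<open>Reading a node leaves its children to be read besides the trees already pending, so the
  induction needs forests instead of single trees.\<close>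

lemma parse_forest:
  assumes "weight P = - int m" "\<And>k. k < length P \<Longrightarrow> weight (take k P) > - int m"
  shows "\<exists>Ts. length Ts = m \<and> concat (map code Ts) = P"
  using assms
proof (induction P arbitrary: m)
  case Nil
  then show ?case by simp
next
  case (Cons s P)
  have pos: "m > 0" using Cons.prems(2)[of 0] by simp
  have tk: "weight (s # take k P) > - int m" if "k < length P" for k
    using Cons.prems(2)[of "Suc k"] that by simp
  show ?case
  proof (cases s)
    case Horizontal
    have "\<exists>Ts. length Ts = m - 1 \<and> concat (map code Ts) = P"
      using Cons.prems(1) tk Horizontal pos by (intro Cons.IH) force+
    then obtain Ts where "length Ts = m - 1" "concat (map code Ts) = P" by blast
    then show ?thesis using Horizontal pos by (intro exI[of _ "Leaf # Ts"]) simp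
  next
    case Vertical
    have "\<exists>Ts. length Ts = m + 2 \<and> concat (map code Ts) = P"
      using Cons.prems(1) tk Vertical pos by (intro Cons.IH) force+
    then obtain Ts where Ts: "length Ts = m + 2" "concat (map code Ts) = P" by blast
    moreover obtain m' where "m = Suc m'" using pos by (cases m) auto
    ultimately obtain a b c Us where "Ts = a # b # c # Us" by (auto simp: length_Suc_conv)
    then show ?thesis using Vertical Ts by (intro exI[of _ "Node a b c # Us"]) simp
  qed
qed

text \<open>After the vertical step of a node the weight is 2. The codes of a and b lower it by at
  most one each, and a proper prefix of the code of c does not lower it.\<close>

lemma weight_code_prefix: "k < length (code T) \<Longrightarrow> weight (take k (code T)) \<ge> 0"
proof (induction T arbitrary: k)
  case (Node a b c)
  have w: "weight (code t) = -1" for t by (simp add: weight_def count_code)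
  show ?case
  proof (cases k)
    case (Suc k')
    then have k': "k' < length (code a) + length (code b) + length (code c)" using Node.prems by simp
    let ?la = "length (code a)" and ?lb = "length (code b)"
    have "weight (take k' (code a)) \<ge> -1" "k' < ?la \<Longrightarrow> weight (take k' (code a)) \<ge> 0"
      using Node.IH(1)[of k'] w[of a] by (cases "k' < ?la"; simp)+
    moreover have "weight (take (k' - ?la) (code b)) \<ge> -1"
      using Node.IH(2)[of "k' - ?la"] w[of b] by (cases "k' - ?la < ?lb"; simp)
    moreover have "k' - ?la - ?lb < length (code c) \<or> ?la + ?lb > k'" using k' by linarith
    then have "weight (take (k' - ?la - ?lb) (code c)) \<ge> 0"
      using Node.IH(3)[of "k' - ?la - ?lb"] by auto
    ultimately show ?thesis using Suc by (simp add: diff_diff_eq)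
  qed simp
qed simp

lemma lattice_paths_iff:
  "P \<in> lattice_paths n \<longleftrightarrow> count_list P Vertical = n \<and> weight P = -1 \<and> (\<forall>k<length P. weight (take k P) \<ge> 0)"
proof -
  have "fst (point P k) \<le> 2 * snd (point P k) \<longleftrightarrow> weight (take k P) \<ge> 0" for k
    by (simp add: point_def weight_def) linarith
  moreover have "point P (length P) = (2 * n + 1, n) \<longleftrightarrow> count_list P Vertical = n \<and> weight P = -1"
    by (auto simp: point_def weight_def)
  ultimately show ?thesis by (simp add: lattice_paths_def)
qed

lemma bij_code: "bij_betw code {T. nnodes T = n} (lattice_paths n)"
  unfolding bij_betw_def
proof (intro conjI equalityI subsetI)
  show "inj_on code {T. nnodes T = n}" using inj_code inj_on_subset by blast
  show "P \<in> lattice_paths n" if "P \<in> code ` {T. nnodes T = n}" for P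
    using that weight_code_prefix by (auto simp: lattice_paths_iff count_code weight_def)
  show "P \<in> code ` {T. nnodes T = n}" if P: "P \<in> lattice_paths n" for P
  proof -
    have "\<exists>Ts. length Ts = 1 \<and> concat (map code Ts) = P"
      using P by (intro parse_forest) (fastforce simp: lattice_paths_iff)+
    then obtain T where "code T = P" by (auto simp: length_Suc_conv)
    then show ?thesis using P count_code(2)[of T] by (auto simp: lattice_paths_iff)
  qed
qed

text \<open>Entering b passes the leaves of one subtree, an odd number; entering c passes those of
  two, an even number; entering a passes none.\<close>

lemma even_leaves_before:
  assumes "k < length (code T)"
  shows "even (count_list (take k (code T)) Horizontal) \<longleftrightarrow> word_right (preorder T ! k)"
  using assms
proof (induction T arbitrary: k)
  case Leaf
  then show ?case by (simp add: word_right_def)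
next
  case (Node a b c)
  show ?case
  proof (cases k)
    case (Suc k')
    let ?la = "length (code a)" and ?lb = "length (code b)"
    have k': "k' < ?la + ?lb + length (code c)" using Node.prems Suc by simp
    consider "k' < ?la" | "?la \<le> k'" "k' - ?la < ?lb" | "?la + ?lb \<le> k'" "k' - ?la - ?lb < length (code c)"
      using k' by linarith
    then show ?thesis
    proof cases
      case 1
      then show ?thesis using Suc Node.IH(1)[OF 1]
        by (simp add: word_right_def nth_append length_preorder)
    next
      case 2
      then show ?thesis using Suc Node.IH(2)[OF 2(2)]
        by (simp add: word_right_def nth_append length_preorder count_code)
    next
      case 3
      then have "\<not> k' < ?la" "\<not> k' - ?la < ?lb" by auto
      then show ?thesis using 3 Suc Node.IH(3)[OF 3(2)]
        by (simp add: word_right_def nth_append length_preorder count_code)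
    qed
  qed (simp add: word_right_def)
qed

section \<open>Exceptional orders and orientation\<close>

text \<open>The order is forced at the ends of the root strand. To the right, strands (y, w) of b
  must precede (v, w), while (v, x) in a and (w, z) in c must follow it; to the left, the
  constraints are reversed.\<close>

primrec exc_order :: "tern \<Rightarrow> bool \<Rightarrow> nat \<Rightarrow> (nat \<times> nat) list" where
  "exc_order Leaf = (\<lambda>r v. [])"
| "exc_order (Node a b c) = (\<lambda>r v. let w = far r v (Suc (nnodes a + nnodes b)) in
     if r then exc_order b (\<not> r) w @ strand (v, w) # exc_order a r v @ exc_order c r w
     else exc_order a r v @ exc_order c r w @ strand (v, w) # exc_order b (\<not> r) w)"

lemma set_exc_order: "set (exc_order T r v) = diagram r v T"
  by (induction T arbitrary: r v) (auto simp: diagram_Node Let_def)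

lemma length_exc_order: "length (exc_order T r v) = nnodes T"
  by (induction T arbitrary: r v) (auto simp: Let_def)

lemma sorted_exc_order:
  assumes "r \<or> nnodes T \<le> v"
  shows "sorted_wrt (\<lambda>X Y. perp Y X) (exc_order T r v)"
  using assms
proof (induction T arbitrary: r v)
  case (Node a b c)
  define w where "w = far r v (Suc (nnodes a + nnodes b))"
  have val: "r \<or> nnodes a \<le> v" "\<not> r \<or> nnodes b \<le> w" "r \<or> nnodes c \<le> w"
    using Node.prems(1) by (auto simp: w_def far_def)
  note IH = Node.IH(1)[OF val(1)] Node.IH(2)[OF val(2)] Node.IH(3)[OF val(3)]
  have eq: "exc_order (Node a b c) r v =
    (if r then exc_order b (\<not> r) w @ strand (v, w) # exc_order a r v @ exc_order c r w
     else exc_order a r v @ exc_order c r w @ strand (v, w) # exc_order b (\<not> r) w)"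
    by (simp add: w_def Let_def)
  show ?case
  proof (cases r)
    case True
    have w: "w = v + (Suc (nnodes a + nnodes b))" using True by (simp add: w_def far_def)
    have A: "v \<le> fst X \<and> snd X \<le> v + nnodes a \<and> fst X < snd X" if "X \<in> diagram True v a" for X
      using diagram_cover[OF that] by (auto simp: cover_def)
    have B: "v + nnodes a < fst X \<and> snd X \<le> w \<and> fst X < snd X" if "X \<in> diagram False w b" for X
      using diagram_cover[OF that] val True by (auto simp: cover_def w)
    have C: "w \<le> fst X \<and> fst X < snd X" if "X \<in> diagram True w c" for X
      using diagram_cover[OF that] by (auto simp: cover_def)
    have S: "strand (v, w) = (v, w)" using w by (simp add: strand_def)
    have "sorted_wrt (\<lambda>X Y. perp Y X) (exc_order b False w @ (v, w) # exc_order a True v @ exc_order c True w)"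
      unfolding sorted_wrt_append sorted_wrt.simps set_append set_exc_order list.set
    proof (intro conjI ballI)
      show "sorted_wrt (\<lambda>X Y. perp Y X) (exc_order b False w)"
        "sorted_wrt (\<lambda>X Y. perp Y X) (exc_order a True v)"
        "sorted_wrt (\<lambda>X Y. perp Y X) (exc_order c True w)" using IH True by auto
      fix X Y
      show "perp Y (v, w)" if "Y \<in> diagram True v a \<union> diagram True w c"
        using that A[of Y] C[of Y] w by (elim UnE) (auto simp: perp_def)
      show "perp Y X" if "X \<in> diagram True v a" "Y \<in> diagram True w c"
        using A[OF that(1)] C[OF that(2)] w by (auto simp: perp_def)
      show "perp Y X" if "X \<in> diagram False w b" "Y \<in> insert (v, w) (diagram True v a \<union> diagram True w c)"
        using B[OF that(1)] A[of Y] C[of Y] w that(2) by (elim insertE UnE) (auto simp: perp_def)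
    qed
    then show ?thesis unfolding eq S using True by simp
  next
    case False
    have v: "v = w + Suc (nnodes a + nnodes b)" "nnodes c \<le> w"
      using False Node.prems by (auto simp: w_def far_def)
    have A: "w + nnodes b < fst X \<and> snd X \<le> v \<and> fst X < snd X" if "X \<in> diagram False v a" for X
      using diagram_cover[OF that] val False by (auto simp: cover_def v)
    have B: "w \<le> fst X \<and> snd X \<le> w + nnodes b \<and> fst X < snd X" if "X \<in> diagram True w b" for X
      using diagram_cover[OF that] by (auto simp: cover_def v)
    have C: "snd X \<le> w \<and> fst X < snd X" if "X \<in> diagram False w c" for X
      using diagram_cover[OF that] v by (auto simp: cover_def)
    have S: "strand (v, w) = (w, v)" using v by (simp add: strand_def)
    have "sorted_wrt (\<lambda>X Y. perp Y X) (exc_order a False v @ exc_order c False w @ (w, v) # exc_order b True w)"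
      unfolding sorted_wrt_append sorted_wrt.simps set_append set_exc_order list.set
    proof (intro conjI ballI)
      show "sorted_wrt (\<lambda>X Y. perp Y X) (exc_order b True w)"
        "sorted_wrt (\<lambda>X Y. perp Y X) (exc_order a False v)"
        "sorted_wrt (\<lambda>X Y. perp Y X) (exc_order c False w)" using IH False by auto
      fix X Y
      show "perp Y (w, v)" if "Y \<in> diagram True w b"
        using B[OF that] v by (auto simp: perp_def)
      show "perp Y X" if "X \<in> diagram False w c" "Y \<in> insert (w, v) (diagram True w b)"
        using C[OF that(1)] B[of Y] v that(2) by (elim insertE) (auto simp: perp_def)
      show "perp Y X" if "X \<in> diagram False v a" "Y \<in> diagram False w c \<union> insert (w, v) (diagram True w b)"
        using A[OF that(1)] B[of Y] C[of Y] v that(2) by (elim insertE UnE) (auto simp: perp_def)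
    qed
    then show ?thesis unfolding eq S using False by simp
  qed
qed simp

definition exc_list :: "nat \<Rightarrow> (nat \<times> nat) list \<Rightarrow> bool" where
  "exc_list n es \<longleftrightarrow> length es = n \<and> set es \<subseteq> strands_in 0 n \<and> sorted_wrt (\<lambda>X Y. perp Y X) es"

lemma exc_list_exc_order: "nnodes T = n \<Longrightarrow> exc_list n (exc_order T True 0)"
  using diagram_cover[of _ True 0 T]
  by (force simp: exc_list_def length_exc_order set_exc_order sorted_exc_order strands_in_def cover_def)

text \<open>\<open>perp X X\<close> fails for a strand, since its support contains its upper end but
  not its lower one; in terms of modules, Hom(M, M) is not 0.\<close>

lemma exc_list_distinct:
  assumes "exc_list n es"
  shows "distinct es"
  unfolding distinct_conv_nth
proof (intro allI impI)
  have *: "es ! q \<noteq> es ! p" if "q < p" "p < length es" for p q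
  proof -
    have "perp (es ! p) (es ! q)" using assms that by (auto simp: exc_list_def sorted_wrt_iff_nth_less)
    moreover have "es ! p \<in> strands_in 0 n"
      using assms that by (auto simp: exc_list_def)
    then have "fst (es ! p) < snd (es ! p)" by (auto simp: strands_in_def)
    ultimately show ?thesis by (auto simp: perp_def)
  qed
  fix i j assume "i < length es" "j < length es" "i \<noteq> j"
  then show "es ! i \<noteq> es ! j" using *[of i j] *[of j i] by (metis linorder_neqE_nat)
qed

lemma exc_list_rank:
  assumes "exc_list n es"
  obtains r where "excs r (set es)" "\<And>p. p < n \<Longrightarrow> r (es ! p) = p"
proof -
  define r where "r X = (THE k. k < n \<and> es ! k = X)" for X
  have len: "length es = n" using assms by (simp add: exc_list_def)
  have r: "r (es ! p) = p" if "p < n" for p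
    unfolding r_def using that exc_list_distinct[OF assms] len by (auto simp: nth_eq_iff_index_eq)
  moreover have "excs r (set es)"
    unfolding excs_def
  proof (intro conjI ballI impI inj_onI)
    fix X Y assume "X \<in> set es" "Y \<in> set es"
    then obtain p q where pq: "X = es ! p" "Y = es ! q" "p < n" "q < n"
      using len by (auto simp: in_set_conv_nth)
    { assume "r X = r Y" then show "X = Y" using pq r by simp }
    { assume "r X < r Y"
      then have "p < q" using pq r by simp
      then show "perp Y X" using assms pq by (auto simp: exc_list_def sorted_wrt_iff_nth_less) }
  qed
  ultimately show thesis using that by blast
qed

lemma exc_list_diagram:
  assumes "exc_list n es"
  obtains T where "nnodes T = n" "diagram True 0 T = set es"
proof -
  obtain r where "excs r (set es)" using exc_list_rank[OF assms] by blast
  moreover have "card (set es) = n" "set es \<subseteq> strands_in 0 n"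
    using assms distinct_card[OF exc_list_distinct[OF assms]] by (auto simp: exc_list_def)
  ultimately show thesis using that excs_imp_diagram[of r "set es" 0 n] by auto
qed

text \<open>
  For a representation \<open>W\<close> left orthogonal to all strands before \<open>Y\<close>, the first component makes
  \<open>W\<^sub>x \<rightarrow> W\<^sub>v\<close> an isomorphism, and the second \<open>W\<^sub>x \<rightarrow> W\<^sub>z\<close> (or \<open>W\<^sub>x = 0\<close>).
\<close>

definition anchored :: "(nat \<times> nat \<Rightarrow> nat) \<Rightarrow> (nat \<times> nat) set \<Rightarrow> nat \<Rightarrow> nat \<Rightarrow> nat \<times> nat \<Rightarrow> bool" where
  "anchored r D v m Y \<longleftrightarrow> (\<exists>x. (x, v) \<in> {E \<in> D. r E < r Y}\<^sup>* \<and>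
     (x = 0 \<or> (\<exists>z>m. (x, z) \<in> D \<and> r (x, z) < r Y)))"

lemma anchored_mono: "anchored r D v m Y \<Longrightarrow> m' \<le> m \<Longrightarrow> anchored r D v m' Y"
  unfolding anchored_def using le_less_trans by blast

text \<open>The hypothesis on strands at v is the invariant: a block directed to the right has an
  anchor beyond its last vertex. As an a-child it inherits the anchor of its parent, as a c-child it
  prolongs the chain by (v, w). As a b-child below a left strand (w, v) it is anchored by that
  strand, which starts at w, ends beyond the block and precedes each (w, y) in it.\<close>

lemma right_arcs_anchored:
  assumes D: "excs r D" and "diagram o' v T \<subseteq> D" "o' \<or> nnodes T \<le> v"
    and "o' \<Longrightarrow> \<forall>y. v < y \<and> y \<le> v + nnodes T \<and> (v, y) \<in> D \<longrightarrow> anchored r D v (v + nnodes T) (v, y)"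
    and "(i, j) \<in> arcs o' v T" "i < j"
  shows "anchored r D i j (i, j)"
  using assms(2-)
proof (induction T arbitrary: o' v)
  case (Node a b c)
  define w where "w = far o' v (Suc (nnodes a + nnodes b))"
  have val: "o' \<or> nnodes a \<le> v" "\<not> o' \<or> nnodes b \<le> w" "o' \<or> nnodes c \<le> w"
    using Node.prems(2) by (auto simp: w_def far_def)
  have sub: "strand (v, w) \<in> D" "diagram o' v a \<subseteq> D" "diagram (\<not> o') w b \<subseteq> D" "diagram o' w c \<subseteq> D"
    using Node.prems(1) by (auto simp: diagram_Node Let_def w_def)
  have "(i, j) = (v, w) \<or> (i, j) \<in> arcs o' v a \<or> (i, j) \<in> arcs (\<not> o') w b \<or> (i, j) \<in> arcs o' w c"
    using Node.prems(4) by (auto simp: Let_def w_def)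
  then consider "(i, j) = (v, w)" | "(i, j) \<in> arcs o' v a" | "(i, j) \<in> arcs (\<not> o') w b"
    | "(i, j) \<in> arcs o' w c" by blast
  then show ?case
  proof cases
    case 1
    then have o': "o'" using Node.prems(5) by (auto simp: w_def far_def split: if_splits)
    then have w: "w = v + Suc (nnodes a + nnodes b)" "(v, w) \<in> D"
      using sub(1) by (auto simp: w_def far_def strand_def)
    then have "anchored r D v (v + nnodes (Node a b c)) (v, w)" using Node.prems(3)[OF o'] by auto
    then show ?thesis using 1 w(1) by (auto intro: anchored_mono)
  next
    case 2
    have "\<forall>y. v < y \<and> y \<le> v + nnodes a \<and> (v, y) \<in> D \<longrightarrow> anchored r D v (v + nnodes a) (v, y)" if o'
      using Node.prems(3)[OF that] anchored_mono[of r D v "v + nnodes (Node a b c)" _ "v + nnodes a"] by auto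
    then show ?thesis using Node.IH(1)[OF sub(2) val(1) _ 2] Node.prems(5) by blast
  next
    case 3
    have "\<forall>y. w < y \<and> y \<le> w + nnodes b \<and> (w, y) \<in> D \<longrightarrow> anchored r D w (w + nnodes b) (w, y)" if "\<not> o'"
    proof (intro allI impI)
      fix y assume y: "w < y \<and> y \<le> w + nnodes b \<and> (w, y) \<in> D"
      have v: "v = w + Suc (nnodes a + nnodes b)" using that Node.prems(2) by (simp add: w_def far_def)
      then have wv: "(w, v) \<in> D" using sub(1) by (simp add: strand_def)
      then have "r (w, v) < r (w, y)" using y v by (intro excs_before[OF D]) (auto simp: perp_def)
      then show "anchored r D w (w + nnodes b) (w, y)"
        unfolding anchored_def using wv v by (intro exI[of _ w]) auto
    qed
    then show ?thesis using Node.IH(2)[OF sub(3) val(2) _ 3] Node.prems(5) by blast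
  next
    case 4
    have "\<forall>y. w < y \<and> y \<le> w + nnodes c \<and> (w, y) \<in> D \<longrightarrow> anchored r D w (w + nnodes c) (w, y)" if o': o'
    proof (intro allI impI)
      fix y assume y: "w < y \<and> y \<le> w + nnodes c \<and> (w, y) \<in> D"
      have w: "w = v + Suc (nnodes a + nnodes b)" using that by (simp add: w_def far_def)
      then have vw: "(v, w) \<in> D" using sub(1) by (simp add: strand_def)
      then have lt: "r (v, w) < r (w, y)" using y w by (intro excs_before[OF D]) (auto simp: perp_def)
      have "anchored r D v (w + nnodes c) (v, w)" using Node.prems(3)[OF o'] vw w by (auto simp: add_ac)
      then obtain x where x: "(x, v) \<in> {E \<in> D. r E < r (v, w)}\<^sup>*"
        "x = 0 \<or> (\<exists>z>w + nnodes c. (x, z) \<in> D \<and> r (x, z) < r (v, w))" unfolding anchored_def by blast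
      have "{E \<in> D. r E < r (v, w)} \<subseteq> {E \<in> D. r E < r (w, y)}" using lt by auto
      then have "(x, v) \<in> {E \<in> D. r E < r (w, y)}\<^sup>*" using x(1) rtrancl_mono by blast
      moreover have "(v, w) \<in> {E \<in> D. r E < r (w, y)}" using vw lt by simp
      ultimately have "(x, w) \<in> {E \<in> D. r E < r (w, y)}\<^sup>*" by (rule rtrancl_into_rtrancl)
      then show "anchored r D w (w + nnodes c) (w, y)"
        unfolding anchored_def using x(2) lt less_trans by blast
    qed
    then show ?thesis using Node.IH(3)[OF sub(4) val(3) _ 4] Node.prems(5) by blast
  qed
qed simp

text \<open>The interval is the component that is cut off from 0 when the strand is removed. The
  strict inequality keeps left blocks away from 0; thus u is at least 1 and u - 1 is a
  vertex.\<close>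

lemma left_arcs_component:
  assumes "block D o' v T" "o' \<or> nnodes T < v" "(j, i) \<in> arcs o' v T" "i < j"
  shows "\<exists>u u'. 1 \<le> u \<and> u \<le> i \<and> i \<le> u' \<and> u' < j \<and>
     (\<forall>E\<in>D. E \<noteq> (i, j) \<longrightarrow> (fst E \<in> {u..u'} \<longleftrightarrow> snd E \<in> {u..u'}))"
  using assms
proof (induction T arbitrary: o' v)
  case (Node a b c)
  define w where "w = far o' v (Suc (nnodes a + nnodes b))"
  note B = block_sub[OF Node.prems(1), folded w_def]
  have val: "o' \<or> nnodes a < v" "\<not> o' \<or> nnodes b < w" "o' \<or> nnodes c < w"
    using Node.prems(2) by (auto simp: w_def far_def)
  have "(j, i) = (v, w) \<or> (j, i) \<in> arcs o' v a \<or> (j, i) \<in> arcs (\<not> o') w b \<or> (j, i) \<in> arcs o' w c"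
    using Node.prems(3) by (auto simp: Let_def w_def)
  then consider "(j, i) = (v, w)" | "(j, i) \<in> arcs o' v a" | "(j, i) \<in> arcs (\<not> o') w b"
    | "(j, i) \<in> arcs o' w c" by blast
  then show ?case
  proof cases
    case 1
    then have o': "\<not> o'" and ij: "i = w" "j = v"
      using Node.prems(4) by (auto simp: w_def far_def)
    have v: "v = w + Suc (nnodes a + nnodes b)" "nnodes c < w"
      using o' Node.prems(2) by (auto simp: w_def far_def)
    \<comment> \<open>The vertices of the blocks of b and c, which hang at the far end w of the
      strand.\<close>
    let ?U = "{w - nnodes c..w + nnodes b}"
    have "fst E \<in> ?U \<longleftrightarrow> snd E \<in> ?U" if E: "E \<in> D" "E \<noteq> (w, v)" for E
    proof (rule ccontr)
      assume ne: "\<not> ?thesis"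
      have "?U \<subseteq> cover o' v (Node a b c) - {v}" using v o' by (auto simp: cover_def)
      then have "E \<in> diagram o' v (Node a b c)" using Node.prems(1) E ne unfolding block_def by blast
      then have "E = strand (v, w) \<or> E \<in> diagram o' v a \<or> E \<in> diagram (\<not> o') w b \<or> E \<in> diagram o' w c"
        by (auto simp: diagram_Node Let_def w_def)
      moreover have "E \<noteq> strand (v, w)" using E v by (simp add: strand_def)
      moreover have "E \<notin> diagram o' v a"
        using diagram_cover[of E o' v a] ne v o' by (auto simp: cover_def)
      moreover have "E \<notin> diagram (\<not> o') w b"
        using diagram_cover[of E "\<not> o'" w b] ne v o' by (auto simp: cover_def)
      moreover have "E \<notin> diagram o' w c"
        using diagram_cover[of E o' w c] ne v o' by (auto simp: cover_def)
      ultimately show False by blast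
    qed
    then show ?thesis using ij v by (intro exI[of _ "w - nnodes c"] exI[of _ "w + nnodes b"]) auto
  next
    case 2
    then show ?thesis using Node.IH(1)[OF B(1) val(1)] Node.prems(4) by blast
  next
    case 3
    then show ?thesis using Node.IH(2)[OF B(2) val(2)] Node.prems(4) by blast
  next
    case 4
    then show ?thesis using Node.IH(3)[OF B(3) val(3)] Node.prems(4) by blast
  qed
qed simp

section \<open>Matrix factorizations\<close>

text \<open>The matrix laws are restated with equations between dimensions in place of carrier sets,
  so that they serve as conditional rewrite rules.\<close>

lemma mult_assoc_dim:
  fixes A :: "'a::semiring_0 mat"
  shows "dim_col A = dim_row B \<Longrightarrow> dim_col B = dim_row C \<Longrightarrow> A * B * C = A * (B * C)"
  by (rule assoc_mult_mat) auto

lemma mult_add_dim: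
  fixes A :: "'a::semiring_0 mat"
  shows "dim_col A = dim_row B \<Longrightarrow> dim_row C = dim_row B \<Longrightarrow> dim_col C = dim_col B \<Longrightarrow> A * (B + C) = A * B + A * C"
  by (rule mult_add_distrib_mat) auto

lemma add_mult_dim:
  fixes A :: "'a::semiring_0 mat"
  shows "dim_row B = dim_row A \<Longrightarrow> dim_col B = dim_col A \<Longrightarrow> dim_col A = dim_row C \<Longrightarrow> (A + B) * C = A * C + B * C"
  by (rule add_mult_distrib_mat) auto

lemma mult_minus_dim:
  fixes A :: "'a::ring mat"
  shows "dim_col A = dim_row B \<Longrightarrow> dim_row C = dim_row B \<Longrightarrow> dim_col C = dim_col B \<Longrightarrow> A * (B - C) = A * B - A * C"
  by (rule mult_minus_distrib_mat) auto

lemma minus_mult_dim: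
  fixes A :: "'a::ring mat"
  shows "dim_row B = dim_row A \<Longrightarrow> dim_col B = dim_col A \<Longrightarrow> dim_col A = dim_row C \<Longrightarrow> (A - B) * C = A * C - B * C"
  by (rule minus_mult_distrib_mat) auto

lemma mult_one_dim:
  fixes A :: "'a::semiring_1 mat"
  shows "dim_col A = n \<Longrightarrow> A * 1\<^sub>m n = A" "dim_row A = n \<Longrightarrow> 1\<^sub>m n * A = A"
  by (auto intro: right_mult_one_mat left_mult_one_mat)

lemma mult_zero_dim:
  fixes A :: "'a::semiring_0 mat"
  shows "dim_col A = n \<Longrightarrow> A * 0\<^sub>m n k = 0\<^sub>m (dim_row A) k" "dim_row A = n \<Longrightarrow> 0\<^sub>m k n * A = 0\<^sub>m k (dim_col A)"
  by (auto intro: right_mult_zero_mat left_mult_zero_mat)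

lemma add_zero_dim:
  fixes A :: "'a::comm_monoid_add mat"
  shows "dim_row A = n \<Longrightarrow> dim_col A = k \<Longrightarrow> A + 0\<^sub>m n k = A" "dim_row A = n \<Longrightarrow> dim_col A = k \<Longrightarrow> 0\<^sub>m n k + A = A"
  by auto

lemma minus_zero_dim:
  fixes A :: "'a::group_add mat"
  shows "dim_row A = n \<Longrightarrow> dim_col A = k \<Longrightarrow> A - 0\<^sub>m n k = A" "dim_row A = n \<Longrightarrow> dim_col A = k \<Longrightarrow> A - A = 0\<^sub>m n k"
  by auto

lemmas mat_alg = mult_assoc_dim mult_add_dim add_mult_dim mult_minus_dim minus_mult_dim mult_one_dim
  mult_zero_dim add_zero_dim minus_zero_dim

text \<open>\<open>mat_alg\<close> nests products to the right, which hides a known product A * B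
  inside A * (B * X).\<close>

lemma mult_reduce:
  fixes A :: "'a::semiring_0 mat"
  shows "A * B = C \<Longrightarrow> dim_col A = dim_row B \<Longrightarrow> dim_col B = dim_row X \<Longrightarrow> A * (B * X) = C * X"
  by (metis mult_assoc_dim)

text \<open>Used wherever a space is zero: outside the support of an interval module and at the
  vertex 0.\<close>

lemma eq_mat_empty: "dim_row A = dim_row B \<Longrightarrow> dim_col A = dim_col B \<Longrightarrow> dim_row A = 0 \<or> dim_col A = 0 \<Longrightarrow> A = B"
  by (rule eq_matI) auto

lemma four_block_empty:
  "A \<in> carrier_mat r c \<Longrightarrow> four_block_mat A (0\<^sub>m r 0) (0\<^sub>m 0 c) (0\<^sub>m 0 0) = A"
  by (rule eq_matI) auto

text \<open>Induction on the columns. U' splits off the part of the new column a that lies in the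
  image of U; the rest b either vanishes, and only V grows, or it contributes a new column to U. The
  one-sided inverses replace bases and ranks in what follows.\<close>

lemma rank_factorization:
  fixes A :: "'k::field mat"
  assumes "A \<in> carrier_mat r c"
  shows "\<exists>d U V U' V'. U \<in> carrier_mat r d \<and> V \<in> carrier_mat d c \<and> U' \<in> carrier_mat d r \<and>
    V' \<in> carrier_mat c d \<and> A = U * V \<and> U' * U = 1\<^sub>m d \<and> V * V' = 1\<^sub>m d"
  using assms
proof (induction c arbitrary: A)
  case 0
  then show ?case
    by (intro exI[of _ 0] exI[of _ "0\<^sub>m r 0"] exI[of _ "0\<^sub>m 0 0"] exI[of _ "0\<^sub>m 0 r"] exI[of _ "0\<^sub>m 0 0"])
      (auto intro!: eq_mat_empty)
next
  case (Suc c)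
  define A1 where "A1 = mat r c (\<lambda>(i, j). A $$ (i, j))"
  define a where "a = mat r 1 (\<lambda>(i, j). A $$ (i, c))"
  have cA: "A1 \<in> carrier_mat r c" "a \<in> carrier_mat r 1" by (auto simp: A1_def a_def)
  have A: "A = four_block_mat A1 a (0\<^sub>m 0 c) (0\<^sub>m 0 1)"
    using Suc.prems by (intro eq_matI) (auto simp: A1_def a_def less_Suc_eq)
  obtain d U V U' V' where c: "U \<in> carrier_mat r d" "V \<in> carrier_mat d c" "U' \<in> carrier_mat d r" "V' \<in> carrier_mat c d"
    and e: "A1 = U * V" "U' * U = 1\<^sub>m d" "V * V' = 1\<^sub>m d"
    using Suc.IH[OF cA(1)] by blast
  note D = carrier_matD[OF c(1)] carrier_matD[OF c(2)] carrier_matD[OF c(3)] carrier_matD[OF c(4)]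
    carrier_matD[OF cA(2)] carrier_matD[OF cA(1)]
  define b where "b = a - U * (U' * a)"
  have cb: "b \<in> carrier_mat r 1" using c cA by (auto simp: b_def)
  show ?case
  proof (cases "b = 0\<^sub>m r 1")
    case True
    have "a = b + U * (U' * a)" unfolding b_def using D by (intro eq_matI) auto
    then have a: "a = U * (U' * a)" using True D by (metis add_zero_dim(2) index_mult_mat(2,3))
    define V2 where "V2 = four_block_mat V (U' * a) (0\<^sub>m 0 c) (0\<^sub>m 0 1)"
    define V2' where "V2' = four_block_mat V' (0\<^sub>m c 0) (0\<^sub>m 1 d) (0\<^sub>m 1 0)"
    have c2: "V2 \<in> carrier_mat d (Suc c)" "V2' \<in> carrier_mat (Suc c) d"
      using four_block_carrier_mat[OF c(2) zero_carrier_mat[of 0 1]] four_block_carrier_mat[OF c(4) zero_carrier_mat[of 1 0]]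
      unfolding V2_def V2'_def by simp_all
    have "four_block_mat U (0\<^sub>m r 0) (0\<^sub>m 0 d) (0\<^sub>m 0 0) * V2 =
        four_block_mat (U * V + 0\<^sub>m r 0 * 0\<^sub>m 0 c) (U * (U' * a) + 0\<^sub>m r 0 * 0\<^sub>m 0 1)
         (0\<^sub>m 0 d * V + 0\<^sub>m 0 0 * 0\<^sub>m 0 c) (0\<^sub>m 0 d * (U' * a) + 0\<^sub>m 0 0 * 0\<^sub>m 0 1)"
      unfolding V2_def
      by (rule mult_four_block_mat[OF c(1) zero_carrier_mat zero_carrier_mat zero_carrier_mat
            c(2) mult_carrier_mat[OF c(3) cA(2)] zero_carrier_mat zero_carrier_mat])
    also have "\<dots> = A" unfolding A e(1) using a D by (simp add: mat_alg)
    finally have 1: "A = U * V2" using four_block_empty[OF c(1)] by simp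
    have "V2 * V2' = four_block_mat (V * V' + U' * a * 0\<^sub>m 1 d) (V * 0\<^sub>m c 0 + U' * a * 0\<^sub>m 1 0)
         (0\<^sub>m 0 c * V' + 0\<^sub>m 0 1 * 0\<^sub>m 1 d) (0\<^sub>m 0 c * 0\<^sub>m c 0 + 0\<^sub>m 0 1 * 0\<^sub>m 1 0)"
      unfolding V2_def V2'_def
      by (rule mult_four_block_mat[OF c(2) mult_carrier_mat[OF c(3) cA(2)] zero_carrier_mat zero_carrier_mat
            c(4) zero_carrier_mat zero_carrier_mat zero_carrier_mat])
    also have "\<dots> = 1\<^sub>m d" using D e(3) four_block_empty[of "1\<^sub>m d" d d] by (simp add: mat_alg)
    finally show ?thesis using 1 c c2 e(2) by blast
  next
    case False
    then obtain p where p: "p < r" "b $$ (p, 0) \<noteq> 0" using cb by (metis eq_matI carrier_matD index_zero_mat less_one)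
    \<comment> \<open>A functional with g U = 0 and g a = 1: row p of the projection 1 - U U',
      scaled by the nonzero entry of b.\<close>
    define g where "g = mat 1 r (\<lambda>(i, j). (1\<^sub>m r - U * U') $$ (p, j) / b $$ (p, 0))"
    have cg: "g \<in> carrier_mat 1 r" by (simp add: g_def)
    have gX: "g * X = mat 1 k (\<lambda>(i, j). (X - U * (U' * X)) $$ (p, j) / b $$ (p, 0))"
      if X: "X \<in> carrier_mat r k" for X k
    proof (rule eq_matI)
      fix i j assume ij: "i < dim_row (mat 1 k (\<lambda>(i, j). (X - U * (U' * X)) $$ (p, j) / b $$ (p, 0)))"
        "j < dim_col (mat 1 k (\<lambda>(i, j). (X - U * (U' * X)) $$ (p, j) / b $$ (p, 0)))"
      have "X - U * (U' * X) = (1\<^sub>m r - U * U') * X"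
        using D carrier_matD[OF X] by (simp add: mat_alg)
      then have "(X - U * (U' * X)) $$ (p, j) = ((1\<^sub>m r - U * U') * X) $$ (p, j)" by simp
      also have "\<dots> = (\<Sum>l<r. (1\<^sub>m r - U * U') $$ (p, l) * X $$ (l, j))"
        using ij p D X by (simp add: scalar_prod_def lessThan_atLeast0)
      finally show "(g * X) $$ (i, j) = mat 1 k (\<lambda>(i, j). (X - U * (U' * X)) $$ (p, j) / b $$ (p, 0)) $$ (i, j)"
        using ij p D X cg by (simp add: g_def scalar_prod_def lessThan_atLeast0 sum_divide_distrib)
    qed (use X cg in auto)
    have gU: "g * U = 0\<^sub>m 1 d"
      unfolding gX[OF c(1)] using D p e(2) by (intro eq_matI) (auto simp: mat_alg)
    have ga: "g * a = 1\<^sub>m 1"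
      unfolding gX[OF cA(2)] using p by (intro eq_matI) (auto simp: b_def)
    define U2 where "U2 = four_block_mat U a (0\<^sub>m 0 d) (0\<^sub>m 0 1)"
    \<comment> \<open>The upper block is U' corrected so that it kills the new column a; the lower
      block g reads off the coordinate along a.\<close>
    define U2' where "U2' = four_block_mat (U' - U' * a * g) (0\<^sub>m d 0) g (0\<^sub>m 1 0)"
    define V2 where "V2 = four_block_mat V (0\<^sub>m d 1) (0\<^sub>m 1 c) (1\<^sub>m 1)"
    define V2' where "V2' = four_block_mat V' (0\<^sub>m c 1) (0\<^sub>m 1 d) (1\<^sub>m 1)"
    have cm: "U' - U' * a * g \<in> carrier_mat d r"
      by (rule carrier_matI; simp add: D carrier_matD[OF cg])
    have c2: "U2 \<in> carrier_mat r (Suc d)" "U2' \<in> carrier_mat (Suc d) r" "V2 \<in> carrier_mat (Suc d) (Suc c)"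
        "V2' \<in> carrier_mat (Suc c) (Suc d)"
      using four_block_carrier_mat[OF c(1) zero_carrier_mat[of 0 1]] four_block_carrier_mat[OF cm zero_carrier_mat[of 1 0]]
        four_block_carrier_mat[OF c(2) one_carrier_mat[of 1]] four_block_carrier_mat[OF c(4) one_carrier_mat[of 1]]
      unfolding U2_def U2'_def V2_def V2'_def by simp_all
    have "U2 * V2 = four_block_mat (U * V + a * 0\<^sub>m 1 c) (U * 0\<^sub>m d 1 + a * 1\<^sub>m 1)
         (0\<^sub>m 0 d * V + 0\<^sub>m 0 1 * 0\<^sub>m 1 c) (0\<^sub>m 0 d * 0\<^sub>m d 1 + 0\<^sub>m 0 1 * 1\<^sub>m 1)"
      unfolding U2_def V2_def
      by (rule mult_four_block_mat[OF c(1) cA(2) zero_carrier_mat zero_carrier_mat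
            c(2) zero_carrier_mat zero_carrier_mat one_carrier_mat])
    also have "\<dots> = A" unfolding A e(1) using D by (simp add: mat_alg)
    finally have 1: "A = U2 * V2" by simp
    have "V2 * V2' = four_block_mat (V * V' + 0\<^sub>m d 1 * 0\<^sub>m 1 d) (V * 0\<^sub>m c 1 + 0\<^sub>m d 1 * 1\<^sub>m 1)
         (0\<^sub>m 1 c * V' + 1\<^sub>m 1 * 0\<^sub>m 1 d) (0\<^sub>m 1 c * 0\<^sub>m c 1 + 1\<^sub>m 1 * 1\<^sub>m 1)"
      unfolding V2_def V2'_def
      by (rule mult_four_block_mat[OF c(2) zero_carrier_mat zero_carrier_mat one_carrier_mat
            c(4) zero_carrier_mat zero_carrier_mat one_carrier_mat])
    also have "\<dots> = 1\<^sub>m (d + 1)" using D e(3) by (simp add: mat_alg)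
    finally have 2: "V2 * V2' = 1\<^sub>m (Suc d)" by simp
    have "U2' * U2 = four_block_mat ((U' - U' * a * g) * U + 0\<^sub>m d 0 * 0\<^sub>m 0 d) ((U' - U' * a * g) * a + 0\<^sub>m d 0 * 0\<^sub>m 0 1)
         (g * U + 0\<^sub>m 1 0 * 0\<^sub>m 0 d) (g * a + 0\<^sub>m 1 0 * 0\<^sub>m 0 1)"
      unfolding U2_def U2'_def
      by (rule mult_four_block_mat[OF cm zero_carrier_mat cg zero_carrier_mat c(1) cA(2) zero_carrier_mat zero_carrier_mat])
    also have "\<dots> = 1\<^sub>m (d + 1)"
      using D e(2) gU ga carrier_matD[OF cg] by (simp add: mat_alg)
    finally have 3: "U2' * U2 = 1\<^sub>m (Suc d)" by simp
    show ?thesis using 1 2 3 c2 by blast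
  qed
qed

text \<open>In (U V)(U V) = U V the outer factors cancel against U' and V', which leaves V U =
  1.\<close>

lemma idempotent_split:
  fixes E :: "'k::field mat"
  assumes E: "E \<in> carrier_mat m m" "E * E = E"
  shows "\<exists>d B L. B \<in> carrier_mat m d \<and> L \<in> carrier_mat d m \<and> L * B = 1\<^sub>m d \<and> B * L = E"
proof -
  obtain d U V U' V' where c: "U \<in> carrier_mat m d" "V \<in> carrier_mat d m" "U' \<in> carrier_mat d m" "V' \<in> carrier_mat m d"
    and e: "E = U * V" "U' * U = 1\<^sub>m d" "V * V' = 1\<^sub>m d"
    using rank_factorization[OF E(1)] by blast
  note D = carrier_matD[OF c(1)] carrier_matD[OF c(2)] carrier_matD[OF c(3)] carrier_matD[OF c(4)]
  have "U' * (U * V * (U * V)) * V' = U' * (U * V) * V'" using E(2) e(1) by simp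
  also have "U' * (U * V * (U * V)) * V' = (U' * U) * (V * U) * (V * V')" using D by (simp add: mat_alg)
  also have "U' * (U * V) * V' = (U' * U) * (V * V')" using D by (simp add: mat_alg)
  finally have "V * U = 1\<^sub>m d" unfolding e using D by (simp add: mat_alg)
  then show ?thesis using c e by blast
qed

text \<open>As U is injective, A and V have the same kernel, and 1 - V' V is an idempotent onto it.
  Splitting it gives a basis B and coordinates L.\<close>

lemma kernel_basis:
  fixes A :: "'k::field mat"
  assumes A: "A \<in> carrier_mat r c"
  shows "\<exists>d B L. B \<in> carrier_mat c d \<and> L \<in> carrier_mat d c \<and> L * B = 1\<^sub>m d \<and> A * B = 0\<^sub>m r d \<and>
    (\<forall>X k. X \<in> carrier_mat c k \<longrightarrow> A * X = 0\<^sub>m r k \<longrightarrow> B * (L * X) = X)"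
proof -
  obtain d U V U' V' where c: "U \<in> carrier_mat r d" "V \<in> carrier_mat d c" "U' \<in> carrier_mat d r" "V' \<in> carrier_mat c d"
    and e: "A = U * V" "U' * U = 1\<^sub>m d" "V * V' = 1\<^sub>m d"
    using rank_factorization[OF A(1)] by blast
  note D = carrier_matD[OF c(1)] carrier_matD[OF c(2)] carrier_matD[OF c(3)] carrier_matD[OF c(4)]
  define E where "E = 1\<^sub>m c - V' * V"
  have cE: "E \<in> carrier_mat c c" using c by (auto simp: E_def)
  have VV: "V * (V' * X) = X" if "dim_row X = d" for X
    using mult_reduce[OF e(3), of X] D that by (simp add: mat_alg)
  have VE: "V * E = 0\<^sub>m d c" unfolding E_def using D VV by (simp add: mat_alg)
  have "E * E = E - V' * (V * E)" using D by (simp add: E_def mat_alg)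
  then have "E * E = E" using VE D cE by (simp add: mat_alg)
  then obtain k B L where BL: "B \<in> carrier_mat c k" "L \<in> carrier_mat k c" "L * B = 1\<^sub>m k" "B * L = E"
    using idempotent_split[OF cE] by blast
  note DB = carrier_matD[OF BL(1)] carrier_matD[OF BL(2)]
  have "E * B = B" unfolding BL(4)[symmetric] using BL(3) DB by (simp add: mat_alg)
  then have "A * B = U * (V * E) * B" unfolding e(1) using D DB cE by (metis carrier_matD mult_assoc_dim index_mult_mat(2,3))
  then have AB: "A * B = 0\<^sub>m r k" using VE D DB by (simp add: mat_alg)
  have "B * (L * X) = X" if X: "X \<in> carrier_mat c l" "A * X = 0\<^sub>m r l" for X l
  proof -
    have "V * X = U' * (A * X)"
      unfolding e(1) using D X(1) mult_reduce[OF e(2), of "V * X"] by (simp add: mat_alg)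
    then have "V * X = 0\<^sub>m d l" using X D by (simp add: mat_alg)
    then have "E * X = X" unfolding E_def using D X(1) by (simp add: mat_alg)
    then show ?thesis unfolding BL(4)[symmetric] using DB X(1) by (simp add: mat_alg)
  qed
  then show ?thesis using BL AB by blast
qed

section \<open>Homomorphisms and extensions into interval modules\<close>

text \<open>\<open>rdim W 0\<close> is junk in the encoding of representations. Giving the vertex 0
  the zero space lets strands from 0 obey the same criterion as the others.\<close>

definition ext_dim :: "'k rep \<Rightarrow> nat \<Rightarrow> nat" where
  "ext_dim W v = (if v = 0 then 0 else rdim W v)"

definition ext_arrow :: "'k::field rep \<Rightarrow> nat \<Rightarrow> 'k mat" where
  "ext_arrow W v = (if v = 0 then 0\<^sub>m (rdim W 1) 0 else arrow W v)"

text \<open>The composite \<open>W\<^sub>s \<rightarrow> W\<^sub>t\<close> for \<open>s \<le> t\<close>, with the convention \<open>W\<^sub>0 = 0\<close>.\<close>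

primrec transport :: "'k::field rep \<Rightarrow> nat \<Rightarrow> nat \<Rightarrow> 'k mat" where
  "transport W s 0 = 1\<^sub>m (ext_dim W s)"
| "transport W s (Suc t) = (if s < Suc t then ext_arrow W t * transport W s t else 1\<^sub>m (ext_dim W s))"

lemma ext_dim_pos [simp]: "0 < v \<Longrightarrow> ext_dim W v = rdim W v" "ext_dim W 0 = 0" "ext_dim W (Suc v) = rdim W (Suc v)"
  by (auto simp: ext_dim_def)

lemma ext_arrow_pos [simp]: "0 < v \<Longrightarrow> ext_arrow W v = arrow W v"
  by (auto simp: ext_arrow_def)

lemma ext_arrow_carrier: "is_rep n W \<Longrightarrow> v < n \<Longrightarrow> ext_arrow W v \<in> carrier_mat (ext_dim W (Suc v)) (ext_dim W v)"
  by (cases "v = 0") (auto simp: ext_arrow_def ext_dim_def is_rep_def)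

lemma arrow_carrier: "is_rep n W \<Longrightarrow> 1 \<le> v \<Longrightarrow> v < n \<Longrightarrow> arrow W v \<in> carrier_mat (rdim W (Suc v)) (rdim W v)"
  by (auto simp: is_rep_def)

lemma transport_refl [simp]: "transport W s s = 1\<^sub>m (ext_dim W s)"
  by (cases s) auto

lemma transport_carrier:
  "is_rep n W \<Longrightarrow> s \<le> t \<Longrightarrow> t \<le> n \<Longrightarrow> transport W s t \<in> carrier_mat (ext_dim W t) (ext_dim W s)"
proof (induction t)
  case (Suc t)
  show ?case
  proof (cases "s = Suc t")
    case False
    then have "transport W s t \<in> carrier_mat (ext_dim W t) (ext_dim W s)" using Suc by auto
    then show ?thesis using ext_arrow_carrier[OF Suc.prems(1), of t] Suc.prems False
      by (auto intro: mult_carrier_mat simp del: ext_dim_pos)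
  qed (auto simp del: ext_dim_pos)
qed simp

lemma transport_trans:
  assumes "is_rep n W" "s \<le> u" "u \<le> t" "t \<le> n"
  shows "transport W s t = transport W u t * transport W s u"
  using assms(3,4)
proof (induction t rule: dec_induct)
  case base
  show ?case using transport_carrier[OF assms(1,2)] base by simp
next
  case (step t)
  have "transport W s (Suc t) = ext_arrow W t * (transport W u t * transport W s u)"
    using step assms(2) by simp
  also have "\<dots> = ext_arrow W t * transport W u t * transport W s u"
    using transport_carrier[OF assms(1,2)] transport_carrier[OF assms(1) step(1)] ext_arrow_carrier[OF assms(1), of t] step
    by (intro assoc_mult_mat[symmetric]) (auto simp del: ext_dim_pos)
  also have "ext_arrow W t * transport W u t = transport W u (Suc t)"
    using step(1) by simp
  finally show ?case .
qed

lemma transport_first: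
  assumes "is_rep n W" "s < t" "t \<le> n"
  shows "transport W s t = transport W (Suc s) t * ext_arrow W s"
proof -
  have "transport W s (Suc s) = ext_arrow W s"
    using ext_arrow_carrier[OF assms(1), of s] assms by (simp del: ext_dim_pos)
  then show ?thesis using transport_trans[OF assms(1), of s "Suc s" t] assms by simp
qed

definition ext_hom :: "(nat \<Rightarrow> 'k::field mat) \<Rightarrow> nat \<Rightarrow> 'k mat" where
  "ext_hom f v = (if v = 0 then 0\<^sub>m 0 0 else f v)"

lemma rep_hom_carrier: "f \<in> rep_hom n M N \<Longrightarrow> 1 \<le> v \<Longrightarrow> v \<le> n \<Longrightarrow> f v \<in> carrier_mat (rdim N v) (rdim M v)"
  by (auto simp: rep_hom_def)

lemma rep_hom_comm: "f \<in> rep_hom n M N \<Longrightarrow> 1 \<le> v \<Longrightarrow> v < n \<Longrightarrow> f (Suc v) * arrow M v = arrow N v * f v"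
  by (auto simp: rep_hom_def)

lemma rep_homI:
  assumes "\<And>v. 1 \<le> v \<Longrightarrow> v \<le> n \<Longrightarrow> f v \<in> carrier_mat (rdim N v) (rdim M v)"
    "\<And>v. 1 \<le> v \<Longrightarrow> v < n \<Longrightarrow> f (Suc v) * arrow M v = arrow N v * f v"
  shows "f \<in> rep_hom n M N"
  using assms by (auto simp: rep_hom_def)

lemma ext_hom_carrier: "f \<in> rep_hom n M N \<Longrightarrow> v \<le> n \<Longrightarrow> ext_hom f v \<in> carrier_mat (ext_dim N v) (ext_dim M v)"
  using rep_hom_carrier[of f n M N v] by (auto simp: ext_hom_def ext_dim_def)

lemma ext_hom_comm:
  assumes "is_rep n M" "is_rep n N" "f \<in> rep_hom n M N" "v < n"
  shows "ext_hom f (Suc v) * ext_arrow M v = ext_arrow N v * ext_hom f v"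
proof (cases "v = 0")
  case True
  then show ?thesis
    using ext_hom_carrier[OF assms(3), of v] ext_hom_carrier[OF assms(3), of "Suc v"] assms(4)
      ext_arrow_carrier[OF assms(1), of v] ext_arrow_carrier[OF assms(2), of v]
    by (intro eq_mat_empty) auto
next
  case False
  then show ?thesis using rep_hom_comm[OF assms(3), of v] assms by (simp add: ext_hom_def)
qed

lemma ext_hom_transport:
  assumes "is_rep n M" "is_rep n N" "f \<in> rep_hom n M N" "s \<le> t" "t \<le> n"
  shows "ext_hom f t * transport M s t = transport N s t * ext_hom f s"
  using assms(4,5)
proof (induction t rule: dec_induct)
  case base
  then show ?case using ext_hom_carrier[OF assms(3), of s] by simp
next
  case (step t)
  note c = ext_hom_carrier[OF assms(3), of "Suc t"] ext_hom_carrier[OF assms(3), of t] ext_hom_carrier[OF assms(3), of s]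
   ext_arrow_carrier[OF assms(1), of t] ext_arrow_carrier[OF assms(2), of t]
   transport_carrier[OF assms(1) step(1)] transport_carrier[OF assms(2) step(1)]
  have "ext_hom f (Suc t) * transport M s (Suc t) = ext_hom f (Suc t) * (ext_arrow M t * transport M s t)"
    using step by simp
  also have "\<dots> = ext_hom f (Suc t) * ext_arrow M t * transport M s t"
    using c step by (intro assoc_mult_mat[symmetric]) (auto simp del: ext_dim_pos)
  also have "\<dots> = ext_arrow N t * ext_hom f t * transport M s t"
    using ext_hom_comm[OF assms(1-3), of t] step by simp
  also have "\<dots> = ext_arrow N t * (ext_hom f t * transport M s t)"
    using c step by (intro assoc_mult_mat) (auto simp del: ext_dim_pos)
  also have "\<dots> = ext_arrow N t * (transport N s t * ext_hom f s)"
    using step by simp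
  also have "\<dots> = ext_arrow N t * transport N s t * ext_hom f s"
    using c step by (intro assoc_mult_mat[symmetric]) (auto simp del: ext_dim_pos)
  finally show ?case using step by simp
qed

section \<open>Homomorphisms and cocycles with values in an interval module\<close>

lemma interval_rep_simps:
  "rdim (interval_rep (i, j)) v = (if i < v \<and> v \<le> j then 1 else 0)"
  "arrow (interval_rep (i, j)) v = (if i < v \<and> v + 1 \<le> j then 1\<^sub>m 1
     else 0\<^sub>m (if i < v + 1 \<and> v + 1 \<le> j then 1 else 0) (if i < v \<and> v \<le> j then 1 else 0))"
  by (auto simp: interval_rep_def Let_def)

lemma is_rep_interval: "is_rep n (interval_rep (i, j))"
  by (auto simp: is_rep_def interval_rep_simps)

text \<open>Between vertices of the support the arrows are identities, so commutation there holds by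
  the choice of the components. The only condition left comes from the arrow i -> i + 1: phi has to
  kill the image of W_i.\<close>

lemma hom_to_interval:
  fixes W :: "'k::field rep"
  assumes W: "is_rep n W" and ij: "i < j" "j \<le> n"
    and \<phi>: "\<phi> \<in> carrier_mat 1 (ext_dim W j)" "\<phi> * transport W i j = 0\<^sub>m 1 (ext_dim W i)"
  shows "(\<lambda>v. if i < v \<and> v \<le> j then \<phi> * transport W v j else 0\<^sub>m 0 (rdim W v)) \<in> rep_hom n W (interval_rep (i, j))"
    (is "?f \<in> _")
proof (rule rep_homI)
  show c: "?f v \<in> carrier_mat (rdim (interval_rep (i, j)) v) (rdim W v)" if "1 \<le> v" "v \<le> n" for v
    using that transport_carrier[OF W, of v j] \<phi>(1) ij
    by (auto simp: interval_rep_simps)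
  fix v assume v: "1 \<le> v" "v < n"
  note d = carrier_matD[OF c[of v]] carrier_matD[OF c[of "Suc v"]] carrier_matD[OF arrow_carrier[OF W v]]
    carrier_matD[OF arrow_carrier[OF is_rep_interval[of n i j] v]]
  show "?f (Suc v) * arrow W v = arrow (interval_rep (i, j)) v * ?f v"
  proof (cases "i < Suc v \<and> Suc v \<le> j")
    case False
    then show ?thesis using v d
      by (intro eq_mat_empty) (auto simp: interval_rep_simps)
  next
    case True
    have t: "transport W v j = transport W (Suc v) j * arrow W v"
      using transport_first[OF W, of v j] True ij v by simp
    have e: "?f (Suc v) * arrow W v = \<phi> * transport W v j"
      unfolding t using True transport_carrier[OF W, of "Suc v" j] ij arrow_carrier[OF W v] \<phi>(1) by simp
    show ?thesis
    proof (cases "i < v")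
      case True
      then show ?thesis unfolding e using \<open>i < Suc v \<and> Suc v \<le> j\<close> ij
        by (simp add: interval_rep_simps mult_one_dim carrier_matD(1)[OF \<phi>(1), simplified])
    next
      case False
      then have "i = v" using True by simp
      then show ?thesis unfolding e using \<phi>(2) v ij by (simp add: interval_rep_simps)
    qed
  qed
qed

lemma hom_to_interval_determined:
  fixes W :: "'k::field rep"
  assumes W: "is_rep n W" and ij: "i < j" "j \<le> n" and f: "f \<in> rep_hom n W (interval_rep (i, j))"
  shows "\<And>v. i < v \<Longrightarrow> v \<le> j \<Longrightarrow> f v = f j * transport W v j"
    and "f j * transport W i j = 0\<^sub>m 1 (ext_dim W i)"
proof -
  have cj: "f j \<in> carrier_mat 1 (rdim W j)"
    using rep_hom_carrier[OF f, of j] ij by (simp add: interval_rep_simps)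
  show *: "f v = f j * transport W v j" if "i < v" "v \<le> j" for v
    using that(2,1)
  proof (induction v rule: inc_induct)
    case base
    then show ?case using cj ij by (simp add: ext_dim_def)
  next
    case (step v)
    have cv: "f v \<in> carrier_mat 1 (rdim W v)"
      using rep_hom_carrier[OF f, of v] ij step by (simp add: interval_rep_simps)
    have "f v = f (Suc v) * arrow W v"
      using rep_hom_comm[OF f, of v] step ij cv by (simp add: interval_rep_simps)
    also have "\<dots> = f j * transport W (Suc v) j * arrow W v" using step by simp
    also have "\<dots> = f j * (transport W (Suc v) j * arrow W v)"
      using cj transport_carrier[OF W, of "Suc v" j] arrow_carrier[OF W, of v] step ij by simp
    finally show ?case using transport_first[OF W, of v j] step ij by simp
  qed
  show "f j * transport W i j = 0\<^sub>m 1 (ext_dim W i)"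
  proof (cases "i = 0")
    case True
    then show ?thesis using cj transport_carrier[OF W, of i j] ij by (intro eq_mat_empty) auto
  next
    case False
    have "f j * transport W i j = f j * transport W (Suc i) j * arrow W i"
      using transport_first[OF W, of i j] False cj transport_carrier[OF W, of "Suc i" j] arrow_carrier[OF W, of i] ij by simp
    also have "\<dots> = f (Suc i) * arrow W i" using *[of "Suc i"] ij by simp
    also have "\<dots> = 0\<^sub>m 1 0 * f i"
      using rep_hom_comm[OF f, of i] False ij by (simp add: interval_rep_simps)
    also have "\<dots> = 0\<^sub>m 1 (rdim W i)"
      using rep_hom_carrier[OF f, of i] False ij by (simp add: interval_rep_simps)
    finally show ?thesis using False by simp
  qed
qed

text \<open>The right side is injectivity of composition with W_i -> W_j on functionals.\<close>

lemma hom_vanishes_interval_iff: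
  fixes W :: "'k::field rep"
  assumes W: "is_rep n W" and ij: "i < j" "j \<le> n"
  shows "hom_vanishes n W (interval_rep (i, j)) \<longleftrightarrow>
    (\<forall>\<phi>\<in>carrier_mat 1 (ext_dim W j). \<phi> * transport W i j = 0\<^sub>m 1 (ext_dim W i) \<longrightarrow> \<phi> = 0\<^sub>m 1 (ext_dim W j))"
    (is "?L \<longleftrightarrow> ?R")
proof (intro iffI ballI impI)
  fix \<phi> assume L: ?L and \<phi>: "\<phi> \<in> carrier_mat 1 (ext_dim W j)" "\<phi> * transport W i j = 0\<^sub>m 1 (ext_dim W i)"
  have "j \<in> {1..n}" using ij by simp
  from bspec[OF bspec[OF L[unfolded hom_vanishes_def hom_eq_def hom_zero_def] hom_to_interval[OF W ij \<phi>]] this]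
  have "\<phi> * transport W j j = 0\<^sub>m 1 (rdim W j)"
    using ij by (simp add: interval_rep_simps)
  then show "\<phi> = 0\<^sub>m 1 (ext_dim W j)" using \<phi> ij by simp
next
  assume R: ?R
  show ?L
    unfolding hom_vanishes_def hom_eq_def hom_zero_def
  proof (intro ballI)
    fix f :: "nat \<Rightarrow> 'k mat" and v assume f: "f \<in> rep_hom n W (interval_rep (i, j))" and v: "v \<in> {1..n}"
    note h = hom_to_interval_determined[OF W ij f]
    have "f j = 0\<^sub>m 1 (ext_dim W j)"
      using R h(2) rep_hom_carrier[OF f, of j] ij by (simp add: interval_rep_simps)
    then have "f v = 0\<^sub>m 1 (rdim W v)" if "i < v" "v \<le> j"
      using h(1)[OF that] transport_carrier[OF W, of v j] that ij by simp
    moreover have "f v = 0\<^sub>m 0 (rdim W v)" if "\<not> (i < v \<and> v \<le> j)"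
      using rep_hom_carrier[OF f, of v] v that by (intro eq_mat_empty) (auto simp: interval_rep_simps)
    ultimately show "f v = 0\<^sub>m (rdim (interval_rep (i, j)) v) (rdim W v)" by (auto simp: interval_rep_simps)
  qed
qed

text \<open>
  \<open>Ext\<^sup>1(W, V)\<close> is the cokernel of \<open>\<Prod>Hom(W\<^sub>v, V\<^sub>v) \<rightarrow> \<Prod>Hom(W\<^sub>v, V\<^sub>v\<^sub>+\<^sub>1)\<close>.
\<close>

definition ext_splits :: "nat \<Rightarrow> 'k::field rep \<Rightarrow> 'k rep \<Rightarrow> bool" where
  "ext_splits n W V \<longleftrightarrow>
     (\<forall>c. (\<forall>v\<in>{1..<n}. c v \<in> carrier_mat (rdim V (Suc v)) (rdim W v)) \<longrightarrow>
       (\<exists>f. (\<forall>v\<in>{1..n}. f v \<in> carrier_mat (rdim V v) (rdim W v)) \<and>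
         (\<forall>v\<in>{1..<n}. c v = f (Suc v) * arrow W v - arrow V v * f v)))"

text \<open>Inside the support the cocycle equation can be solved downwards from j. One equation
  remains, at the arrow i -> i + 1, and its freedom is a functional on W_j; so the right side is
  surjectivity of composition with W_i -> W_j.\<close>

lemma ext_splits_interval_iff:
  fixes W :: "'k::field rep"
  assumes W: "is_rep n W" and ij: "i < j" "j \<le> n"
  shows "ext_splits n W (interval_rep (i, j)) \<longleftrightarrow>
    (\<forall>\<psi>\<in>carrier_mat 1 (ext_dim W i). \<exists>\<phi>\<in>carrier_mat 1 (ext_dim W j). \<phi> * transport W i j = \<psi>)"
    (is "?L \<longleftrightarrow> ?R")
proof (intro iffI ballI)
  fix \<psi> :: "'k mat" assume L: ?L and \<psi>: "\<psi> \<in> carrier_mat 1 (ext_dim W i)"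
  show "\<exists>\<phi>\<in>carrier_mat 1 (ext_dim W j). \<phi> * transport W i j = \<psi>"
  proof (cases "i = 0")
    case True
    then show ?thesis using \<psi> transport_carrier[OF W, of i j] ij
      by (intro bexI[of _ "0\<^sub>m 1 (ext_dim W j)"] eq_mat_empty) auto
  next
    case False
    \<comment> \<open>A cocycle concentrated at the arrow i -> i + 1, where the module enters its
      support.\<close>
    define c where "c v = (if v = i then \<psi> else 0\<^sub>m (rdim (interval_rep (i, j) :: 'k rep) (Suc v)) (rdim W v))" for v
    have "\<forall>v\<in>{1..<n}. c v \<in> carrier_mat (rdim (interval_rep (i, j) :: 'k rep) (Suc v)) (rdim W v)"
      using \<psi> False ij by (auto simp: c_def interval_rep_simps)
    from mp[OF spec[OF L[unfolded ext_splits_def], of c] this] obtain f where f: "\<And>v. v\<in>{1..n} \<Longrightarrow> f v \<in> carrier_mat (rdim (interval_rep (i, j) :: 'k rep) v) (rdim W v)"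
      and e: "\<And>v. v\<in>{1..<n} \<Longrightarrow> c v = f (Suc v) * arrow W v - arrow (interval_rep (i, j)) v * f v"
      by blast
    have cj: "f j \<in> carrier_mat 1 (rdim W j)" using f[of j] ij by (simp add: interval_rep_simps)
    have *: "f v = f j * transport W v j" if "i < v" "v \<le> j" for v
      using that(2,1)
    proof (induction v rule: inc_induct)
      case base
      then show ?case using cj ij by (simp add: ext_dim_def)
    next
      case (step v)
      have cv: "f v \<in> carrier_mat 1 (rdim W v)" "f (Suc v) \<in> carrier_mat 1 (rdim W (Suc v))"
        using f[of v] f[of "Suc v"] ij step by (simp_all add: interval_rep_simps)
      have "0\<^sub>m 1 (rdim W v) = f (Suc v) * arrow W v - f v"
        using e[of v] step ij cv by (simp add: interval_rep_simps c_def)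
      then have "f v = f (Suc v) * arrow W v - f v + f v"
        using cv by (metis left_add_zero_mat)
      also have "\<dots> = f (Suc v) * arrow W v"
        using cv arrow_carrier[OF W, of v] step ij by (intro eq_matI) auto
      also have "\<dots> = f j * transport W (Suc v) j * arrow W v" using step by simp
      also have "\<dots> = f j * (transport W (Suc v) j * arrow W v)"
        using cj transport_carrier[OF W, of "Suc v" j] arrow_carrier[OF W, of v] step ij by simp
      finally show ?case using transport_first[OF W, of v j] step ij by simp
    qed
    have ci: "f (Suc i) \<in> carrier_mat 1 (rdim W (Suc i))" "f i \<in> carrier_mat 0 (rdim W i)"
      using f[of "Suc i"] f[of i] ij False by (simp_all add: interval_rep_simps)
    have "\<psi> = f (Suc i) * arrow W i - 0\<^sub>m 1 0 * f i"
      using e[of i] False ij by (simp add: interval_rep_simps c_def)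
    also have "\<dots> = f (Suc i) * arrow W i"
      using ci arrow_carrier[OF W, of i] False ij by (simp add: mat_alg)
    also have "\<dots> = f j * transport W (Suc i) j * arrow W i" using *[of "Suc i"] ij by simp
    also have "\<dots> = f j * transport W i j"
      using transport_first[OF W, of i j] False cj transport_carrier[OF W, of "Suc i" j] arrow_carrier[OF W, of i] ij by simp
    finally show ?thesis using cj ij by force
  qed
next
  assume R: ?R
  show ?L
    unfolding ext_splits_def
  proof (intro allI impI)
    fix c :: "nat \<Rightarrow> 'k mat"
    assume c: "\<forall>v\<in>{1..<n}. c v \<in> carrier_mat (rdim (interval_rep (i, j) :: 'k rep) (Suc v)) (rdim W v)"
    \<comment> \<open>A particular solution inside the support, started with 0 at j; the index is
      the distance to j.\<close>
    define G where "G = rec_nat (0\<^sub>m 1 (rdim W j)) (\<lambda>k x. x * arrow W (j - Suc k) - c (j - Suc k))"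
    have cG: "G k \<in> carrier_mat 1 (rdim W (j - k))" if "k < j - i" for k
      using that
    proof (induction k)
      case 0
      then show ?case by (simp add: G_def)
    next
      case (Suc k)
      have v: "j - Suc k \<in> {1..<n}" "i < Suc (j - Suc k)" "Suc (j - Suc k) \<le> j"
        using Suc.prems ij by auto
      have "c (j - Suc k) \<in> carrier_mat 1 (rdim W (j - Suc k))"
        using c[rule_format, OF v(1)] v(2,3) by (simp add: interval_rep_simps)
      moreover have "j - k = Suc (j - Suc k)" using Suc.prems by simp
      ultimately show ?case using Suc arrow_carrier[OF W, of "j - Suc k"] ij by (auto simp: G_def)
    qed
    define g where "g v = G (j - v)" for v
    have cg: "g v \<in> carrier_mat 1 (rdim W v)" if "i < v" "v \<le> j" for v
      using cG[of "j - v"] that by (simp add: g_def)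
    have g: "g v = g (Suc v) * arrow W v - c v" if "i < v" "v < j" for v
    proof -
      have "j - v = Suc (j - Suc v)" "j - Suc (j - Suc v) = v" using that by auto
      then show ?thesis by (simp add: g_def G_def)
    qed
    \<comment> \<open>The functional phi removes the defect of the particular solution at the arrow
      i -> i + 1. For i = 0 there is no such arrow.\<close>
    have "\<exists>\<phi>\<in>carrier_mat 1 (ext_dim W j). i \<noteq> 0 \<longrightarrow> \<phi> * transport W i j = c i - g (Suc i) * arrow W i"
    proof (cases "i = 0")
      case True
      then show ?thesis by (intro bexI[of _ "0\<^sub>m 1 (ext_dim W j)"]) simp_all
    next
      case False
      then have "c i - g (Suc i) * arrow W i \<in> carrier_mat 1 (ext_dim W i)"
        using c[rule_format, of i] cg[of "Suc i"] arrow_carrier[OF W, of i] ij by (auto simp: interval_rep_simps)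
      from R[rule_format, OF this] show ?thesis by (elim bexE) (intro bexI impI)
    qed
    then obtain \<phi> where \<phi>: "\<phi> \<in> carrier_mat 1 (rdim W j)"
      "i \<noteq> 0 \<Longrightarrow> \<phi> * transport W i j = c i - g (Suc i) * arrow W i" using ij by auto
    \<comment> \<open>Particular solution plus a solution of the homogeneous equation.\<close>
    define f where "f v = (if i < v \<and> v \<le> j then g v + \<phi> * transport W v j else 0\<^sub>m 0 (rdim W v))" for v
    have tc: "transport W v j \<in> carrier_mat (rdim W j) (rdim W v)" if "i < v" "v \<le> j" for v
      using transport_carrier[OF W that(2) ij(2)] that ij by simp
    have cf: "f v \<in> carrier_mat (rdim (interval_rep (i, j) :: 'k rep) v) (rdim W v)" for v
      using cg[of v] \<phi> tc[of v] by (auto simp: f_def interval_rep_simps)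
    have "c v = f (Suc v) * arrow W v - arrow (interval_rep (i, j)) v * f v" if v: "v \<in> {1..<n}" for v
    proof (cases "i < Suc v \<and> Suc v \<le> j")
      case False
      have "dim_row (c v) = 0" "dim_col (c v) = rdim W v"
        using c[rule_format, OF v] False by (auto simp: interval_rep_simps)
      then show ?thesis
        using False arrow_carrier[OF W, of v] cf[of v] v
        by (intro eq_mat_empty) (auto simp: interval_rep_simps)
    next
      case True
      note ca = arrow_carrier[OF W, of v]
      have cv: "c v \<in> carrier_mat 1 (rdim W v)"
        using c[rule_format, OF v] True by (auto simp: interval_rep_simps)
      have t: "transport W v j = transport W (Suc v) j * arrow W v"
        using transport_first[OF W, of v j] True ij v by simp
      have "f (Suc v) * arrow W v = g (Suc v) * arrow W v + \<phi> * transport W v j"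
        unfolding t using True cg[of "Suc v"] \<phi>(1) tc[of "Suc v"] ca v by (simp add: f_def mat_alg)
      moreover have "c v = g (Suc v) * arrow W v + \<phi> * transport W v j - arrow (interval_rep (i, j)) v * f v"
      proof (cases "i < v")
        case iv: True
        then have "arrow (interval_rep (i, j)) v * f v = g v + \<phi> * transport W v j"
          using True cg[of v] \<phi>(1) tc[of v] by (simp add: interval_rep_simps f_def mult_one_dim)
        then show ?thesis
          using g[of v] iv True cv cg[of "Suc v"] ca v \<phi>(1) tc[of v] by (intro eq_matI) auto
      next
        case False
        then have iv: "i = v" using True by simp
        then have "arrow (interval_rep (i, j)) v * f v = 0\<^sub>m 1 (rdim W v)"
          using True by (simp add: interval_rep_simps f_def mat_alg)
        moreover have "\<phi> * transport W v j = c v - g (Suc v) * arrow W v"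
          using \<phi>(2) iv v by simp
        ultimately show ?thesis
          using iv True cv cg[of "Suc v"] ca v by (intro eq_matI) auto
      qed
      ultimately show ?thesis by simp
    qed
    then show "\<exists>f. (\<forall>v\<in>{1..n}. f v \<in> carrier_mat (rdim (interval_rep (i, j) :: 'k rep) v) (rdim W v)) \<and>
      (\<forall>v\<in>{1..<n}. c v = f (Suc v) * arrow W v - arrow (interval_rep (i, j)) v * f v)"
      using cf by blast
  qed
qed

section \<open>Yoneda extensions and cocycles\<close>

lemma zero_mult_vec:
  "x \<in> carrier_vec c \<Longrightarrow> 0\<^sub>m r c *\<^sub>v (x :: 'a::semiring_0 vec) = 0\<^sub>v r"
  by (intro eq_vecI) (auto simp: scalar_prod_def)

lemma ball_choice: "\<forall>x\<in>S. \<exists>y\<in>A x. P x y \<Longrightarrow> \<exists>f. \<forall>x\<in>S. f x \<in> A x \<and> P x (f x)"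
  by metis

lemma mat_factor:
  fixes A :: "'k::field mat"
  assumes A: "A \<in> carrier_mat r c" and X: "X \<in> carrier_mat r m"
    and col: "\<And>k. k < m \<Longrightarrow> \<exists>y\<in>carrier_vec c. A *\<^sub>v y = col X k"
  shows "\<exists>Y\<in>carrier_mat c m. A * Y = X"
proof -
  obtain y where y: "\<And>k. k < m \<Longrightarrow> y k \<in> carrier_vec c" "\<And>k. k < m \<Longrightarrow> A *\<^sub>v y k = col X k"
    using col by metis
  define Y where "Y = mat_of_cols c (map y [0..<m])"
  have Y: "Y \<in> carrier_mat c m" by (rule carrier_matI) (simp_all add: Y_def)
  have "A * Y = X"
  proof (rule mat_col_eqI)
    fix k assume "k < dim_col X"
    then have k: "k < m" using X by simp
    then have "col Y k = y k" using y(1)[OF k] by (simp add: Y_def)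
    then show "col (A * Y) k = col X k" using y(2)[OF k] col_mult2[OF A Y k] by simp
  qed (use A X Y in auto)
  then show ?thesis using Y by blast
qed

lemma hom_comp_in:
  fixes f g :: "nat \<Rightarrow> 'k::field mat"
  assumes reps: "is_rep n A" "is_rep n B" "is_rep n C" and f: "f \<in> rep_hom n A B" and g: "g \<in> rep_hom n B C"
  shows "(\<lambda>v. g v * f v) \<in> rep_hom n A C"
proof (rule rep_homI)
  show "g v * f v \<in> carrier_mat (rdim C v) (rdim A v)" if "1 \<le> v" "v \<le> n" for v
    using rep_hom_carrier[OF f that] rep_hom_carrier[OF g that] by auto
  fix v assume v: "1 \<le> v" "v < n"
  note D = carrier_matD[OF rep_hom_carrier[OF f, of v]] carrier_matD[OF rep_hom_carrier[OF g, of v]]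
    carrier_matD[OF rep_hom_carrier[OF f, of "Suc v"]] carrier_matD[OF rep_hom_carrier[OF g, of "Suc v"]]
    carrier_matD[OF arrow_carrier[OF reps(1) v]] carrier_matD[OF arrow_carrier[OF reps(2) v]]
    carrier_matD[OF arrow_carrier[OF reps(3) v]]
  have "g (Suc v) * f (Suc v) * arrow A v = g (Suc v) * (arrow B v * f v)"
    using rep_hom_comm[OF f v] v D by (simp add: mat_alg)
  also have "\<dots> = g (Suc v) * arrow B v * f v" using v D by (simp add: mat_alg)
  also have "\<dots> = arrow C v * (g v * f v)" using rep_hom_comm[OF g v] v D by (simp add: mat_alg)
  finally show "g (Suc v) * f (Suc v) * arrow A v = arrow C v * (g v * f v)" .
qed

text \<open>Linear sections t of g, chosen at each vertex, fail to commute with the arrows by a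
  cocycle with values in N. If h solves the cocycle equation, t + f h is a homomorphism, and still a
  section since g f = 0.\<close>

lemma ext_splits_imp_ext_vanishes:
  fixes M N :: "'k::field rep"
  assumes M: "is_rep n M" and N: "is_rep n N" and s: "ext_splits n M N"
  shows "ext_vanishes n M N"
  unfolding ext_vanishes_def
proof (intro allI impI)
  fix E :: "'k rep" and f g assume E: "is_rep n E" and se: "short_exact n N f E g M"
  have f: "f \<in> rep_hom n N E" and g: "g \<in> rep_hom n E M" using se by (auto simp: short_exact_def)
  note cf = rep_hom_carrier[OF f] and cg = rep_hom_carrier[OF g]
  have im: "(\<lambda>x. f v *\<^sub>v x) ` carrier_vec (rdim N v) = {x \<in> carrier_vec (rdim E v). g v *\<^sub>v x = 0\<^sub>v (rdim M v)}"
    "(\<lambda>x. g v *\<^sub>v x) ` carrier_vec (rdim E v) = carrier_vec (rdim M v)" if "1 \<le> v" "v \<le> n" for v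
    using se that by (auto simp: short_exact_def)
  have gf: "g v * f v = 0\<^sub>m (rdim M v) (rdim N v)" if v: "1 \<le> v" "v \<le> n" for v
  proof (rule mat_col_eqI)
    fix k assume "k < dim_col (0\<^sub>m (rdim M v) (rdim N v) :: 'k mat)"
    then have k: "k < rdim N v" by simp
    have "f v *\<^sub>v unit_vec (rdim N v) k \<in> (\<lambda>x. f v *\<^sub>v x) ` carrier_vec (rdim N v)" by simp
    then have "g v *\<^sub>v (f v *\<^sub>v unit_vec (rdim N v) k) = 0\<^sub>v (rdim M v)" using im(1)[OF v] by auto
    moreover have "f v *\<^sub>v unit_vec (rdim N v) k = col (f v) k"
      using cf[OF v] k by (intro eq_vecI) auto
    ultimately show "col (g v * f v) k = col (0\<^sub>m (rdim M v) (rdim N v)) k"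
      using col_mult2[OF cg[OF v] cf[OF v] k] k by simp
  qed (use cf[OF v] cg[OF v] in auto)
  have "\<forall>v\<in>{1..n}. \<exists>t\<in>carrier_mat (rdim E v) (rdim M v). g v * t = 1\<^sub>m (rdim M v)"
  proof
    fix v assume "v \<in> {1..n}"
    then have v: "1 \<le> v" "v \<le> n" by auto
    show "\<exists>t\<in>carrier_mat (rdim E v) (rdim M v). g v * t = 1\<^sub>m (rdim M v)"
    proof (rule mat_factor[OF cg[OF v] one_carrier_mat])
      fix k assume "k < rdim M v"
      then have "col (1\<^sub>m (rdim M v) :: 'k mat) k \<in> carrier_vec (rdim M v)" by simp
      then show "\<exists>y\<in>carrier_vec (rdim E v). g v *\<^sub>v y = col (1\<^sub>m (rdim M v)) k"
        unfolding im(2)[OF v, symmetric] by auto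
    qed
  qed
  from ball_choice[OF this] obtain t
    where t0: "\<forall>v\<in>{1..n}. t v \<in> carrier_mat (rdim E v) (rdim M v) \<and> g v * t v = 1\<^sub>m (rdim M v)" by blast
  have t: "\<And>v. 1 \<le> v \<Longrightarrow> v \<le> n \<Longrightarrow> t v \<in> carrier_mat (rdim E v) (rdim M v)"
    "\<And>v. 1 \<le> v \<Longrightarrow> v \<le> n \<Longrightarrow> g v * t v = 1\<^sub>m (rdim M v)"
    using t0 by auto
  \<comment> \<open>The defect of t is killed by g, hence lifts along f by exactness.\<close>
  have "\<forall>v\<in>{1..<n}. \<exists>c\<in>carrier_mat (rdim N (Suc v)) (rdim M v).
      f (Suc v) * c = arrow E v * t v - t (Suc v) * arrow M v"
  proof
    fix v assume "v \<in> {1..<n}"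
    then have v: "1 \<le> v" "v < n" "1 \<le> Suc v" "Suc v \<le> n" "v \<le> n" by auto
    note C = arrow_carrier[OF E v(1,2)] arrow_carrier[OF M v(1,2)] cg[OF v(1,5)] cg[OF v(3,4)] t(1)[OF v(1,5)] t(1)[OF v(3,4)]
    note D = C[THEN carrier_matD(1)] C[THEN carrier_matD(2)]
    let ?X = "arrow E v * t v - t (Suc v) * arrow M v"
    have X: "?X \<in> carrier_mat (rdim E (Suc v)) (rdim M v)" using C by auto
    have "g (Suc v) * ?X = g (Suc v) * arrow E v * t v - g (Suc v) * t (Suc v) * arrow M v"
      using D by (simp add: mat_alg)
    also have "\<dots> = arrow M v * (g v * t v) - arrow M v"
      using rep_hom_comm[OF g v(1,2)] t(2)[OF v(3,4)] D by (simp add: mat_alg)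
    also have "\<dots> = 0\<^sub>m (rdim M (Suc v)) (rdim M v)"
      using t(2)[OF v(1,5)] D by (simp add: mat_alg)
    finally have gX: "g (Suc v) * ?X = 0\<^sub>m (rdim M (Suc v)) (rdim M v)" .
    show "\<exists>c\<in>carrier_mat (rdim N (Suc v)) (rdim M v). f (Suc v) * c = ?X"
    proof (rule mat_factor[OF cf[OF v(3,4)] X])
      fix k assume k: "k < rdim M v"
      have "g (Suc v) *\<^sub>v col ?X k = col (g (Suc v) * ?X) k" using col_mult2[OF C(4) X k] by simp
      then have "g (Suc v) *\<^sub>v col ?X k = 0\<^sub>v (rdim M (Suc v))" unfolding gX using k by simp
      moreover have "col ?X k \<in> carrier_vec (rdim E (Suc v))" using X by (metis carrier_matD(1) col_carrier_vec col_dim)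
      ultimately have "col ?X k \<in> (\<lambda>x. f (Suc v) *\<^sub>v x) ` carrier_vec (rdim N (Suc v))"
        unfolding im(1)[OF v(3,4)] by simp
      then show "\<exists>y\<in>carrier_vec (rdim N (Suc v)). f (Suc v) *\<^sub>v y = col ?X k" by auto
    qed
  qed
  from ball_choice[OF this] obtain c where c: "\<And>v. v \<in> {1..<n} \<Longrightarrow> c v \<in> carrier_mat (rdim N (Suc v)) (rdim M v)"
    "\<And>v. v \<in> {1..<n} \<Longrightarrow> f (Suc v) * c v = arrow E v * t v - t (Suc v) * arrow M v" by blast
  then have "\<forall>v\<in>{1..<n}. c v \<in> carrier_mat (rdim N (Suc v)) (rdim M v)" by blast
  from mp[OF spec[OF s[unfolded ext_splits_def], of c] this] obtain h where h: "\<And>v. v \<in> {1..n} \<Longrightarrow> h v \<in> carrier_mat (rdim N v) (rdim M v)"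
    "\<And>v. v \<in> {1..<n} \<Longrightarrow> c v = h (Suc v) * arrow M v - arrow N v * h v"
    by blast
  define t' where "t' v = t v + f v * h v" for v
  have ct': "t' v \<in> carrier_mat (rdim E v) (rdim M v)" if "1 \<le> v" "v \<le> n" for v
    using that t(1)[OF that] cf[OF that] h(1)[of v] by (auto simp: t'_def)
  have "t' \<in> rep_hom n M E"
  proof (rule rep_homI[OF ct'])
    fix v assume "1 \<le> v" "v < n"
    then have v: "1 \<le> v" "v < n" "1 \<le> Suc v" "Suc v \<le> n" "v \<le> n" "v \<in> {1..n}" "Suc v \<in> {1..n}" "v \<in> {1..<n}" by auto
    note C = arrow_carrier[OF E v(1,2)] arrow_carrier[OF M v(1,2)] arrow_carrier[OF N v(1,2)]
      cf[OF v(1,5)] cf[OF v(3,4)] t(1)[OF v(1,5)] t(1)[OF v(3,4)] h(1)[OF v(6)] h(1)[OF v(7)]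
    note D = C[THEN carrier_matD(1)] C[THEN carrier_matD(2)]
    have "f (Suc v) * c v = f (Suc v) * h (Suc v) * arrow M v - arrow E v * (f v * h v)"
    proof -
      have "f (Suc v) * c v = f (Suc v) * h (Suc v) * arrow M v - f (Suc v) * arrow N v * h v"
        unfolding h(2)[OF v(8)] using D by (simp add: mat_alg)
      then show ?thesis unfolding rep_hom_comm[OF f v(1,2)] using D by (simp add: mat_alg)
    qed
    then have e: "arrow E v * t v - t (Suc v) * arrow M v = f (Suc v) * h (Suc v) * arrow M v - arrow E v * (f v * h v)"
      using c(2)[OF v(8)] by simp
    have "t (Suc v) * arrow M v + f (Suc v) * h (Suc v) * arrow M v = arrow E v * t v + arrow E v * (f v * h v)"
      (is "?A + ?B = ?C + ?D")
    proof (rule eq_matI)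
      fix i j assume ij: "i < dim_row (?C + ?D)" "j < dim_col (?C + ?D)"
      have "(?C - ?A) $$ (i, j) = (?B - ?D) $$ (i, j)" using e by simp
      then have "?C $$ (i, j) - ?A $$ (i, j) = ?B $$ (i, j) - ?D $$ (i, j)"
        using ij D by simp
      then have "?A $$ (i, j) + ?B $$ (i, j) = ?C $$ (i, j) + ?D $$ (i, j)" by (simp add: algebra_simps)
      then show "(?A + ?B) $$ (i, j) = (?C + ?D) $$ (i, j)" using ij D by simp
    qed (use D in auto)
    then show "t' (Suc v) * arrow M v = arrow E v * t' v"
      unfolding t'_def using D by (simp add: mat_alg)
  qed
  moreover have "hom_eq n (g \<circ>\<^sub>r t') (hom_id M)"
    unfolding hom_eq_def hom_comp_def hom_id_def
  proof
    fix v assume v0: "v \<in> {1..n}"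
    then have v: "1 \<le> v" "v \<le> n" by auto
    note C = cf[OF v] cg[OF v] t(1)[OF v] h(1)[OF v0]
    note D = C[THEN carrier_matD(1)] C[THEN carrier_matD(2)]
    have "g v * (f v * h v) = 0\<^sub>m (rdim M v) (rdim M v)"
      using mult_reduce[OF gf[OF v], of "h v"] D by (simp add: mat_alg)
    then show "g v * t' v = 1\<^sub>m (rdim M v)" unfolding t'_def using t(2)[OF v] D by (simp add: mat_alg)
  qed
  ultimately show "\<exists>s\<in>rep_hom n M E. hom_eq n (g \<circ>\<^sub>r s) (hom_id M)" by blast
qed

text \<open>Blocks without rows or columns pad these maps to the shape of
  \<open>four_block_mat\<close>, whose multiplication rule then applies.\<close>

definition inj1 :: "nat \<Rightarrow> nat \<Rightarrow> 'k::field mat" where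
  "inj1 p q = four_block_mat (1\<^sub>m p) (0\<^sub>m p 0) (0\<^sub>m q p) (0\<^sub>m q 0)"

definition inj2 :: "nat \<Rightarrow> nat \<Rightarrow> 'k::field mat" where
  "inj2 p q = four_block_mat (0\<^sub>m p q) (0\<^sub>m p 0) (1\<^sub>m q) (0\<^sub>m q 0)"

definition prj1 :: "nat \<Rightarrow> nat \<Rightarrow> 'k::field mat" where
  "prj1 p q = four_block_mat (1\<^sub>m p) (0\<^sub>m p q) (0\<^sub>m 0 p) (0\<^sub>m 0 q)"

definition prj2 :: "nat \<Rightarrow> nat \<Rightarrow> 'k::field mat" where
  "prj2 p q = four_block_mat (0\<^sub>m q p) (1\<^sub>m q) (0\<^sub>m 0 p) (0\<^sub>m 0 q)"

lemma inj_prj_carrier: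
  "inj1 p q \<in> carrier_mat (p + q) p" "inj2 p q \<in> carrier_mat (p + q) q"
  "prj1 p q \<in> carrier_mat p (p + q)" "prj2 p q \<in> carrier_mat q (p + q)"
  unfolding inj1_def inj2_def prj1_def prj2_def carrier_mat_def by auto

lemmas inj_prj_dim [simp] = inj_prj_carrier[THEN carrier_matD(1)] inj_prj_carrier[THEN carrier_matD(2)]

lemma prj_inj:
  "prj1 p q * inj1 p q = (1\<^sub>m p :: 'k::field mat)" "prj2 p q * inj2 p q = (1\<^sub>m q :: 'k mat)"
  "prj1 p q * inj2 p q = (0\<^sub>m p q :: 'k mat)" "prj2 p q * inj1 p q = (0\<^sub>m q p :: 'k mat)"
  "inj1 p q * prj1 p q + inj2 p q * prj2 p q = (1\<^sub>m (p + q) :: 'k mat)"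
proof -
  note z = zero_carrier_mat one_carrier_mat
  have e: "four_block_mat X (0\<^sub>m r 0) (0\<^sub>m 0 c) (0\<^sub>m 0 0) = X" if "X \<in> carrier_mat r c" for X :: "'k mat" and r c
    by (rule four_block_empty[OF that])
  show "prj1 p q * inj1 p q = (1\<^sub>m p :: 'k mat)"
    unfolding inj1_def prj1_def
    by (subst mult_four_block_mat[OF z(2) z(1) z(1) z(1) z(2) z(1) z(1) z(1)])
      (simp add: mat_alg e[OF z(2)])
  show "prj2 p q * inj2 p q = (1\<^sub>m q :: 'k mat)"
    unfolding inj2_def prj2_def
    by (subst mult_four_block_mat[OF z(1) z(2) z(1) z(1) z(1) z(1) z(2) z(1)])
      (simp add: mat_alg e[OF z(2)])
  show "prj1 p q * inj2 p q = (0\<^sub>m p q :: 'k mat)"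
    unfolding inj2_def prj1_def
    by (subst mult_four_block_mat[OF z(2) z(1) z(1) z(1) z(1) z(1) z(2) z(1)])
      (simp add: mat_alg e[OF z(1)])
  show "prj2 p q * inj1 p q = (0\<^sub>m q p :: 'k mat)"
    unfolding inj1_def prj2_def
    by (subst mult_four_block_mat[OF z(1) z(2) z(1) z(1) z(2) z(1) z(1) z(1)])
      (simp add: mat_alg e[OF z(1)])
  have 1: "inj1 p q * prj1 p q = (four_block_mat (1\<^sub>m p) (0\<^sub>m p q) (0\<^sub>m q p) (0\<^sub>m q q) :: 'k mat)"
    unfolding inj1_def prj1_def
    by (subst mult_four_block_mat[OF z(2) z(1) z(1) z(1) z(2) z(1) z(1) z(1)])
      (simp add: mat_alg)
  have 2: "inj2 p q * prj2 p q = (four_block_mat (0\<^sub>m p p) (0\<^sub>m p q) (0\<^sub>m q p) (1\<^sub>m q) :: 'k mat)"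
    unfolding inj2_def prj2_def
    by (subst mult_four_block_mat[OF z(1) z(1) z(2) z(1) z(1) z(2) z(1) z(1)])
      (simp add: mat_alg)
  show "inj1 p q * prj1 p q + inj2 p q * prj2 p q = (1\<^sub>m (p + q) :: 'k mat)"
    unfolding 1 2
    by (subst add_four_block_mat[OF z(2) z(1) z(1) z(1) z(1) z(1) z(1) z(2)]) (simp add: mat_alg)
qed

text \<open>This replaces computations with blocks by the equations \<open>prj_inj\<close> of a
  biproduct.\<close>

lemma four_block_inj_prj:
  fixes A B :: "'k::field mat"
  assumes "A \<in> carrier_mat p' p" "B \<in> carrier_mat q' q"
  shows "four_block_mat A (0\<^sub>m p' q) (0\<^sub>m q' p) B = inj1 p' q' * A * prj1 p q + inj2 p' q' * B * prj2 p q"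
proof -
  note z = zero_carrier_mat one_carrier_mat
  have "inj1 p' q' * A = inj1 p' q' * four_block_mat A (0\<^sub>m p' 0) (0\<^sub>m 0 p) (0\<^sub>m 0 0)"
    using four_block_empty[OF assms(1)] by simp
  also have "\<dots> = four_block_mat A (0\<^sub>m p' 0) (0\<^sub>m q' p) (0\<^sub>m q' 0)"
    unfolding inj1_def
    by (subst mult_four_block_mat[OF z(2) z(1) z(1) z(1) assms(1) z(1) z(1) z(1)])
      (use assms in \<open>simp add: mat_alg\<close>)
  finally have 1: "inj1 p' q' * A * prj1 p q = four_block_mat A (0\<^sub>m p' q) (0\<^sub>m q' p) (0\<^sub>m q' q)"
    unfolding prj1_def
    by (simp only: mult_four_block_mat[OF assms(1) z(1) z(1) z(1) z(2) z(1) z(1) z(1)])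
      (use assms in \<open>simp add: mat_alg\<close>)
  have "inj2 p' q' * B = inj2 p' q' * four_block_mat B (0\<^sub>m q' 0) (0\<^sub>m 0 q) (0\<^sub>m 0 0)"
    using four_block_empty[OF assms(2)] by simp
  also have "\<dots> = four_block_mat (0\<^sub>m p' q) (0\<^sub>m p' 0) B (0\<^sub>m q' 0)"
    unfolding inj2_def
    by (subst mult_four_block_mat[OF z(1) z(1) z(2) z(1) assms(2) z(1) z(1) z(1)])
      (use assms in \<open>simp add: mat_alg\<close>)
  finally have 2: "inj2 p' q' * B * prj2 p q = four_block_mat (0\<^sub>m p' p) (0\<^sub>m p' q) (0\<^sub>m q' p) B"
    unfolding prj2_def
    by (simp only: mult_four_block_mat[OF z(1) z(1) assms(2) z(1) z(1) z(2) z(1) z(1)])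
      (use assms in \<open>simp add: mat_alg\<close>)
  show ?thesis
    unfolding 1 2
    by (subst add_four_block_mat[OF assms(1) z(1) z(1) z(1) z(1) z(1) z(1) assms(2)])
      (use assms in \<open>simp add: mat_alg\<close>)
qed

text \<open>The cocycle c is placed as the off-diagonal block of an extension with spaces N_v + M_v.
  A splitting has the identity as its M-component, and commutation with the arrows says that its
  N-component solves the cocycle equation.\<close>

lemma ext_vanishes_imp_ext_splits:
  fixes M N :: "'k::field rep"
  assumes M: "is_rep n M" and N: "is_rep n N" and ev: "ext_vanishes n M N"
  shows "ext_splits n M N"
  unfolding ext_splits_def
proof (intro allI impI)
  fix c :: "nat \<Rightarrow> 'k mat"
  assume c: "\<forall>v\<in>{1..<n}. c v \<in> carrier_mat (rdim N (Suc v)) (rdim M v)"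
  define i1 where "i1 v = (inj1 (rdim N v) (rdim M v) :: 'k mat)" for v
  define i2 where "i2 v = (inj2 (rdim N v) (rdim M v) :: 'k mat)" for v
  define p1 where "p1 v = (prj1 (rdim N v) (rdim M v) :: 'k mat)" for v
  define p2 where "p2 v = (prj2 (rdim N v) (rdim M v) :: 'k mat)" for v
  note defs = i1_def i2_def p1_def p2_def
  have dims [simp]: "dim_row (i1 v) = rdim N v + rdim M v" "dim_col (i1 v) = rdim N v"
    "dim_row (i2 v) = rdim N v + rdim M v" "dim_col (i2 v) = rdim M v"
    "dim_col (p1 v) = rdim N v + rdim M v" "dim_row (p1 v) = rdim N v"
    "dim_col (p2 v) = rdim N v + rdim M v" "dim_row (p2 v) = rdim M v" for v
    by (simp_all add: defs)
  have pi: "p1 v * i1 v = 1\<^sub>m (rdim N v)" "p2 v * i2 v = 1\<^sub>m (rdim M v)" "p1 v * i2 v = 0\<^sub>m (rdim N v) (rdim M v)"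
    "p2 v * i1 v = 0\<^sub>m (rdim M v) (rdim N v)" "i1 v * p1 v + i2 v * p2 v = 1\<^sub>m (rdim N v + rdim M v)" for v
    by (simp_all add: defs prj_inj)
  have pi': "dim_row X = rdim N v \<Longrightarrow> p1 v * (i1 v * X) = X" "dim_row X = rdim M v \<Longrightarrow> p2 v * (i2 v * X) = X"
    "dim_row X = rdim M v \<Longrightarrow> p1 v * (i2 v * X) = 0\<^sub>m (rdim N v) (dim_col X)"
    "dim_row X = rdim N v \<Longrightarrow> p2 v * (i1 v * X) = 0\<^sub>m (rdim M v) (dim_col X)" for v X
    by (simp_all add: mult_reduce[OF pi(1)] mult_reduce[OF pi(2)] mult_reduce[OF pi(3)] mult_reduce[OF pi(4)] mat_alg)
  define E where "E = Rep (\<lambda>v. rdim N v + rdim M v)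
     (\<lambda>v. i1 (Suc v) * arrow N v * p1 v + (i1 (Suc v) * c v * p2 v + i2 (Suc v) * arrow M v * p2 v))"
  have dE: "rdim E v = rdim N v + rdim M v" for v by (simp add: E_def)
  have aD: "dim_row (arrow N v) = rdim N (Suc v)" "dim_col (arrow N v) = rdim N v"
    "dim_row (arrow M v) = rdim M (Suc v)" "dim_col (arrow M v) = rdim M v"
    "dim_row (c v) = rdim N (Suc v)" "dim_col (c v) = rdim M v" if "1 \<le> v" "v < n" for v
    using arrow_carrier[OF N that] arrow_carrier[OF M that] c that by auto
  have aE: "arrow E v = i1 (Suc v) * arrow N v * p1 v + (i1 (Suc v) * c v * p2 v + i2 (Suc v) * arrow M v * p2 v)" for v
    by (simp add: E_def)
  have E: "is_rep n E"
    unfolding is_rep_def by (auto simp: dE aE intro!: carrier_matI simp: aD)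
  have i1h: "i1 \<in> rep_hom n N E"
  proof (rule rep_homI)
    show "i1 v \<in> carrier_mat (rdim E v) (rdim N v)" for v by (auto simp: dE intro: carrier_matI)
    show "i1 (Suc v) * arrow N v = arrow E v * i1 v" if "1 \<le> v" "v < n" for v
      unfolding aE using aD[OF that] by (simp add: mat_alg pi)
  qed
  have p2h: "p2 \<in> rep_hom n E M"
  proof (rule rep_homI)
    show "p2 v \<in> carrier_mat (rdim M v) (rdim E v)" for v by (auto simp: dE intro: carrier_matI)
    show "p2 (Suc v) * arrow E v = arrow M v * p2 v" if "1 \<le> v" "v < n" for v
      unfolding aE using aD[OF that] by (simp add: mat_alg pi')
  qed
  have "short_exact n N i1 E p2 M"
    unfolding short_exact_def
  proof (intro conjI i1h p2h ballI)
    fix v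
    have C: "i1 v \<in> carrier_mat (rdim E v) (rdim N v)" "i2 v \<in> carrier_mat (rdim E v) (rdim M v)"
      "p1 v \<in> carrier_mat (rdim N v) (rdim E v)" "p2 v \<in> carrier_mat (rdim M v) (rdim E v)"
      by (auto simp: dE intro: carrier_matI)
    have p1i1: "p1 v *\<^sub>v (i1 v *\<^sub>v x) = x" if "x \<in> carrier_vec (rdim N v)" for x
      using assoc_mult_mat_vec[OF C(3) C(1) that] that by (simp add: pi)
    have p2i1: "p2 v *\<^sub>v (i1 v *\<^sub>v x) = 0\<^sub>v (rdim M v)" if "x \<in> carrier_vec (rdim N v)" for x
      using assoc_mult_mat_vec[OF C(4) C(1) that] that
      by (simp add: pi zero_mult_vec)
    have p2i2: "p2 v *\<^sub>v (i2 v *\<^sub>v x) = x" if "x \<in> carrier_vec (rdim M v)" for x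
      using assoc_mult_mat_vec[OF C(4) C(2) that] that by (simp add: pi)
    show "inj_on (\<lambda>x. i1 v *\<^sub>v x) (carrier_vec (rdim N v))"
      using p1i1 by (metis inj_onI)
    show "(\<lambda>x. i1 v *\<^sub>v x) ` carrier_vec (rdim N v) = {x \<in> carrier_vec (rdim E v). p2 v *\<^sub>v x = 0\<^sub>v (rdim M v)}"
    proof (intro equalityI subsetI)
      fix y assume "y \<in> (\<lambda>x. i1 v *\<^sub>v x) ` carrier_vec (rdim N v)"
      then show "y \<in> {x \<in> carrier_vec (rdim E v). p2 v *\<^sub>v x = 0\<^sub>v (rdim M v)}"
        using p2i1 C(1) by auto
    next
      fix y assume "y \<in> {x \<in> carrier_vec (rdim E v). p2 v *\<^sub>v x = 0\<^sub>v (rdim M v)}"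
      then have y: "y \<in> carrier_vec (rdim E v)" "p2 v *\<^sub>v y = 0\<^sub>v (rdim M v)" by auto
      have "y = (i1 v * p1 v + i2 v * p2 v) *\<^sub>v y" using y(1) by (simp add: pi dE)
      also have "\<dots> = (i1 v * p1 v) *\<^sub>v y + (i2 v * p2 v) *\<^sub>v y"
        using C y(1) by (intro add_mult_distrib_mat_vec[of _ "rdim E v" "rdim E v"]) auto
      also have "(i1 v * p1 v) *\<^sub>v y = i1 v *\<^sub>v (p1 v *\<^sub>v y)" using C y(1) by simp
      also have "(i2 v * p2 v) *\<^sub>v y = i2 v *\<^sub>v (p2 v *\<^sub>v y)" using C y(1) by simp
      also have "\<dots> = 0\<^sub>v (rdim E v)" unfolding y(2) using C(2) by (intro eq_vecI) (auto simp: scalar_prod_def)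
      finally have "y = i1 v *\<^sub>v (p1 v *\<^sub>v y)" using C y(1) by (metis mult_mat_vec_carrier right_zero_vec)
      then show "y \<in> (\<lambda>x. i1 v *\<^sub>v x) ` carrier_vec (rdim N v)"
        using C(3) y(1) by (metis imageI mult_mat_vec_carrier)
    qed
    show "(\<lambda>x. p2 v *\<^sub>v x) ` carrier_vec (rdim E v) = carrier_vec (rdim M v)"
    proof (intro equalityI subsetI)
      fix y assume "y \<in> (\<lambda>x. p2 v *\<^sub>v x) ` carrier_vec (rdim E v)"
      then show "y \<in> carrier_vec (rdim M v)" using C(4) by auto
    next
      fix y :: "'k vec" assume "y \<in> carrier_vec (rdim M v)"
      then show "y \<in> (\<lambda>x. p2 v *\<^sub>v x) ` carrier_vec (rdim E v)"
        using p2i2[of y] C(2) by (metis imageI mult_mat_vec_carrier)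
    qed
  qed
  then obtain s where s: "s \<in> rep_hom n M E" "hom_eq n (p2 \<circ>\<^sub>r s) (hom_id M)"
    using ev E unfolding ext_vanishes_def by blast
  define f where "f v = p1 v * s v" for v
  have cs: "dim_row (s v) = rdim N v + rdim M v" "dim_col (s v) = rdim M v" if "1 \<le> v" "v \<le> n" for v
    using rep_hom_carrier[OF s(1) that] dE by auto
  show "\<exists>f. (\<forall>v\<in>{1..n}. f v \<in> carrier_mat (rdim N v) (rdim M v)) \<and>
         (\<forall>v\<in>{1..<n}. c v = f (Suc v) * arrow M v - arrow N v * f v)"
  proof (intro exI[of _ f] conjI ballI)
    show "f v \<in> carrier_mat (rdim N v) (rdim M v)" if "v \<in> {1..n}" for v
      using cs[of v] that by (auto simp: f_def intro: carrier_matI)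
    fix v assume "v \<in> {1..<n}"
    then have v: "1 \<le> v" "v < n" "v \<le> n" "Suc v \<le> n" "1 \<le> Suc v" by auto
    note D = cs[OF v(1,3)] cs[OF v(5,4)] aD[OF v(1,2)]
    have ps: "p2 v * s v = 1\<^sub>m (rdim M v)" using s(2) v by (auto simp: hom_eq_def hom_comp_def hom_id_def)
    have "f (Suc v) * arrow M v = p1 (Suc v) * (s (Suc v) * arrow M v)"
      unfolding f_def using D by (simp add: mat_alg)
    also have "\<dots> = p1 (Suc v) * arrow E v * s v"
      unfolding rep_hom_comm[OF s(1) v(1,2)] using D by (simp add: mat_alg aE)
    also have "p1 (Suc v) * arrow E v = arrow N v * p1 v + c v * p2 v"
      unfolding aE using D by (simp add: mat_alg pi')
    also have "(arrow N v * p1 v + c v * p2 v) * s v = arrow N v * f v + c v"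
      unfolding f_def using D ps by (simp add: mat_alg)
    finally have "f (Suc v) * arrow M v = arrow N v * f v + c v" .
    then show "c v = f (Suc v) * arrow M v - arrow N v * f v"
      using D by (intro eq_matI) (auto simp: f_def)
  qed
qed

lemma ext_vanishes_iff: "is_rep n M \<Longrightarrow> is_rep n N \<Longrightarrow> ext_vanishes n M N \<longleftrightarrow> ext_splits n M N"
  using ext_splits_imp_ext_vanishes ext_vanishes_imp_ext_splits by blast

section \<open>Orthogonality, retracts and direct sums\<close>

definition iso_on :: "'k::field rep \<Rightarrow> nat \<Rightarrow> nat \<Rightarrow> bool" where
  "iso_on W s t \<longleftrightarrow> (\<exists>B\<in>carrier_mat (ext_dim W s) (ext_dim W t).
     B * transport W s t = 1\<^sub>m (ext_dim W s) \<and> transport W s t * B = 1\<^sub>m (ext_dim W t))"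

text \<open>This merges the criteria for Hom and Ext^1 into invertibility. Preimages of the unit
  rows form B with B A = 1; then (A B - 1) A = 0, and injectivity applies to the rows of A B -
  1.\<close>

lemma invertible_iff_rows:
  fixes A :: "'k::field mat"
  assumes A: "A \<in> carrier_mat m k"
  shows "(\<forall>\<phi>\<in>carrier_mat 1 m. \<phi> * A = 0\<^sub>m 1 k \<longrightarrow> \<phi> = 0\<^sub>m 1 m) \<and> (\<forall>\<psi>\<in>carrier_mat 1 k. \<exists>\<phi>\<in>carrier_mat 1 m. \<phi> * A = \<psi>)
    \<longleftrightarrow> (\<exists>B\<in>carrier_mat k m. B * A = 1\<^sub>m k \<and> A * B = 1\<^sub>m m)" (is "?L \<longleftrightarrow> ?R")
proof
  assume ?R
  then obtain B where B: "B \<in> carrier_mat k m" "B * A = 1\<^sub>m k" "A * B = 1\<^sub>m m" by blast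
  note D = carrier_matD[OF A] carrier_matD[OF B(1)]
  show ?L
  proof (intro conjI ballI impI)
    fix \<phi> :: "'k mat" assume \<phi>: "\<phi> \<in> carrier_mat 1 m" "\<phi> * A = 0\<^sub>m 1 k"
    have "\<phi> = \<phi> * (A * B)" using \<phi>(1) B(3) by simp
    also have "\<dots> = \<phi> * A * B" using \<phi>(1) D by (simp add: mat_alg)
    finally show "\<phi> = 0\<^sub>m 1 m" using \<phi>(2) D by (simp add: mat_alg)
  next
    fix \<psi> :: "'k mat" assume \<psi>: "\<psi> \<in> carrier_mat 1 k"
    have "\<psi> * B * A = \<psi>" using \<psi> B(2) D by (simp add: mat_alg)
    then show "\<exists>\<phi>\<in>carrier_mat 1 m. \<phi> * A = \<psi>" using \<psi> B(1) by (intro bexI[of _ "\<psi> * B"]) auto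
  qed
next
  assume L: ?L
  have "\<forall>r\<in>{..<k}. \<exists>\<phi>\<in>carrier_mat 1 m. \<phi> * A = mat 1 k (\<lambda>(i, j). 1\<^sub>m k $$ (r, j))"
    using L by simp
  from ball_choice[OF this] obtain b where
    b: "\<forall>r\<in>{..<k}. b r \<in> carrier_mat 1 m \<and> b r * A = mat 1 k (\<lambda>(i, j). 1\<^sub>m k $$ (r, j))" by blast
  define B where "B = mat k m (\<lambda>(r, c). b r $$ (0, c))"
  have B: "B \<in> carrier_mat k m" by (simp add: B_def)
  have BA: "B * A = 1\<^sub>m k"
  proof (rule eq_matI)
    fix r c assume rc: "r < dim_row (1\<^sub>m k :: 'k mat)" "c < dim_col (1\<^sub>m k :: 'k mat)"
    then have br: "b r \<in> carrier_mat 1 m" "b r * A = mat 1 k (\<lambda>(i, j). 1\<^sub>m k $$ (r, j))" using b by auto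
    have "row B r = row (b r) 0" using rc br(1) by (intro eq_vecI) (auto simp: B_def)
    then have "(B * A) $$ (r, c) = (b r * A) $$ (0, c)" using rc br(1) A B by simp
    then show "(B * A) $$ (r, c) = 1\<^sub>m k $$ (r, c)" unfolding br(2) using rc by simp
  qed (use A B in auto)
  define X where "X = A * B - 1\<^sub>m m"
  have X: "X \<in> carrier_mat m m" using A B by (auto simp: X_def)
  have XA: "X * A = 0\<^sub>m m k"
    unfolding X_def using A B BA by (simp add: mat_alg)
  have "X = 0\<^sub>m m m"
  proof (rule eq_matI)
    fix p q assume pq: "p < dim_row (0\<^sub>m m m :: 'k mat)" "q < dim_col (0\<^sub>m m m :: 'k mat)"
    define x where "x = mat 1 m (\<lambda>(i, j). X $$ (p, j))"
    have x: "x \<in> carrier_mat 1 m" by (simp add: x_def)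
    have rx: "row x 0 = row X p" using X pq by (intro eq_vecI) (auto simp: x_def)
    have "x * A = 0\<^sub>m 1 k"
    proof (rule eq_matI)
      fix i j assume ij: "i < dim_row (0\<^sub>m 1 k :: 'k mat)" "j < dim_col (0\<^sub>m 1 k :: 'k mat)"
      then have "(x * A) $$ (i, j) = (X * A) $$ (p, j)" using rx X x A pq by simp
      then show "(x * A) $$ (i, j) = 0\<^sub>m 1 k $$ (i, j)" unfolding XA using ij pq by simp
    qed (use x A in auto)
    then have "x = 0\<^sub>m 1 m" using L x by blast
    then have "x $$ (0, q) = 0" using pq by simp
    then show "X $$ (p, q) = 0\<^sub>m m m $$ (p, q)" using pq by (simp add: x_def)
  qed (use X in auto)
  then have X0: "X $$ (i, j) = 0" if "i < m" "j < m" for i j using that by simp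
  have "A * B = 1\<^sub>m m"
  proof (rule eq_matI)
    fix i j assume "i < dim_row (1\<^sub>m m :: 'k mat)" "j < dim_col (1\<^sub>m m :: 'k mat)"
    then show "(A * B) $$ (i, j) = 1\<^sub>m m $$ (i, j)" using X0[of i j] A B by (simp add: X_def)
  qed (use A B in auto)
  then show ?R using B BA by blast
qed

definition orth :: "nat \<Rightarrow> 'k::field rep \<Rightarrow> 'k rep \<Rightarrow> bool" where
  "orth n W V \<longleftrightarrow> hom_vanishes n W V \<and> ext_vanishes n W V"

lemma orth_interval_iff:
  assumes "is_rep n W" "i < j" "j \<le> n"
  shows "orth n W (interval_rep (i, j)) \<longleftrightarrow> iso_on W i j"
  unfolding orth_def ext_vanishes_iff[OF assms(1) is_rep_interval] hom_vanishes_interval_iff[OF assms]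
    ext_splits_interval_iff[OF assms] iso_on_def
  using invertible_iff_rows[OF transport_carrier[OF assms(1) _ assms(3), of i]] assms(2) by simp

text \<open>Isomorphic representations are retracts of each other and summands are retracts of their
  sum, so one argument serves both situations.\<close>

definition retract :: "nat \<Rightarrow> 'k::field rep \<Rightarrow> 'k rep \<Rightarrow> bool" where
  "retract n V' V \<longleftrightarrow> (\<exists>\<iota>\<in>rep_hom n V' V. \<exists>\<pi>\<in>rep_hom n V V'. \<forall>v\<in>{1..n}. \<pi> v * \<iota> v = 1\<^sub>m (rdim V' v))"

lemma hom_vanishesD: "hom_vanishes n M N \<Longrightarrow> f \<in> rep_hom n M N \<Longrightarrow> v \<in> {1..n} \<Longrightarrow> f v = 0\<^sub>m (rdim N v) (rdim M v)"
  by (auto simp: hom_vanishes_def hom_eq_def hom_zero_def)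

lemma hom_vanishesI:
  "(\<And>f v. f \<in> rep_hom n M N \<Longrightarrow> v \<in> {1..n} \<Longrightarrow> f v = 0\<^sub>m (rdim N v) (rdim M v)) \<Longrightarrow> hom_vanishes n M N"
  by (auto simp: hom_vanishes_def hom_eq_def hom_zero_def)

lemma ext_splitsD:
  assumes "ext_splits n W V" "\<And>v. v \<in> {1..<n} \<Longrightarrow> c v \<in> carrier_mat (rdim V (Suc v)) (rdim W v)"
  obtains f where "\<And>v. v \<in> {1..n} \<Longrightarrow> f v \<in> carrier_mat (rdim V v) (rdim W v)"
    "\<And>v. v \<in> {1..<n} \<Longrightarrow> c v = f (Suc v) * arrow W v - arrow V v * f v"
proof -
  have "\<forall>v\<in>{1..<n}. c v \<in> carrier_mat (rdim V (Suc v)) (rdim W v)" using assms(2) by blast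
  from mp[OF spec[OF assms(1)[unfolded ext_splits_def], of c] this] show thesis using that by blast
qed

lemma retract_orth:
  assumes W: "is_rep n W" and V: "is_rep n V" and V': "is_rep n V'" and r: "retract n V' V" and o': "orth n W V"
  shows "orth n W V'"
proof -
  obtain \<iota> \<pi> where i: "\<iota> \<in> rep_hom n V' V" and p: "\<pi> \<in> rep_hom n V V'"
    and pi: "\<And>v. v \<in> {1..n} \<Longrightarrow> \<pi> v * \<iota> v = 1\<^sub>m (rdim V' v)" using r by (auto simp: retract_def)
  have ci: "\<iota> v \<in> carrier_mat (rdim V v) (rdim V' v)" "\<pi> v \<in> carrier_mat (rdim V' v) (rdim V v)" if "v \<in> {1..n}" for v
    using rep_hom_carrier[OF i, of v] rep_hom_carrier[OF p, of v] that by auto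
  have hv: "hom_vanishes n W V" and es: "ext_splits n W V"
    using o' ext_vanishes_iff[OF W V] by (auto simp: orth_def)
  have "hom_vanishes n W V'"
  proof (rule hom_vanishesI)
    fix f v assume f: "f \<in> rep_hom n W V'" and v: "v \<in> {1..n}"
    have cf: "f v \<in> carrier_mat (rdim V' v) (rdim W v)" using rep_hom_carrier[OF f] v by auto
    note D = carrier_matD[OF ci(1)[OF v]] carrier_matD[OF ci(2)[OF v]] carrier_matD[OF cf]
    have z: "\<iota> v * f v = 0\<^sub>m (rdim V v) (rdim W v)"
      using hom_vanishesD[OF hv hom_comp_in[OF W V' V f i] v] .
    have "f v = \<pi> v * (\<iota> v * f v)" using mult_reduce[OF pi[OF v], of "f v"] D by (simp add: mat_alg)
    then show "f v = 0\<^sub>m (rdim V' v) (rdim W v)" unfolding z by (simp add: mat_alg D)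
  qed
  moreover have "ext_splits n W V'"
    unfolding ext_splits_def
  proof (intro allI impI)
    fix c :: "nat \<Rightarrow> 'a mat" assume c: "\<forall>v\<in>{1..<n}. c v \<in> carrier_mat (rdim V' (Suc v)) (rdim W v)"
    have "\<iota> (Suc v) * c v \<in> carrier_mat (rdim V (Suc v)) (rdim W v)" if "v \<in> {1..<n}" for v
      using ci(1)[of "Suc v"] c that by (auto intro!: mult_carrier_mat)
    from ext_splitsD[OF es, of "\<lambda>v. \<iota> (Suc v) * c v", OF this] obtain f where
      f: "\<And>v. v \<in> {1..n} \<Longrightarrow> f v \<in> carrier_mat (rdim V v) (rdim W v)"
      "\<And>v. v \<in> {1..<n} \<Longrightarrow> \<iota> (Suc v) * c v = f (Suc v) * arrow W v - arrow V v * f v" by blast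
    show "\<exists>f. (\<forall>v\<in>{1..n}. f v \<in> carrier_mat (rdim V' v) (rdim W v)) \<and>
         (\<forall>v\<in>{1..<n}. c v = f (Suc v) * arrow W v - arrow V' v * f v)"
    proof (intro exI[of _ "\<lambda>v. \<pi> v * f v"] conjI ballI)
      show "\<pi> v * f v \<in> carrier_mat (rdim V' v) (rdim W v)" if "v \<in> {1..n}" for v
        using ci(2)[OF that] f(1)[OF that] by auto
      fix v assume v: "v \<in> {1..<n}"
      then have v': "1 \<le> v" "v < n" "v \<in> {1..n}" "Suc v \<in> {1..n}" by auto
      note D = ci(1)[OF v'(3), THEN carrier_matD(1)] ci(1)[OF v'(3), THEN carrier_matD(2)]
        ci(1)[OF v'(4), THEN carrier_matD(1)] ci(1)[OF v'(4), THEN carrier_matD(2)]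
        ci(2)[OF v'(3), THEN carrier_matD(1)] ci(2)[OF v'(3), THEN carrier_matD(2)]
        ci(2)[OF v'(4), THEN carrier_matD(1)] ci(2)[OF v'(4), THEN carrier_matD(2)]
        f(1)[OF v'(3), THEN carrier_matD(1)] f(1)[OF v'(3), THEN carrier_matD(2)]
        f(1)[OF v'(4), THEN carrier_matD(1)] f(1)[OF v'(4), THEN carrier_matD(2)]
        arrow_carrier[OF W v'(1,2), THEN carrier_matD(1)] arrow_carrier[OF W v'(1,2), THEN carrier_matD(2)]
        arrow_carrier[OF V v'(1,2), THEN carrier_matD(1)] arrow_carrier[OF V v'(1,2), THEN carrier_matD(2)]
        arrow_carrier[OF V' v'(1,2), THEN carrier_matD(1)] arrow_carrier[OF V' v'(1,2), THEN carrier_matD(2)]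
        c[rule_format, OF v, THEN carrier_matD(1)] c[rule_format, OF v, THEN carrier_matD(2)]
      have "c v = \<pi> (Suc v) * (\<iota> (Suc v) * c v)"
        using mult_reduce[OF pi[OF v'(4)], of "c v"] D by (simp add: mat_alg)
      also have "\<dots> = \<pi> (Suc v) * f (Suc v) * arrow W v - (\<pi> (Suc v) * arrow V v) * f v"
        unfolding f(2)[OF v] by (simp add: mat_alg D)
      also have "(\<pi> (Suc v) * arrow V v) * f v = arrow V' v * (\<pi> v * f v)"
        unfolding rep_hom_comm[OF p v'(1,2)] by (simp add: mat_alg D)
      finally show "c v = \<pi> (Suc v) * f (Suc v) * arrow W v - arrow V' v * (\<pi> v * f v)" .
    qed
  qed
  ultimately show ?thesis using ext_vanishes_iff[OF W V'] by (simp add: orth_def)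
qed

lemma ext_hom_retract:
  assumes "\<iota> \<in> rep_hom n V' V" "\<pi> \<in> rep_hom n V V'" "\<And>v. v \<in> {1..n} \<Longrightarrow> \<pi> v * \<iota> v = 1\<^sub>m (rdim V' v)" "v \<le> n"
  shows "ext_hom \<pi> v * ext_hom \<iota> v = 1\<^sub>m (ext_dim V' v)"
  using assms(3)[of v] assms(4) by (cases "v = 0") (auto simp: ext_hom_def intro: eq_mat_empty)

text \<open>The inverse is compressed to the retract: inclusion at t, inverse, projection at s. It
  inverts because both maps commute with the transports.\<close>

lemma retract_iso_on:
  assumes W: "is_rep n W" and W': "is_rep n W'" and r: "retract n W' W" and st: "s \<le> t" "t \<le> n" and iso: "iso_on W s t"
  shows "iso_on W' s t"
proof -
  obtain \<iota> \<pi> where i: "\<iota> \<in> rep_hom n W' W" and p: "\<pi> \<in> rep_hom n W W'"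
    and pi: "\<And>v. v \<in> {1..n} \<Longrightarrow> \<pi> v * \<iota> v = 1\<^sub>m (rdim W' v)" using r by (auto simp: retract_def)
  have e: "ext_hom \<pi> v * ext_hom \<iota> v = 1\<^sub>m (ext_dim W' v)" if "v \<le> n" for v
    using ext_hom_retract[OF i p _ that] pi by blast
  obtain B where B: "B \<in> carrier_mat (ext_dim W s) (ext_dim W t)" "B * transport W s t = 1\<^sub>m (ext_dim W s)"
    "transport W s t * B = 1\<^sub>m (ext_dim W t)" using iso by (auto simp: iso_on_def)
  have s: "s \<le> n" using st by simp
  note C = ext_hom_carrier[OF i s] ext_hom_carrier[OF i st(2)] ext_hom_carrier[OF p s] ext_hom_carrier[OF p st(2)]
    transport_carrier[OF W st] transport_carrier[OF W' st] B(1)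
  note D = C[THEN carrier_matD(1)] C[THEN carrier_matD(2)]
  note ti = ext_hom_transport[OF W' W i st] and tp = ext_hom_transport[OF W W' p st]
  have 1: "ext_hom \<pi> s * B * ext_hom \<iota> t * transport W' s t = 1\<^sub>m (ext_dim W' s)"
  proof -
    have "ext_hom \<pi> s * B * ext_hom \<iota> t * transport W' s t = ext_hom \<pi> s * (B * (ext_hom \<iota> t * transport W' s t))"
      by (simp add: mat_alg D)
    also have "\<dots> = ext_hom \<pi> s * (B * transport W s t * ext_hom \<iota> s)"
      unfolding ti by (simp add: mat_alg D)
    finally show ?thesis unfolding B(2) using D e[OF s] by (simp add: mat_alg)
  qed
  have 2: "transport W' s t * (ext_hom \<pi> s * B * ext_hom \<iota> t) = 1\<^sub>m (ext_dim W' t)"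
  proof -
    have "transport W' s t * (ext_hom \<pi> s * B * ext_hom \<iota> t) = transport W' s t * ext_hom \<pi> s * (B * ext_hom \<iota> t)"
      by (simp add: mat_alg D)
    also have "\<dots> = ext_hom \<pi> t * (transport W s t * B * ext_hom \<iota> t)"
      unfolding tp[symmetric] by (simp add: mat_alg D)
    finally show ?thesis unfolding B(3) using D e[OF st(2)] by (simp add: mat_alg)
  qed
  show ?thesis
    unfolding iso_on_def
    by (rule bexI[of _ "ext_hom \<pi> s * B * ext_hom \<iota> t"]) (use 1 2 D in \<open>auto intro: carrier_matI\<close>)
qed

lemma rep_iso_iff:
  "rep_iso n M N \<longleftrightarrow> (\<exists>f\<in>rep_hom n M N. \<exists>g\<in>rep_hom n N M. \<forall>v\<in>{1..n}. g v * f v = 1\<^sub>m (rdim M v) \<and> f v * g v = 1\<^sub>m (rdim N v))"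
  unfolding rep_iso_def hom_eq_def hom_comp_def hom_id_def by blast

lemma rep_iso_retract: "rep_iso n M N \<Longrightarrow> retract n M N" "rep_iso n M N \<Longrightarrow> retract n N M"
  unfolding rep_iso_iff retract_def by blast+

lemma rep_iso_sym: "rep_iso n M N \<Longrightarrow> rep_iso n N M"
  unfolding rep_iso_iff by blast

lemma hom_id_in: "is_rep n M \<Longrightarrow> hom_id M \<in> rep_hom n M M"
  by (intro rep_homI) (simp_all add: hom_id_def mult_one_dim carrier_matD[OF arrow_carrier])

lemma rep_iso_refl: "is_rep n M \<Longrightarrow> rep_iso n M M"
  unfolding rep_iso_iff using hom_id_in[of n M] by (intro bexI[of _ "hom_id M"]) (auto simp: hom_id_def)

lemma rep_iso_trans:
  assumes "is_rep n L" "is_rep n M" "is_rep n N" "rep_iso n L M" "rep_iso n M N"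
  shows "rep_iso n L N"
proof -
  obtain f g where f: "f \<in> rep_hom n L M" "g \<in> rep_hom n M L"
    "\<And>v. v \<in> {1..n} \<Longrightarrow> g v * f v = 1\<^sub>m (rdim L v)" "\<And>v. v \<in> {1..n} \<Longrightarrow> f v * g v = 1\<^sub>m (rdim M v)"
    using assms(4) unfolding rep_iso_iff by blast
  obtain f' g' where f': "f' \<in> rep_hom n M N" "g' \<in> rep_hom n N M"
    "\<And>v. v \<in> {1..n} \<Longrightarrow> g' v * f' v = 1\<^sub>m (rdim M v)" "\<And>v. v \<in> {1..n} \<Longrightarrow> f' v * g' v = 1\<^sub>m (rdim N v)"
    using assms(5) unfolding rep_iso_iff by blast
  have "g v * g' v * (f' v * f v) = 1\<^sub>m (rdim L v) \<and> f' v * f v * (g v * g' v) = 1\<^sub>m (rdim N v)" if v: "v \<in> {1..n}" for v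
  proof -
    have C: "f v \<in> carrier_mat (rdim M v) (rdim L v)" "g v \<in> carrier_mat (rdim L v) (rdim M v)"
      "f' v \<in> carrier_mat (rdim N v) (rdim M v)" "g' v \<in> carrier_mat (rdim M v) (rdim N v)"
      using v rep_hom_carrier[OF f(1)] rep_hom_carrier[OF f(2)] rep_hom_carrier[OF f'(1)] rep_hom_carrier[OF f'(2)] by auto
    note D = C[THEN carrier_matD(1)] C[THEN carrier_matD(2)]
    have "g v * g' v * (f' v * f v) = g v * (g' v * (f' v * f v))" by (simp add: mat_alg D)
    moreover have "f' v * f v * (g v * g' v) = f' v * (f v * (g v * g' v))" by (simp add: mat_alg D)
    ultimately show ?thesis
      using mult_reduce[OF f'(3)[OF v], of "f v"] mult_reduce[OF f(4)[OF v], of "g' v"] f(3)[OF v] f'(4)[OF v] D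
      by (simp add: mat_alg)
  qed
  then show ?thesis unfolding rep_iso_iff
    by (intro bexI[OF _ hom_comp_in[OF assms(1-3) f(1) f'(1)]] bexI[OF _ hom_comp_in[OF assms(3,2,1) f'(2) f(2)]]) blast
qed

lemma iso_class_eq_iff:
  assumes "is_rep n M" "is_rep n N"
  shows "iso_class n M = iso_class n N \<longleftrightarrow> rep_iso n M N"
proof
  assume "iso_class n M = iso_class n N"
  moreover have "N \<in> iso_class n N" using assms rep_iso_refl by (auto simp: iso_class_def)
  ultimately show "rep_iso n M N" by (auto simp: iso_class_def)
next
  assume "rep_iso n M N"
  then show "iso_class n M = iso_class n N"
    using assms rep_iso_trans rep_iso_sym unfolding iso_class_def by blast
qed

lemma retract_dim_zero:
  assumes "retract n M N" "v \<in> {1..n}" "rdim N v = 0"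
  shows "rdim M v = 0"
proof -
  obtain f g where f: "f \<in> rep_hom n M N" "g \<in> rep_hom n N M" "g v * f v = 1\<^sub>m (rdim M v)"
    using assms(1,2) unfolding retract_def by blast
  have C: "f v \<in> carrier_mat 0 (rdim M v)" "g v \<in> carrier_mat (rdim M v) 0"
    using rep_hom_carrier[OF f(1), of v] rep_hom_carrier[OF f(2), of v] assms(2,3) by auto
  show ?thesis
  proof (rule ccontr)
    assume n: "rdim M v \<noteq> 0"
    have "(g v * f v) $$ (0, 0) = 0" using C n by (simp add: scalar_prod_def)
    then show False using f(3) n by simp
  qed
qed

text \<open>Supports suffice: vanishing of the space at a vertex passes to retracts, and a nonempty
  interval is determined by its elements.\<close>

lemma interval_iso_imp_eq:
  assumes "rep_iso n (interval_rep (i, j) :: 'k::field rep) (interval_rep (k, l))" "i < j" "j \<le> n" "k < l" "l \<le> n"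
  shows "(i, j) = (k, l)"
proof -
  have "i < v \<and> v \<le> j \<longleftrightarrow> k < v \<and> v \<le> l" if "v \<in> {1..n}" for v
    using retract_dim_zero[OF rep_iso_retract(1)[OF assms(1)] that] retract_dim_zero[OF rep_iso_retract(2)[OF assms(1)] that]
    by (cases "i < v \<and> v \<le> j"; cases "k < v \<and> v \<le> l") (auto simp: interval_rep_simps)
  from this[of "Suc i"] this[of j] this[of "Suc k"] this[of l] show ?thesis using assms by auto
qed

lemma iso_class_interval_inj:
  assumes "iso_class n (interval_rep (i, j) :: 'k::field rep) = iso_class n (interval_rep (k, l))"
    "i < j" "j \<le> n" "k < l" "l \<le> n"
  shows "(i, j) = (k, l)"
  using assms interval_iso_imp_eq iso_class_eq_iff[OF is_rep_interval is_rep_interval] by blast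

lemma direct_sum_Cons_simps:
  "rdim (direct_sum (V # Vs)) v = rdim V v + rdim (direct_sum Vs) v"
  "arrow (direct_sum (V # Vs)) v = four_block_mat (arrow V v) (0\<^sub>m (dim_row (arrow V v)) (dim_col (arrow (direct_sum Vs) v)))
     (0\<^sub>m (dim_row (arrow (direct_sum Vs) v)) (dim_col (arrow V v))) (arrow (direct_sum Vs) v)"
  by (auto simp: direct_sum_def Let_def)

lemma is_rep_direct_sum: "(\<And>V. V \<in> set Vs \<Longrightarrow> is_rep n V) \<Longrightarrow> is_rep n (direct_sum Vs)"
proof (induction Vs)
  case Nil
  then show ?case by (auto simp: is_rep_def direct_sum_def)
next
  case (Cons V Vs)
  then have "is_rep n V" "is_rep n (direct_sum Vs)" by auto
  then show ?case using four_block_carrier_mat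
    by (auto simp: is_rep_def direct_sum_Cons_simps)
qed

lemma direct_sum_biproduct:
  fixes V :: "'k::field rep"
  assumes V: "is_rep n V" and U: "is_rep n (direct_sum Vs)"
  obtains i1 i2 p1 p2 where
    "i1 \<in> rep_hom n V (direct_sum (V # Vs))" "i2 \<in> rep_hom n (direct_sum Vs) (direct_sum (V # Vs))"
    "p1 \<in> rep_hom n (direct_sum (V # Vs)) V" "p2 \<in> rep_hom n (direct_sum (V # Vs)) (direct_sum Vs)"
    "\<And>v. p1 v * i1 v = 1\<^sub>m (rdim V v)" "\<And>v. p2 v * i2 v = 1\<^sub>m (rdim (direct_sum Vs) v)"
    "\<And>v. p1 v * i2 v = 0\<^sub>m (rdim V v) (rdim (direct_sum Vs) v)" "\<And>v. p2 v * i1 v = 0\<^sub>m (rdim (direct_sum Vs) v) (rdim V v)"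
    "\<And>v. i1 v * p1 v + i2 v * p2 v = 1\<^sub>m (rdim (direct_sum (V # Vs)) v)"
proof -
  let ?U = "direct_sum Vs" and ?S = "direct_sum (V # Vs)"
  define i1 where "i1 v = (inj1 (rdim V v) (rdim ?U v) :: 'k mat)" for v
  define i2 where "i2 v = (inj2 (rdim V v) (rdim ?U v) :: 'k mat)" for v
  define p1 where "p1 v = (prj1 (rdim V v) (rdim ?U v) :: 'k mat)" for v
  define p2 where "p2 v = (prj2 (rdim V v) (rdim ?U v) :: 'k mat)" for v
  note defs = i1_def i2_def p1_def p2_def
  have dims [simp]: "dim_row (i1 v) = rdim V v + rdim ?U v" "dim_col (i1 v) = rdim V v"
    "dim_row (i2 v) = rdim V v + rdim ?U v" "dim_col (i2 v) = rdim ?U v"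
    "dim_col (p1 v) = rdim V v + rdim ?U v" "dim_row (p1 v) = rdim V v"
    "dim_col (p2 v) = rdim V v + rdim ?U v" "dim_row (p2 v) = rdim ?U v" for v
    by (simp_all add: defs)
  have pi: "p1 v * i1 v = 1\<^sub>m (rdim V v)" "p2 v * i2 v = 1\<^sub>m (rdim ?U v)" "p1 v * i2 v = 0\<^sub>m (rdim V v) (rdim ?U v)"
    "p2 v * i1 v = 0\<^sub>m (rdim ?U v) (rdim V v)" "i1 v * p1 v + i2 v * p2 v = 1\<^sub>m (rdim ?S v)" for v
    by (simp_all add: defs prj_inj direct_sum_Cons_simps)
  have pi': "dim_row X = rdim V v \<Longrightarrow> p1 v * (i1 v * X) = X" "dim_row X = rdim ?U v \<Longrightarrow> p2 v * (i2 v * X) = X"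
    "dim_row X = rdim ?U v \<Longrightarrow> p1 v * (i2 v * X) = 0\<^sub>m (rdim V v) (dim_col X)"
    "dim_row X = rdim V v \<Longrightarrow> p2 v * (i1 v * X) = 0\<^sub>m (rdim ?U v) (dim_col X)" for v X
    by (simp_all add: mult_reduce[OF pi(1)] mult_reduce[OF pi(2)] mult_reduce[OF pi(3)] mult_reduce[OF pi(4)] mat_alg)
  have dS: "rdim ?S v = rdim V v + rdim ?U v" for v by (simp add: direct_sum_Cons_simps)
  have aD: "dim_row (arrow V v) = rdim V (Suc v)" "dim_col (arrow V v) = rdim V v"
    "dim_row (arrow ?U v) = rdim ?U (Suc v)" "dim_col (arrow ?U v) = rdim ?U v" if "1 \<le> v" "v < n" for v
    using arrow_carrier[OF V that] arrow_carrier[OF U that] by auto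
  have aS: "arrow ?S v = i1 (Suc v) * arrow V v * p1 v + i2 (Suc v) * arrow ?U v * p2 v" if v: "1 \<le> v" "v < n" for v
    unfolding direct_sum_Cons_simps aD[OF v] defs
    by (rule four_block_inj_prj[OF arrow_carrier[OF V v] arrow_carrier[OF U v]])
  show thesis
  proof (rule that[of i1 i2 p1 p2])
    show "i1 \<in> rep_hom n V ?S"
      by (rule rep_homI; (rule carrier_matI)?) (use aD in \<open>simp_all add: dS aS mat_alg pi pi'\<close>)
    show "i2 \<in> rep_hom n ?U ?S"
      by (rule rep_homI; (rule carrier_matI)?) (use aD in \<open>simp_all add: dS aS mat_alg pi pi'\<close>)
    show "p1 \<in> rep_hom n ?S V"
      by (rule rep_homI; (rule carrier_matI)?) (use aD in \<open>simp_all add: dS aS mat_alg pi pi'\<close>)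
    show "p2 \<in> rep_hom n ?S ?U"
      by (rule rep_homI; (rule carrier_matI)?) (use aD in \<open>simp_all add: dS aS mat_alg pi pi'\<close>)
  qed (rule pi)+
qed

text \<open>One direction is \<open>retract_orth\<close>; for the other, homomorphisms and cocycles
  into the sum are treated by components.\<close>

lemma orth_direct_sum_Cons:
  fixes V :: "'k::field rep"
  assumes W: "is_rep n W" and V: "is_rep n V" and U: "is_rep n (direct_sum Vs)" and S: "is_rep n (direct_sum (V # Vs))"
  shows "orth n W (direct_sum (V # Vs)) \<longleftrightarrow> orth n W V \<and> orth n W (direct_sum Vs)"
proof -
  let ?U = "direct_sum Vs" and ?S = "direct_sum (V # Vs)"
  obtain i1 i2 p1 p2 where h: "i1 \<in> rep_hom n V ?S" "i2 \<in> rep_hom n ?U ?S" "p1 \<in> rep_hom n ?S V" "p2 \<in> rep_hom n ?S ?U"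
    and pi: "\<And>v. p1 v * i1 v = 1\<^sub>m (rdim V v)" "\<And>v. p2 v * i2 v = 1\<^sub>m (rdim ?U v)"
      "\<And>v. i1 v * p1 v + i2 v * p2 v = 1\<^sub>m (rdim ?S v)"
    using direct_sum_biproduct[OF V U] by metis
  have "retract n V ?S" "retract n ?U ?S"
    unfolding retract_def using h pi by blast+
  then have 1: "orth n W ?S \<Longrightarrow> orth n W V \<and> orth n W ?U"
    using retract_orth[OF W S V] retract_orth[OF W S U] by blast
  have "orth n W ?S" if o': "orth n W V" "orth n W ?U"
  proof -
    have hv: "hom_vanishes n W V" "hom_vanishes n W ?U" and es: "ext_splits n W V" "ext_splits n W ?U"
      using o' ext_vanishes_iff[OF W V] ext_vanishes_iff[OF W U] by (auto simp: orth_def)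
    have C: "i1 v \<in> carrier_mat (rdim ?S v) (rdim V v)" "i2 v \<in> carrier_mat (rdim ?S v) (rdim ?U v)"
       "p1 v \<in> carrier_mat (rdim V v) (rdim ?S v)" "p2 v \<in> carrier_mat (rdim ?U v) (rdim ?S v)" if "v \<in> {1..n}" for v
      using h[THEN rep_hom_carrier] that by auto
    note CD = C[THEN carrier_matD(1)] C[THEN carrier_matD(2)]
    have "hom_vanishes n W ?S"
    proof (rule hom_vanishesI)
      fix f v assume f: "f \<in> rep_hom n W ?S" and v: "v \<in> {1..n}"
      have cf: "f v \<in> carrier_mat (rdim ?S v) (rdim W v)" using rep_hom_carrier[OF f] v by auto
      note D = CD[OF v] carrier_matD[OF cf]
      have z: "p1 v * f v = 0\<^sub>m (rdim V v) (rdim W v)" "p2 v * f v = 0\<^sub>m (rdim ?U v) (rdim W v)"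
        using hom_vanishesD[OF hv(1) hom_comp_in[OF W S V f h(3)] v] hom_vanishesD[OF hv(2) hom_comp_in[OF W S U f h(4)] v] .
      have "f v = (i1 v * p1 v + i2 v * p2 v) * f v" unfolding pi(3) by (simp add: mat_alg D)
      also have "\<dots> = i1 v * (p1 v * f v) + i2 v * (p2 v * f v)" by (simp add: mat_alg D)
      finally show "f v = 0\<^sub>m (rdim ?S v) (rdim W v)" unfolding z by (simp add: mat_alg D)
    qed
    moreover have "ext_splits n W ?S"
      unfolding ext_splits_def
    proof (intro allI impI)
      fix c :: "nat \<Rightarrow> 'k mat" assume c: "\<forall>v\<in>{1..<n}. c v \<in> carrier_mat (rdim ?S (Suc v)) (rdim W v)"
      have "p1 (Suc v) * c v \<in> carrier_mat (rdim V (Suc v)) (rdim W v)" if "v \<in> {1..<n}" for v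
        by (rule mult_carrier_mat[OF C(3) c[rule_format]]) (use that in auto)
      from ext_splitsD[OF es(1), of "\<lambda>v. p1 (Suc v) * c v", OF this] obtain f where
        f: "\<And>v. v \<in> {1..n} \<Longrightarrow> f v \<in> carrier_mat (rdim V v) (rdim W v)"
        "\<And>v. v \<in> {1..<n} \<Longrightarrow> p1 (Suc v) * c v = f (Suc v) * arrow W v - arrow V v * f v" by blast
      have "p2 (Suc v) * c v \<in> carrier_mat (rdim ?U (Suc v)) (rdim W v)" if "v \<in> {1..<n}" for v
        by (rule mult_carrier_mat[OF C(4) c[rule_format]]) (use that in auto)
      from ext_splitsD[OF es(2), of "\<lambda>v. p2 (Suc v) * c v", OF this] obtain g where
        g: "\<And>v. v \<in> {1..n} \<Longrightarrow> g v \<in> carrier_mat (rdim ?U v) (rdim W v)"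
        "\<And>v. v \<in> {1..<n} \<Longrightarrow> p2 (Suc v) * c v = g (Suc v) * arrow W v - arrow ?U v * g v" by blast
      show "\<exists>f. (\<forall>v\<in>{1..n}. f v \<in> carrier_mat (rdim ?S v) (rdim W v)) \<and>
         (\<forall>v\<in>{1..<n}. c v = f (Suc v) * arrow W v - arrow ?S v * f v)"
      proof (intro exI[of _ "\<lambda>v. i1 v * f v + i2 v * g v"] conjI ballI)
        show "i1 v * f v + i2 v * g v \<in> carrier_mat (rdim ?S v) (rdim W v)" if "v \<in> {1..n}" for v
          by (rule add_carrier_mat[OF mult_carrier_mat[OF C(2)[OF that] g(1)[OF that]]])
        fix v assume v: "v \<in> {1..<n}"
        then have v': "1 \<le> v" "v < n" "v \<in> {1..n}" "Suc v \<in> {1..n}" by auto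
        note A = arrow_carrier[OF W v'(1,2)] arrow_carrier[OF V v'(1,2)] arrow_carrier[OF U v'(1,2)] arrow_carrier[OF S v'(1,2)]
          f(1)[OF v'(3)] f(1)[OF v'(4)] g(1)[OF v'(3)] g(1)[OF v'(4)] c[rule_format, OF v]
        note D = CD[OF v'(3)] CD[OF v'(4)] A[THEN carrier_matD(1)] A[THEN carrier_matD(2)]
        have "c v = (i1 (Suc v) * p1 (Suc v) + i2 (Suc v) * p2 (Suc v)) * c v"
          unfolding pi(3) by (simp add: mat_alg D)
        also have "\<dots> = i1 (Suc v) * (p1 (Suc v) * c v) + i2 (Suc v) * (p2 (Suc v) * c v)"
          by (simp add: mat_alg D)
        also have "i1 (Suc v) * (p1 (Suc v) * c v) = i1 (Suc v) * f (Suc v) * arrow W v - (i1 (Suc v) * arrow V v) * f v"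
          unfolding f(2)[OF v] by (simp add: mat_alg D)
        also have "(i1 (Suc v) * arrow V v) * f v = arrow ?S v * (i1 v * f v)"
          unfolding rep_hom_comm[OF h(1) v'(1,2)] by (simp add: mat_alg D)
        also have "i2 (Suc v) * (p2 (Suc v) * c v) = i2 (Suc v) * g (Suc v) * arrow W v - (i2 (Suc v) * arrow ?U v) * g v"
          unfolding g(2)[OF v] by (simp add: mat_alg D)
        also have "(i2 (Suc v) * arrow ?U v) * g v = arrow ?S v * (i2 v * g v)"
          unfolding rep_hom_comm[OF h(2) v'(1,2)] by (simp add: mat_alg D)
        finally have e: "c v = (i1 (Suc v) * f (Suc v) * arrow W v - arrow ?S v * (i1 v * f v)) +
            (i2 (Suc v) * g (Suc v) * arrow W v - arrow ?S v * (i2 v * g v))" (is "_ = (?P - ?Q) + (?R - ?T)") .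
        have "?P - ?Q + (?R - ?T) = (?P + ?R) - (?Q + ?T)" using D by (intro eq_matI) auto
        also have "\<dots> = (i1 (Suc v) * f (Suc v) + i2 (Suc v) * g (Suc v)) * arrow W v - arrow ?S v * (i1 v * f v + i2 v * g v)"
          by (simp add: mat_alg D)
        finally show "c v = (i1 (Suc v) * f (Suc v) + i2 (Suc v) * g (Suc v)) * arrow W v - arrow ?S v * (i1 v * f v + i2 v * g v)"
          using e by simp
      qed
    qed
    ultimately show ?thesis using ext_vanishes_iff[OF W S] by (simp add: orth_def)
  qed
  then show ?thesis using 1 by blast
qed

lemma orth_direct_sum:
  assumes W: "is_rep n W" and "\<And>V. V \<in> set Vs \<Longrightarrow> is_rep n V"
  shows "orth n W (direct_sum Vs) \<longleftrightarrow> (\<forall>V\<in>set Vs. orth n W V)"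
  using assms(2)
proof (induction Vs)
  case Nil
  have d: "rdim (direct_sum [] :: 'a rep) v = 0" for v by (simp add: direct_sum_def)
  have r: "is_rep n (direct_sum [] :: 'a rep)" by (rule is_rep_direct_sum) simp
  have "hom_vanishes n W (direct_sum [])"
  proof (rule hom_vanishesI)
    fix f v assume "f \<in> rep_hom n W (direct_sum [])" "v \<in> {1..n}"
    then show "f v = 0\<^sub>m (rdim (direct_sum [] :: 'a rep) v) (rdim W v)"
      using rep_hom_carrier[of f n W "direct_sum []" v] by (intro eq_mat_empty) (auto simp: d)
  qed
  moreover have "ext_splits n W (direct_sum [])"
    unfolding ext_splits_def
  proof (intro allI impI exI[of _ "\<lambda>v. 0\<^sub>m 0 (rdim W v)"] conjI ballI)
    fix c :: "nat \<Rightarrow> 'a mat" and v assume c: "\<forall>v\<in>{1..<n}. c v \<in> carrier_mat (rdim (direct_sum [] :: 'a rep) (Suc v)) (rdim W v)"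
      and v: "v \<in> {1..<n}"
    show "c v = 0\<^sub>m 0 (rdim W (Suc v)) * arrow W v - arrow (direct_sum []) v * 0\<^sub>m 0 (rdim W v)"
      using c[rule_format, OF v] arrow_carrier[OF r, of v] v by (intro eq_mat_empty) (auto simp: d)
  qed (simp add: d)
  ultimately show ?case using ext_vanishes_iff[OF W r] by (simp add: orth_def)
next
  case (Cons V Vs)
  then show ?case
    using orth_direct_sum_Cons[OF W, of V Vs] is_rep_direct_sum[of Vs n] is_rep_direct_sum[of "V # Vs" n] by auto
qed

section \<open>Indecomposable representations\<close>

lemma direct_sum_single [simp]: "direct_sum [K] = K"
  by (cases K) (simp add: direct_sum_def fun_eq_iff four_block_empty[OF carrier_matI[OF refl refl]])

lemma one_mat_eq_zero_iff: "(1\<^sub>m d :: 'k::field mat) = 0\<^sub>m d d \<longleftrightarrow> d = 0"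
proof
  assume e: "(1\<^sub>m d :: 'k mat) = 0\<^sub>m d d"
  show "d = 0"
  proof (rule ccontr)
    assume "d \<noteq> 0"
    then have "(1\<^sub>m d :: 'k mat) $$ (0, 0) = 1" "(0\<^sub>m d d :: 'k mat) $$ (0, 0) = 0" by auto
    then show False using e by simp
  qed
qed (auto intro: eq_mat_empty)

lemma mult_inner_zero:
  fixes A :: "'k::field mat"
  assumes "A \<in> carrier_mat r 0" "B \<in> carrier_mat 0 c"
  shows "A * B = 0\<^sub>m r c"
  using assms by (intro eq_matI) (auto simp: scalar_prod_def)

lemma hom_add_in:
  fixes f g :: "nat \<Rightarrow> 'k::field mat"
  assumes M: "is_rep n M" and N: "is_rep n N" and f: "f \<in> rep_hom n M N" and g: "g \<in> rep_hom n M N"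
  shows "(\<lambda>v. f v + g v) \<in> rep_hom n M N"
proof (rule rep_homI)
  show "f v + g v \<in> carrier_mat (rdim N v) (rdim M v)" if "1 \<le> v" "v \<le> n" for v
    using rep_hom_carrier[OF f that] rep_hom_carrier[OF g that] by auto
  fix v assume v: "1 \<le> v" "v < n"
  note D = carrier_matD[OF rep_hom_carrier[OF f, of v]] carrier_matD[OF rep_hom_carrier[OF g, of v]]
    carrier_matD[OF rep_hom_carrier[OF f, of "Suc v"]] carrier_matD[OF rep_hom_carrier[OF g, of "Suc v"]]
    carrier_matD[OF arrow_carrier[OF M v]] carrier_matD[OF arrow_carrier[OF N v]]
  show "(f (Suc v) + g (Suc v)) * arrow M v = arrow N v * (f v + g v)"
    using rep_hom_comm[OF f v] rep_hom_comm[OF g v] v D by (simp add: mat_alg)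
qed

text \<open>The complement is the image of the idempotent E = 1 - iota pi, split at each vertex as B
  L; since E commutes with the arrows, B and L are homomorphisms. If the complement is zero then E =
  0, so iota and pi are mutually inverse.\<close>

lemma split_off:
  fixes M A :: "'k::field rep"
  assumes M: "is_rep n M" and A: "is_rep n A" and i: "\<iota> \<in> rep_hom n A M" and p: "\<pi> \<in> rep_hom n M A"
    and pi: "\<And>v. v \<in> {1..n} \<Longrightarrow> \<pi> v * \<iota> v = 1\<^sub>m (rdim A v)"
  shows "\<exists>K. is_rep n K \<and> rep_iso n M (direct_sum [A, K]) \<and>
    (is_zero_rep n K \<longrightarrow> (\<forall>v\<in>{1..n}. \<iota> v * \<pi> v = 1\<^sub>m (rdim M v)))"
proof -
  define E where "E v = 1\<^sub>m (rdim M v) - \<iota> v * \<pi> v" for v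
  have ci: "\<iota> v \<in> carrier_mat (rdim M v) (rdim A v)" "\<pi> v \<in> carrier_mat (rdim A v) (rdim M v)" if "v \<in> {1..n}" for v
    using rep_hom_carrier[OF i, of v] rep_hom_carrier[OF p, of v] that by auto
  note ciD = ci(1)[THEN carrier_matD(1)] ci(1)[THEN carrier_matD(2)] ci(2)[THEN carrier_matD(1)] ci(2)[THEN carrier_matD(2)]
  have cE: "E v \<in> carrier_mat (rdim M v) (rdim M v)" if "v \<in> {1..n}" for v
    unfolding E_def by (rule minus_carrier_mat[OF mult_carrier_mat[OF ci[OF that]]])
  have piE: "\<pi> v * E v = 0\<^sub>m (rdim A v) (rdim M v)" if v: "v \<in> {1..n}" for v
    unfolding E_def using ciD[OF v] mult_reduce[OF pi[OF v], of "\<pi> v"] by (simp add: mat_alg)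
  have Ei: "E v * \<iota> v = 0\<^sub>m (rdim M v) (rdim A v)" if v: "v \<in> {1..n}" for v
    unfolding E_def using ciD[OF v] pi[OF v] by (simp add: mat_alg)
  have EE: "E v * E v = E v" if v: "v \<in> {1..n}" for v
  proof -
    have "E v * E v = E v - \<iota> v * (\<pi> v * E v)"
      unfolding E_def using ciD[OF v] by (simp add: mat_alg)
    then show ?thesis unfolding piE[OF v] using ciD[OF v] carrier_matD[OF cE[OF v]] by (simp add: mat_alg)
  qed
  have "\<forall>v\<in>{1..n}. \<exists>T. snd T \<in> carrier_mat (rdim M v) (dim_row (fst T)) \<and> fst T \<in> carrier_mat (dim_row (fst T)) (rdim M v) \<and>
      fst T * snd T = 1\<^sub>m (dim_row (fst T)) \<and> snd T * fst T = E v"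
  proof
    fix v assume v: "v \<in> {1..n}"
    from idempotent_split[OF cE[OF v] EE[OF v]] obtain d B L where
      b: "B \<in> carrier_mat (rdim M v) d" "L \<in> carrier_mat d (rdim M v)" "L * B = 1\<^sub>m d" "B * L = E v" by blast
    have "dim_row L = d" using b(2) by simp
    with b show "\<exists>T. snd T \<in> carrier_mat (rdim M v) (dim_row (fst T)) \<and> fst T \<in> carrier_mat (dim_row (fst T)) (rdim M v) \<and>
      fst T * snd T = 1\<^sub>m (dim_row (fst T)) \<and> snd T * fst T = E v"
      by (intro exI[of _ "(L, B)"]) (simp only: fst_conv snd_conv simp_thms)
  qed
  from bchoice[OF this] obtain T where T: "\<And>v. v \<in> {1..n} \<Longrightarrow> snd (T v) \<in> carrier_mat (rdim M v) (dim_row (fst (T v)))"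
    "\<And>v. v \<in> {1..n} \<Longrightarrow> fst (T v) \<in> carrier_mat (dim_row (fst (T v))) (rdim M v)"
    "\<And>v. v \<in> {1..n} \<Longrightarrow> fst (T v) * snd (T v) = 1\<^sub>m (dim_row (fst (T v)))"
    "\<And>v. v \<in> {1..n} \<Longrightarrow> snd (T v) * fst (T v) = E v" by blast
  define B L d where "B v = snd (T v)" and "L v = fst (T v)" and "d v = dim_row (fst (T v))" for v
  have BL: "B v \<in> carrier_mat (rdim M v) (d v)" "L v \<in> carrier_mat (d v) (rdim M v)" "L v * B v = 1\<^sub>m (d v)" "B v * L v = E v"
    if "v \<in> {1..n}" for v
    unfolding B_def L_def d_def by (rule T[OF that])+
  note BLD = BL(1)[THEN carrier_matD(1)] BL(1)[THEN carrier_matD(2)] BL(2)[THEN carrier_matD(1)] BL(2)[THEN carrier_matD(2)]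
  define K where "K = Rep d (\<lambda>v. L (Suc v) * arrow M v * B v)"
  have dK: "rdim K v = d v" and aK: "arrow K v = L (Suc v) * arrow M v * B v" for v by (simp_all add: K_def)
  have K: "is_rep n K"
    unfolding is_rep_def
  proof
    fix v assume "v \<in> {1..<n}"
    then have v: "1 \<le> v" "v < n" "v \<in> {1..n}" "Suc v \<in> {1..n}" by auto
    show "arrow K v \<in> carrier_mat (rdim K (v + 1)) (rdim K v)"
      using BL(1)[OF v(3)] BL(2)[OF v(4)] arrow_carrier[OF M v(1,2)] by (auto simp: aK dK)
  qed
  have LE: "L v * E v = L v" "E v * B v = B v" if v: "v \<in> {1..n}" for v
    unfolding BL(4)[OF v, symmetric] using mult_reduce[OF BL(3)[OF v], of "L v"] BL(3)[OF v] BLD[OF v] by (simp_all add: mat_alg)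
  have EM: "E (Suc v) * arrow M v = arrow M v * E v" if v: "1 \<le> v" "v < n" for v
  proof -
    have v': "v \<in> {1..n}" "Suc v \<in> {1..n}" using v by auto
    note D = ciD[OF v'(1)] ciD[OF v'(2)] carrier_matD[OF arrow_carrier[OF M v]] carrier_matD[OF arrow_carrier[OF A v]]
    have "\<iota> (Suc v) * (\<pi> (Suc v) * arrow M v) = \<iota> (Suc v) * arrow A v * \<pi> v"
      unfolding rep_hom_comm[OF p v] by (simp add: mat_alg D)
    also have "\<dots> = arrow M v * (\<iota> v * \<pi> v)" unfolding rep_hom_comm[OF i v] by (simp add: mat_alg D)
    finally show ?thesis unfolding E_def by (simp add: mat_alg D)
  qed
  have Lh: "L \<in> rep_hom n M K"
  proof (rule rep_homI)
    fix v assume v: "1 \<le> v" "v < n"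
    then have v': "v \<in> {1..n}" "Suc v \<in> {1..n}" by auto
    note D = BLD[OF v'(1)] BLD[OF v'(2)] carrier_matD[OF arrow_carrier[OF M v]] carrier_matD[OF cE[OF v'(1)]] carrier_matD[OF cE[OF v'(2)]]
    have "arrow K v * L v = L (Suc v) * (arrow M v * E v)"
      unfolding aK BL(4)[OF v'(1), symmetric] by (simp add: mat_alg D)
    also have "\<dots> = L (Suc v) * E (Suc v) * arrow M v" unfolding EM[OF v, symmetric] by (simp add: mat_alg D)
    finally show "L (Suc v) * arrow M v = arrow K v * L v" unfolding LE(1)[OF v'(2)] by simp
  qed (use BL in \<open>auto simp: dK\<close>)
  have Bh: "B \<in> rep_hom n K M"
  proof (rule rep_homI)
    fix v assume v: "1 \<le> v" "v < n"
    then have v': "v \<in> {1..n}" "Suc v \<in> {1..n}" by auto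
    note D = BLD[OF v'(1)] BLD[OF v'(2)] carrier_matD[OF arrow_carrier[OF M v]] carrier_matD[OF cE[OF v'(1)]] carrier_matD[OF cE[OF v'(2)]]
    have "B (Suc v) * arrow K v = B (Suc v) * L (Suc v) * arrow M v * B v"
      unfolding aK by (simp add: mat_alg D)
    also have "\<dots> = arrow M v * (E v * B v)" unfolding BL(4)[OF v'(2)] EM[OF v] by (simp add: mat_alg D)
    finally show "B (Suc v) * arrow K v = arrow M v * B v" unfolding LE(2)[OF v'(1)] .
  qed (use BL in \<open>auto simp: dK\<close>)
  let ?S = "direct_sum (A # [K])"
  have S: "is_rep n ?S" by (rule is_rep_direct_sum) (use A K in auto)
  obtain i1 i2 p1 p2 where h: "i1 \<in> rep_hom n A ?S" "i2 \<in> rep_hom n K ?S" "p1 \<in> rep_hom n ?S A" "p2 \<in> rep_hom n ?S K"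
    and q: "\<And>v. p1 v * i1 v = 1\<^sub>m (rdim A v)" "\<And>v. p2 v * i2 v = 1\<^sub>m (rdim K v)"
      "\<And>v. p1 v * i2 v = 0\<^sub>m (rdim A v) (rdim K v)" "\<And>v. p2 v * i1 v = 0\<^sub>m (rdim K v) (rdim A v)"
      "\<And>v. i1 v * p1 v + i2 v * p2 v = 1\<^sub>m (rdim ?S v)"
    using direct_sum_biproduct[OF A, of "[K]"] K unfolding direct_sum_single by metis
  let ?F = "\<lambda>v. i1 v * \<pi> v + i2 v * L v" and ?G = "\<lambda>v. \<iota> v * p1 v + B v * p2 v"
  have F: "?F \<in> rep_hom n M ?S"
    by (rule hom_add_in[OF M S hom_comp_in[OF M A S p h(1)] hom_comp_in[OF M K S Lh h(2)]])
  have G: "?G \<in> rep_hom n ?S M"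
    by (rule hom_add_in[OF S M hom_comp_in[OF S A M h(3) i] hom_comp_in[OF S K M h(4) Bh]])
  have FG: "?G v * ?F v = 1\<^sub>m (rdim M v) \<and> ?F v * ?G v = 1\<^sub>m (rdim ?S v)" if v: "v \<in> {1..n}" for v
  proof
    have v1: "1 \<le> v" "v \<le> n" using v by auto
    note C = h(1)[THEN rep_hom_carrier, OF v1] h(2)[THEN rep_hom_carrier, OF v1] h(3)[THEN rep_hom_carrier, OF v1] h(4)[THEN rep_hom_carrier, OF v1]
    note D = ciD[OF v] BLD[OF v] C[THEN carrier_matD(1)] C[THEN carrier_matD(2)] dK
    have pB: "\<pi> v * B v = 0\<^sub>m (rdim A v) (d v)"
      using mult_reduce[OF piE[OF v], of "B v"] LE(2)[OF v] D carrier_matD[OF cE[OF v]] by (simp add: mat_alg)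
    have Li: "L v * \<iota> v = 0\<^sub>m (d v) (rdim A v)"
    proof -
      have "L v * \<iota> v = L v * (E v * \<iota> v)" using mult_reduce[OF LE(1)[OF v], of "\<iota> v"] D carrier_matD[OF cE[OF v]] by simp
      then show ?thesis unfolding Ei[OF v] by (simp add: mat_alg D)
    qed
    have q': "dim_row X = rdim A v \<Longrightarrow> p1 v * (i1 v * X) = X" "dim_row X = d v \<Longrightarrow> p2 v * (i2 v * X) = X"
      "dim_row X = d v \<Longrightarrow> p1 v * (i2 v * X) = 0\<^sub>m (rdim A v) (dim_col X)"
      "dim_row X = rdim A v \<Longrightarrow> p2 v * (i1 v * X) = 0\<^sub>m (d v) (dim_col X)" for X
      using mult_reduce[OF q(1)[of v], of X] mult_reduce[OF q(2)[of v], of X] mult_reduce[OF q(3)[of v], of X]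
        mult_reduce[OF q(4)[of v], of X] D by (simp_all add: mat_alg)
    have "?G v * ?F v = \<iota> v * \<pi> v + B v * L v" using D q' by (simp add: mat_alg)
    also have "\<dots> = 1\<^sub>m (rdim M v)" unfolding BL(4)[OF v] E_def using D by (intro eq_matI) auto
    finally show "?G v * ?F v = 1\<^sub>m (rdim M v)" .
    have "?F v * ?G v = i1 v * ((\<pi> v * \<iota> v) * p1 v) + i2 v * ((L v * \<iota> v) * p1 v) + (i1 v * ((\<pi> v * B v) * p2 v) + i2 v * ((L v * B v) * p2 v))"
      by (simp add: mat_alg D)
    also have "\<dots> = i1 v * p1 v + i2 v * p2 v"
      unfolding pi[OF v] pB Li BL(3)[OF v] by (simp add: mat_alg D)
    finally show "?F v * ?G v = 1\<^sub>m (rdim ?S v)" unfolding q(5) .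
  qed
  have iso: "rep_iso n M ?S" unfolding rep_iso_iff
    by (intro bexI[OF _ F] bexI[OF _ G]) (use FG in blast)
  moreover have "\<iota> v * \<pi> v = 1\<^sub>m (rdim M v)" if z: "is_zero_rep n K" and v: "v \<in> {1..n}" for v
  proof -
    have "d v = 0" using z v by (simp add: is_zero_rep_def dK)
    then have "E v = 0\<^sub>m (rdim M v) (rdim M v)"
      unfolding BL(4)[OF v, symmetric] using BL(1,2)[OF v] by (intro mult_inner_zero) auto
    then have e: "(1\<^sub>m (rdim M v) - \<iota> v * \<pi> v) $$ (a, b) = 0" if "a < rdim M v" "b < rdim M v" for a b
      unfolding E_def using that by simp
    show ?thesis
    proof (rule eq_matI)
      fix a b assume "a < dim_row (1\<^sub>m (rdim M v) :: 'k mat)" "b < dim_col (1\<^sub>m (rdim M v) :: 'k mat)"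
      then show "(\<iota> v * \<pi> v) $$ (a, b) = 1\<^sub>m (rdim M v) $$ (a, b)" using e[of a b] ciD[OF v] by simp
    qed (use ciD[OF v] in auto)
  qed
  ultimately show ?thesis using K by blast
qed

text \<open>An interval summand is split off. Let s be the first vertex with a nonzero space and j
  the last one for which M_s -> M_j is injective. A vector x in M_s that dies right after j spans a
  copy of M_{s-1,j}, and a functional on M_j that is 1 on its image gives the projection.\<close>

lemma indecomposable_imp_interval:
  fixes M :: "'k::field rep"
  assumes "indecomposable n M"
  shows "\<exists>i j. i < j \<and> j \<le> n \<and> rep_iso n M (interval_rep (i, j))"
proof -
  have M: "is_rep n M" and nz: "\<not> is_zero_rep n M" using assms by (auto simp: indecomposable_def)
  define s where "s = (LEAST v. v \<in> {1..n} \<and> rdim M v \<noteq> 0)"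
  have "\<exists>v. v \<in> {1..n} \<and> rdim M v \<noteq> 0" using nz by (auto simp: is_zero_rep_def)
  then have s: "s \<in> {1..n}" "rdim M s \<noteq> 0" and smin: "\<And>v. v \<in> {1..n} \<Longrightarrow> v < s \<Longrightarrow> rdim M v = 0"
    unfolding s_def using LeastI_ex[of "\<lambda>v. v \<in> {1..n} \<and> rdim M v \<noteq> 0"] not_less_Least[of _ "\<lambda>v. v \<in> {1..n} \<and> rdim M v \<noteq> 0"]
    by blast+
  define i where "i = s - 1"
  have i: "s = Suc i" "i < n" using s by (auto simp: i_def)
  have di: "ext_dim M i = 0" using smin[of i] s i by (cases "i = 0") auto
  define J where "J = {t \<in> {s..n}. \<forall>x\<in>carrier_mat (rdim M s) 1. transport M s t * x = 0\<^sub>m (ext_dim M t) 1 \<longrightarrow> x = 0\<^sub>m (rdim M s) 1}"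
  have JD: "s \<le> t" "t \<le> n" "x \<in> carrier_mat (rdim M s) 1 \<Longrightarrow> transport M s t * x = 0\<^sub>m (ext_dim M t) 1 \<Longrightarrow> x = 0\<^sub>m (rdim M s) 1"
    if "t \<in> J" for t x
    using that by (auto simp: J_def)
  have "s \<in> J" using s by (auto simp: J_def)
  moreover have fJ: "finite J" by (auto simp: J_def)
  ultimately have jJ: "Max J \<in> J" and jmax: "\<And>t. t \<in> J \<Longrightarrow> t \<le> Max J" using Max_in by auto
  define j where "j = Max J"
  have j: "s \<le> j" "j \<le> n" "i < j" using JD(1,2)[OF jJ] i by (auto simp: j_def)
  \<comment> \<open>By maximality of j some nonzero vector dies at j + 1. For j = n there is no
    further vertex and any nonzero vector will do.\<close>
  have "\<exists>x\<in>carrier_mat (rdim M s) 1. x \<noteq> 0\<^sub>m (rdim M s) 1 \<and> (j < n \<longrightarrow> transport M s (Suc j) * x = 0\<^sub>m (ext_dim M (Suc j)) 1)"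
  proof (cases "j < n")
    case True
    then have "Suc j \<notin> J" using jmax[of "Suc j"] by (auto simp: j_def)
    then show ?thesis using True j unfolding J_def by auto
  next
    case False
    have "(mat (rdim M s) 1 (\<lambda>_. 1) :: 'k mat) $$ (0, 0) \<noteq> 0\<^sub>m (rdim M s) 1 $$ (0, 0)" using s(2) by simp
    then have "(mat (rdim M s) 1 (\<lambda>_. 1) :: 'k mat) \<noteq> 0\<^sub>m (rdim M s) 1" by metis
    then show ?thesis using False by (intro bexI[of _ "mat (rdim M s) 1 (\<lambda>_. 1)"]) auto
  qed
  then obtain x where x: "x \<in> carrier_mat (rdim M s) 1" "x \<noteq> 0\<^sub>m (rdim M s) 1"
    "j < n \<Longrightarrow> transport M s (Suc j) * x = 0\<^sub>m (ext_dim M (Suc j)) 1" by blast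
  have tc: "transport M v t \<in> carrier_mat (rdim M t) (rdim M v)" if "i < v" "v \<le> t" "t \<le> n" for v t
    using transport_carrier[OF M that(2,3)] that by simp
  define y where "y = transport M s j * x"
  have y: "y \<in> carrier_mat (rdim M j) 1" using tc[of s j] j i x(1) by (auto simp: y_def)
  have "y \<noteq> 0\<^sub>m (rdim M j) 1" using JD(3)[OF jJ x(1)] x(2) j(3) by (auto simp: y_def j_def[symmetric])
  then obtain p where p: "p < rdim M j" "y $$ (p, 0) \<noteq> 0"
    using y by (metis carrier_matD eq_matI index_zero_mat less_one)
  \<comment> \<open>A coordinate functional at a nonzero entry of y, normalised to 1 on y.\<close>
  define \<phi> where "\<phi> = mat 1 (rdim M j) (\<lambda>(_, c). if c = p then 1 / y $$ (p, 0) else 0)"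
  have \<phi>: "\<phi> \<in> carrier_mat 1 (ext_dim M j)" using j by (simp add: \<phi>_def)
  have \<phi>y: "\<phi> * y = 1\<^sub>m 1"
  proof (rule eq_matI)
    fix a b assume "a < dim_row (1\<^sub>m 1 :: 'k mat)" "b < dim_col (1\<^sub>m 1 :: 'k mat)"
    then have ab: "a = 0" "b = 0" by auto
    have "(\<phi> * y) $$ (0, 0) = (\<Sum>c = 0..<rdim M j. (if c = p then 1 / y $$ (p, 0) else 0) * y $$ (c, 0))"
      using y by (simp add: \<phi>_def scalar_prod_def)
    also have "\<dots> = (\<Sum>c = 0..<rdim M j. if c = p then 1 else 0)"
      by (rule sum.cong) (use p in auto)
    also have "\<dots> = 1" using p by simp
    finally show "(\<phi> * y) $$ (a, b) = 1\<^sub>m 1 $$ (a, b)" using ab by simp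
  qed (use y in \<open>auto simp: \<phi>_def\<close>)
  \<comment> \<open>Automatic, because M_i = 0 below the first nonzero vertex.\<close>
  have "\<phi> * transport M i j = 0\<^sub>m 1 (ext_dim M i)"
    using \<phi> transport_carrier[OF M, of i j] j i di by (intro eq_mat_empty) auto
  note \<pi> = hom_to_interval[OF M j(3,2) \<phi> this]
  define \<pi> where "\<pi> = (\<lambda>v. if i < v \<and> v \<le> j then \<phi> * transport M v j else 0\<^sub>m 0 (rdim M v))"
  define \<iota> where "\<iota> v = (if i < v \<and> v \<le> j then transport M s v * x else 0\<^sub>m (rdim M v) 0)" for v
  let ?I = "interval_rep (i, j) :: 'k rep"
  have ci: "\<iota> v \<in> carrier_mat (rdim M v) (rdim ?I v)" if "1 \<le> v" "v \<le> n" for v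
    using tc[of s v] x(1) i that by (auto simp: \<iota>_def interval_rep_simps)
  have ih: "\<iota> \<in> rep_hom n ?I M"
  proof (rule rep_homI[OF ci])
    fix v assume v: "1 \<le> v" "v < n"
    note aM = arrow_carrier[OF M v] and aI = arrow_carrier[OF is_rep_interval[of n i j] v]
    show "\<iota> (Suc v) * arrow ?I v = arrow M v * \<iota> v"
    proof (cases "i < v \<and> v \<le> j")
      case False
      then show ?thesis using aM aI ci[of v] ci[of "Suc v"] v by (intro eq_mat_empty) (auto simp: interval_rep_simps)
    next
      case True
      have t: "transport M s (Suc v) = arrow M v * transport M s v" using True i by simp
      have e: "arrow M v * \<iota> v = transport M s (Suc v) * x"
        unfolding t \<iota>_def using True aM tc[of s v] x(1) i v by simp
      show ?thesis
      proof (cases "v = j")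
        case True
        have "\<iota> (Suc v) * arrow ?I v = 0\<^sub>m (rdim M (Suc v)) 1"
          using True j by (simp add: \<iota>_def interval_rep_simps mat_alg)
        then show ?thesis unfolding e using True x(3) v by simp
      next
        case False
        have "transport M s (Suc v) * x \<in> carrier_mat (rdim M (Suc v)) 1"
          using tc[of s "Suc v"] True i v x(1) by auto
        moreover have "\<iota> (Suc v) = transport M s (Suc v) * x" "arrow ?I v = 1\<^sub>m 1"
          using False \<open>i < v \<and> v \<le> j\<close> by (simp_all add: \<iota>_def interval_rep_simps del: transport.simps)
        ultimately show ?thesis unfolding e by (simp only: right_mult_one_mat)
      qed
    qed
  qed simp_all
  have pi: "\<pi> v * \<iota> v = 1\<^sub>m (rdim ?I v)" if v: "v \<in> {1..n}" for v
  proof (cases "i < v \<and> v \<le> j")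
    case False
    then have d0: "rdim ?I v = 0" by (auto simp: interval_rep_simps)
    show ?thesis using False by (intro eq_mat_empty) (auto simp: \<pi>_def \<iota>_def d0)
  next
    case True
    have "\<pi> v * \<iota> v = \<phi> * (transport M v j * transport M s v * x)"
      using True tc[of v j] tc[of s v] x(1) \<phi> j i v by (simp add: \<pi>_def \<iota>_def mat_alg)
    also have "transport M v j * transport M s v = transport M s j"
      using transport_trans[OF M, of s v j] True i j by simp
    finally show ?thesis using \<phi>y True by (simp add: y_def interval_rep_simps)
  qed
  from split_off[OF M is_rep_interval ih \<pi>[folded \<pi>_def] pi] obtain K where
    K: "is_rep n K" "rep_iso n M (direct_sum [?I, K])"
      "is_zero_rep n K \<Longrightarrow> \<forall>v\<in>{1..n}. \<iota> v * \<pi> v = 1\<^sub>m (rdim M v)" by blast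
  have "\<not> is_zero_rep n ?I" using j i by (auto simp: is_zero_rep_def interval_rep_simps intro!: bexI[of _ j])
  then have "is_zero_rep n K" using assms K(1,2) is_rep_interval unfolding indecomposable_def by blast
  then have "rep_iso n M ?I"
    unfolding rep_iso_iff using K(3) ih \<pi>[folded \<pi>_def] pi by blast
  then show ?thesis using j by blast
qed

text \<open>An endomorphism of M_{i,j} is determined by its scalar at j. The two summands give
  scalars with e1 + e2 = 1 and e1 idempotent, so one of them is 0.\<close>

lemma indecomposable_interval:
  assumes ij: "i < j" "j \<le> n"
  shows "indecomposable n (interval_rep (i, j) :: 'k::field rep)"
  unfolding indecomposable_def
proof (intro conjI allI impI is_rep_interval)
  let ?I = "interval_rep (i, j) :: 'k rep"
  show "\<not> is_zero_rep n ?I" using ij by (auto simp: is_zero_rep_def interval_rep_simps intro!: bexI[of _ j])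
  fix A B :: "'k rep" assume A: "is_rep n A" and B: "is_rep n B" and iso: "rep_iso n ?I (direct_sum [A, B])"
  let ?S = "direct_sum (A # [B])"
  have S: "is_rep n ?S" by (rule is_rep_direct_sum) (use A B in auto)
  have I: "is_rep n ?I" by (rule is_rep_interval)
  obtain f g where f: "f \<in> rep_hom n ?I ?S" and g: "g \<in> rep_hom n ?S ?I"
    and gf: "\<And>v. v \<in> {1..n} \<Longrightarrow> g v * f v = 1\<^sub>m (rdim ?I v)" and fg: "\<And>v. v \<in> {1..n} \<Longrightarrow> f v * g v = 1\<^sub>m (rdim ?S v)"
    using iso unfolding rep_iso_iff by blast
  obtain i1 i2 p1 p2 where h: "i1 \<in> rep_hom n A ?S" "i2 \<in> rep_hom n B ?S" "p1 \<in> rep_hom n ?S A" "p2 \<in> rep_hom n ?S B"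
    and q: "\<And>v. p1 v * i1 v = 1\<^sub>m (rdim A v)" "\<And>v. p2 v * i2 v = 1\<^sub>m (rdim B v)"
      "\<And>v. i1 v * p1 v + i2 v * p2 v = 1\<^sub>m (rdim ?S v)"
    using direct_sum_biproduct[OF A, of "[B]"] B unfolding direct_sum_single by metis
  \<comment> \<open>If the endomorphism through Z vanishes at j it vanishes everywhere, and the
    identity of Z factors through it.\<close>
  have zero: "is_zero_rep n Z"
    if Z: "is_rep n Z" "\<iota> \<in> rep_hom n Z ?S" "\<pi> \<in> rep_hom n ?S Z" "\<And>v. \<pi> v * \<iota> v = 1\<^sub>m (rdim Z v)"
      and e0: "g j * \<iota> j * (\<pi> j * f j) = 0\<^sub>m 1 1" for Z \<iota> \<pi>
  proof -
    define e where "e v = g v * \<iota> v * (\<pi> v * f v)" for v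
    have eh: "e \<in> rep_hom n ?I ?I"
      unfolding e_def by (rule hom_comp_in[OF I Z(1) I hom_comp_in[OF I S Z(1) f Z(3)] hom_comp_in[OF Z(1) S I Z(2) g]])
    have "e v = 0\<^sub>m (rdim ?I v) (rdim ?I v)" if v: "v \<in> {1..n}" for v
    proof (cases "i < v \<and> v \<le> j")
      case True
      then have "e v = e j * transport ?I v j" using hom_to_interval_determined(1)[OF I ij eh] by blast
      also have "e j = 0\<^sub>m 1 1" using e0 by (simp add: e_def)
      finally show ?thesis using transport_carrier[OF I, of v j] True ij v by (simp add: mat_alg interval_rep_simps)
    next
      case False
      then show ?thesis using rep_hom_carrier[OF eh, of v] v by (intro eq_mat_empty) (auto simp: interval_rep_simps)
    qed
    note e0' = this
    have "rdim Z v = 0" if v: "v \<in> {1..n}" for v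
    proof -
      have v1: "1 \<le> v" "v \<le> n" using v by auto
      note C = f[THEN rep_hom_carrier, OF v1] g[THEN rep_hom_carrier, OF v1] Z(2)[THEN rep_hom_carrier, OF v1] Z(3)[THEN rep_hom_carrier, OF v1]
      note D = C[THEN carrier_matD(1)] C[THEN carrier_matD(2)]
      have 1: "\<pi> v * (f v * (g v * \<iota> v)) = 1\<^sub>m (rdim Z v)"
        using mult_reduce[OF fg[OF v], of "\<iota> v"] Z(4) D by (simp add: mat_alg)
      have "1\<^sub>m (rdim Z v) = \<pi> v * (f v * (g v * \<iota> v)) * (\<pi> v * (f v * (g v * \<iota> v)))" unfolding 1 by simp
      also have "\<dots> = \<pi> v * (f v * (e v * (g v * \<iota> v)))" unfolding e_def by (simp add: mat_alg D)
      also have "\<dots> = 0\<^sub>m (rdim Z v) (rdim Z v)" unfolding e0'[OF v] by (simp add: mat_alg D)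
      finally show ?thesis by (simp add: one_mat_eq_zero_iff)
    qed
    then show ?thesis by (simp add: is_zero_rep_def)
  qed
  have jn: "j \<in> {1..n}" "1 \<le> j" using ij by auto
  have dj: "rdim ?I j = 1" using ij by (simp add: interval_rep_simps)
  define e1 where "e1 = g j * i1 j * (p1 j * f j)"
  define e2 where "e2 = g j * i2 j * (p2 j * f j)"
  note C = f[THEN rep_hom_carrier, OF jn(2) ij(2)] g[THEN rep_hom_carrier, OF jn(2) ij(2)] h(1)[THEN rep_hom_carrier, OF jn(2) ij(2)]
    h(2)[THEN rep_hom_carrier, OF jn(2) ij(2)] h(3)[THEN rep_hom_carrier, OF jn(2) ij(2)] h(4)[THEN rep_hom_carrier, OF jn(2) ij(2)]
  note D = C[THEN carrier_matD(1), unfolded dj] C[THEN carrier_matD(2), unfolded dj]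
  have ce: "e1 \<in> carrier_mat 1 1" "e2 \<in> carrier_mat 1 1" using D by (auto simp: e1_def e2_def intro: carrier_matI)
  have ee: "e1 * e1 = e1"
  proof -
    have "p1 j * (f j * (g j * i1 j)) = 1\<^sub>m (rdim A j)"
      using mult_reduce[OF fg[OF jn(1)], of "i1 j"] q(1) D by (simp add: mat_alg)
    moreover have "e1 * e1 = g j * i1 j * ((p1 j * (f j * (g j * i1 j))) * (p1 j * f j))"
      unfolding e1_def by (simp add: mat_alg D)
    ultimately show ?thesis unfolding e1_def by (simp add: mat_alg D)
  qed
  have sum: "e1 + e2 = 1\<^sub>m 1"
  proof -
    have "e1 + e2 = g j * ((i1 j * p1 j + i2 j * p2 j) * f j)" unfolding e1_def e2_def by (simp add: mat_alg D)
    also have "\<dots> = g j * f j" unfolding q(3) by (simp add: mat_alg D)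
    finally show ?thesis using gf[OF jn(1)] dj by simp
  qed
  have "e1 $$ (0, 0) * e1 $$ (0, 0) = e1 $$ (0, 0)"
  proof -
    have "(e1 * e1) $$ (0, 0) = e1 $$ (0, 0) * e1 $$ (0, 0)" using ce by (simp add: scalar_prod_def)
    then show ?thesis using ee by simp
  qed
  then consider "e1 $$ (0, 0) = 0" | "e1 $$ (0, 0) = 1" by auto
  then show "is_zero_rep n A \<or> is_zero_rep n B"
  proof cases
    case 1
    then have "e1 = 0\<^sub>m 1 1" using ce by (intro eq_matI) auto
    then show ?thesis using zero[OF A h(1) h(3) q(1)] by (simp add: e1_def)
  next
    case 2
    have "(e1 + e2) $$ (0, 0) = 1" unfolding sum by simp
    then have "e2 $$ (0, 0) = 0" using 2 ce by simp
    then have "e2 = 0\<^sub>m 1 1" using ce by (intro eq_matI) auto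
    then show ?thesis using zero[OF B h(2) h(4) q(2)] by (simp add: e2_def)
  qed
qed

section \<open>Relatively injective objects\<close>

lemma minus_mat_eq_zeroD:
  fixes A B :: "'k::field mat"
  assumes "A \<in> carrier_mat r c" "B \<in> carrier_mat r c" "A - B = 0\<^sub>m r c"
  shows "A = B"
proof (rule eq_matI)
  fix i j assume ij: "i < dim_row B" "j < dim_col B"
  then have "(A - B) $$ (i, j) = 0" unfolding assms(3) using assms(2) by simp
  then show "A $$ (i, j) = B $$ (i, j)" using ij assms(1,2) by simp
qed (use assms in auto)

text \<open>The test matrix 1 - V' V is killed by A = U V; hence V' V = 1 and V' U' is a left
  inverse.\<close>

lemma left_inverse_exists:
  fixes A :: "'k::field mat"
  assumes A: "A \<in> carrier_mat r c" and inj: "\<And>X. X \<in> carrier_mat c c \<Longrightarrow> A * X = 0\<^sub>m r c \<Longrightarrow> X = 0\<^sub>m c c"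
  shows "\<exists>L\<in>carrier_mat c r. L * A = 1\<^sub>m c"
proof -
  obtain d U V U' V' where C: "U \<in> carrier_mat r d" "V \<in> carrier_mat d c" "U' \<in> carrier_mat d r" "V' \<in> carrier_mat c d"
    and e: "A = U * V" "U' * U = 1\<^sub>m d" "V * V' = 1\<^sub>m d"
    using rank_factorization[OF A] by blast
  note D = C[THEN carrier_matD(1)] C[THEN carrier_matD(2)]
  have c1: "1\<^sub>m c - V' * V \<in> carrier_mat c c" by (rule carrier_matI) (simp_all add: D)
  have "A * (1\<^sub>m c - V' * V) = U * V - U * ((V * V') * V)" unfolding e(1) by (simp add: mat_alg D del: ext_dim_pos)
  also have "\<dots> = 0\<^sub>m r c" unfolding e(3) by (simp add: mat_alg D del: ext_dim_pos)
  finally have "1\<^sub>m c - V' * V = 0\<^sub>m c c" using inj[OF c1] by blast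
  then have VV: "1\<^sub>m c = V' * V" by (rule minus_mat_eq_zeroD[rotated 2]) (use C in auto)
  have "V' * U' * A = V' * ((U' * U) * V)" unfolding e(1) by (simp add: mat_alg D del: ext_dim_pos)
  also have "\<dots> = 1\<^sub>m c" unfolding e(2) VV by (simp add: mat_alg D del: ext_dim_pos)
  finally show ?thesis using C by (intro bexI[of _ "V' * U'"]) auto
qed

definition perp_cat :: "nat \<Rightarrow> (nat \<times> nat) set \<Rightarrow> 'k::field rep set" where
  "perp_cat n P = {W. is_rep n W \<and> (\<forall>(s, t)\<in>P. iso_on W s t)}"

text \<open>The kernel of m, computed at each vertex, lies in the category again. Comparing its
  inclusion with the zero map shows that it vanishes, so m is injective at every vertex.\<close>

lemma mono_in_left_inverse:
  fixes X Y :: "'k::field rep"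
  assumes P: "\<And>s t. (s, t) \<in> P \<Longrightarrow> s < t \<and> t \<le> n"
    and X: "X \<in> perp_cat n P" and Y: "Y \<in> perp_cat n P" and mono: "mono_in n (perp_cat n P) X Y m" and w: "w \<in> {1..n}"
  shows "\<exists>L\<in>carrier_mat (rdim X w) (rdim Y w). L * m w = 1\<^sub>m (rdim X w)"
proof -
  have rX: "is_rep n X" and rY: "is_rep n Y" using X Y by (auto simp: perp_cat_def)
  have m: "m \<in> rep_hom n X Y" using mono by (simp add: mono_in_def)
  have cm: "m v \<in> carrier_mat (rdim Y v) (rdim X v)" if "v \<in> {1..n}" for v
    using rep_hom_carrier[OF m, of v] that by auto
  have "\<forall>v\<in>{1..n}. \<exists>T. snd T \<in> carrier_mat (rdim X v) (dim_row (fst T)) \<and> fst T \<in> carrier_mat (dim_row (fst T)) (rdim X v) \<and>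
      fst T * snd T = 1\<^sub>m (dim_row (fst T)) \<and> m v * snd T = 0\<^sub>m (rdim Y v) (dim_row (fst T)) \<and>
      (\<forall>Z k. Z \<in> carrier_mat (rdim X v) k \<longrightarrow> m v * Z = 0\<^sub>m (rdim Y v) k \<longrightarrow> snd T * (fst T * Z) = Z)"
  proof
    fix v assume v: "v \<in> {1..n}"
    from kernel_basis[OF cm[OF v]] obtain d B L where
      b: "B \<in> carrier_mat (rdim X v) d" "L \<in> carrier_mat d (rdim X v)" "L * B = 1\<^sub>m d" "m v * B = 0\<^sub>m (rdim Y v) d"
       "\<forall>Z k. Z \<in> carrier_mat (rdim X v) k \<longrightarrow> m v * Z = 0\<^sub>m (rdim Y v) k \<longrightarrow> B * (L * Z) = Z" by blast
    have "dim_row L = d" using b(2) by simp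
    with b show "\<exists>T. snd T \<in> carrier_mat (rdim X v) (dim_row (fst T)) \<and> fst T \<in> carrier_mat (dim_row (fst T)) (rdim X v) \<and>
      fst T * snd T = 1\<^sub>m (dim_row (fst T)) \<and> m v * snd T = 0\<^sub>m (rdim Y v) (dim_row (fst T)) \<and>
      (\<forall>Z k. Z \<in> carrier_mat (rdim X v) k \<longrightarrow> m v * Z = 0\<^sub>m (rdim Y v) k \<longrightarrow> snd T * (fst T * Z) = Z)"
      by (intro exI[of _ "(L, B)"]) (simp only: fst_conv snd_conv simp_thms)
  qed
  from bchoice[OF this] obtain T where T: "\<And>v. v \<in> {1..n} \<Longrightarrow> snd (T v) \<in> carrier_mat (rdim X v) (dim_row (fst (T v)))"
    "\<And>v. v \<in> {1..n} \<Longrightarrow> fst (T v) \<in> carrier_mat (dim_row (fst (T v))) (rdim X v)"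
    "\<And>v. v \<in> {1..n} \<Longrightarrow> fst (T v) * snd (T v) = 1\<^sub>m (dim_row (fst (T v)))"
    "\<And>v. v \<in> {1..n} \<Longrightarrow> m v * snd (T v) = 0\<^sub>m (rdim Y v) (dim_row (fst (T v)))"
    "\<And>v Z k. v \<in> {1..n} \<Longrightarrow> Z \<in> carrier_mat (rdim X v) k \<Longrightarrow> m v * Z = 0\<^sub>m (rdim Y v) k \<Longrightarrow> snd (T v) * (fst (T v) * Z) = Z"
    by blast
  define B L d where "B v = snd (T v)" and "L v = fst (T v)" and "d v = dim_row (fst (T v))" for v
  have BL: "B v \<in> carrier_mat (rdim X v) (d v)" "L v \<in> carrier_mat (d v) (rdim X v)" "L v * B v = 1\<^sub>m (d v)"
    "m v * B v = 0\<^sub>m (rdim Y v) (d v)" if "v \<in> {1..n}" for v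
    unfolding B_def L_def d_def by (rule T[OF that])+
  have ker: "B v * (L v * Z) = Z" if "v \<in> {1..n}" "Z \<in> carrier_mat (rdim X v) k" "m v * Z = 0\<^sub>m (rdim Y v) k" for v Z k
    unfolding B_def L_def by (rule T(5)[OF that])
  \<comment> \<open>The kernel as a representation, with inclusion B and coordinates L.\<close>
  define K where "K = Rep d (\<lambda>v. L (Suc v) * arrow X v * B v)"
  have dK: "rdim K v = d v" and aK: "arrow K v = L (Suc v) * arrow X v * B v" for v by (simp_all add: K_def)
  have K: "is_rep n K"
    unfolding is_rep_def
  proof
    fix v assume "v \<in> {1..<n}"
    then have v: "1 \<le> v" "v < n" "v \<in> {1..n}" "Suc v \<in> {1..n}" by auto
    show "arrow K v \<in> carrier_mat (rdim K (v + 1)) (rdim K v)"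
      using BL(1)[OF v(3)] BL(2)[OF v(4)] arrow_carrier[OF rX v(1,2)] by (auto simp: aK dK)
  qed
  have Bh: "B \<in> rep_hom n K X"
  proof (rule rep_homI)
    fix v assume v: "1 \<le> v" "v < n"
    then have v': "v \<in> {1..n}" "Suc v \<in> {1..n}" by auto
    note C = BL(1)[OF v'(1)] BL(1)[OF v'(2)] BL(2)[OF v'(2)] cm[OF v'(1)] cm[OF v'(2)] arrow_carrier[OF rX v] arrow_carrier[OF rY v]
    note D = C[THEN carrier_matD(1)] C[THEN carrier_matD(2)]
    have "m (Suc v) * (arrow X v * B v) = m (Suc v) * arrow X v * B v" by (simp add: mat_alg D del: ext_dim_pos)
    also have "\<dots> = arrow Y v * (m v * B v)" unfolding rep_hom_comm[OF m v] by (simp add: mat_alg D del: ext_dim_pos)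
    also have "\<dots> = 0\<^sub>m (rdim Y (Suc v)) (d v)" unfolding BL(4)[OF v'(1)] by (simp add: mat_alg D del: ext_dim_pos)
    finally have z: "m (Suc v) * (arrow X v * B v) = 0\<^sub>m (rdim Y (Suc v)) (d v)" .
    have "arrow X v * B v \<in> carrier_mat (rdim X (Suc v)) (d v)" using C by auto
    from ker[OF v'(2) this z] show "B (Suc v) * arrow K v = arrow X v * B v"
      unfolding aK by (simp add: mat_alg D del: ext_dim_pos)
  qed (use BL in \<open>auto simp: dK\<close>)
  have "iso_on K s t" if st: "(s, t) \<in> P" for s t
  proof -
    have st': "s \<le> t" "t \<le> n" "s \<le> n" "t \<in> {1..n}" using P[OF st] by auto
    obtain Q where Q: "Q \<in> carrier_mat (ext_dim X s) (ext_dim X t)" "Q * transport X s t = 1\<^sub>m (ext_dim X s)"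
      "transport X s t * Q = 1\<^sub>m (ext_dim X t)" using X st by (auto simp: perp_cat_def iso_on_def)
    obtain Q' where Q': "Q' \<in> carrier_mat (ext_dim Y s) (ext_dim Y t)" "Q' * transport Y s t = 1\<^sub>m (ext_dim Y s)"
      using Y st by (auto simp: perp_cat_def iso_on_def)
    define eL where "eL = ext_hom L"
    define eB where "eB = ext_hom B"
    define em where "em = ext_hom m"
    have cL: "eL v \<in> carrier_mat (ext_dim K v) (ext_dim X v)" if "v \<le> n" for v
      using BL(2)[of v] that by (auto simp: eL_def ext_hom_def ext_dim_def dK)
    have cB: "eB v \<in> carrier_mat (ext_dim X v) (ext_dim K v)" if "v \<le> n" for v
      using ext_hom_carrier[OF Bh that] by (simp add: eB_def)
    have cem: "em v \<in> carrier_mat (ext_dim Y v) (ext_dim X v)" if "v \<le> n" for v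
      using ext_hom_carrier[OF m that] by (simp add: em_def)
    have eLB: "eL v * eB v = 1\<^sub>m (ext_dim K v)" if "v \<le> n" for v
      using BL(3)[of v] that by (cases "v = 0") (auto simp: eL_def eB_def ext_hom_def dK intro: eq_mat_empty)
    have emB: "em v * eB v = 0\<^sub>m (ext_dim Y v) (ext_dim K v)" if "v \<le> n" for v
      using BL(4)[of v] that by (cases "v = 0") (auto simp: em_def eB_def ext_hom_def dK intro: eq_mat_empty)
    have eker: "eB v * (eL v * Z) = Z" if "v \<le> n" "Z \<in> carrier_mat (ext_dim X v) k" "em v * Z = 0\<^sub>m (ext_dim Y v) k" for v Z k
      using ker[of v Z k] that by (cases "v = 0") (auto simp: em_def eB_def eL_def ext_hom_def dK intro: eq_mat_empty)
    note C = cL[OF st'(2)] cL[OF st'(3)] cB[OF st'(2)] cB[OF st'(3)] cem[OF st'(2)] cem[OF st'(3)] Q(1) Q'(1)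
      transport_carrier[OF rX st'(1,2)] transport_carrier[OF rY st'(1,2)] transport_carrier[OF K st'(1,2)]
    note D = C[THEN carrier_matD(1)] C[THEN carrier_matD(2)]
    have tB: "eB t * transport K s t = transport X s t * eB s"
      unfolding eB_def by (rule ext_hom_transport[OF K rX Bh st'(1,2)])
    have tm: "em t * transport X s t = transport Y s t * em s"
      unfolding em_def by (rule ext_hom_transport[OF rX rY m st'(1,2)])
    \<comment> \<open>The inverses of the transports commute with m, so Q carries the kernel at t
      into the kernel at s and restricts to an inverse for K.\<close>
    have sQ: "em s * Q = Q' * em t"
    proof -
      have "em s * Q = (Q' * transport Y s t) * (em s * Q)" unfolding Q'(2) by (simp add: mat_alg D del: ext_dim_pos)
      also have "\<dots> = Q' * (transport Y s t * em s) * Q" by (simp add: mat_alg D del: ext_dim_pos)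
      also have "\<dots> = Q' * (em t * (transport X s t * Q))" unfolding tm[symmetric] by (simp add: mat_alg D del: ext_dim_pos)
      finally show ?thesis unfolding Q(3) by (simp add: mat_alg D del: ext_dim_pos)
    qed
    have "eL s * Q * eB t * transport K s t = eL s * (Q * (eB t * transport K s t))" by (simp add: mat_alg D del: ext_dim_pos)
    also have "\<dots> = eL s * ((Q * transport X s t) * eB s)" unfolding tB by (simp add: mat_alg D del: ext_dim_pos)
    also have "\<dots> = 1\<^sub>m (ext_dim K s)" unfolding Q(2) by (simp add: mat_alg D eLB[OF st'(3)] del: ext_dim_pos)
    finally have 1: "eL s * Q * eB t * transport K s t = 1\<^sub>m (ext_dim K s)" .
    have "em s * (Q * eB t) = (em s * Q) * eB t" by (simp add: mat_alg D del: ext_dim_pos)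
    also have "\<dots> = Q' * (em t * eB t)" unfolding sQ by (simp add: mat_alg D del: ext_dim_pos)
    also have "\<dots> = 0\<^sub>m (ext_dim Y s) (ext_dim K t)" unfolding emB[OF st'(2)] by (simp add: mat_alg D del: ext_dim_pos)
    finally have z: "em s * (Q * eB t) = 0\<^sub>m (ext_dim Y s) (ext_dim K t)" .
    have k: "eB s * (eL s * (Q * eB t)) = Q * eB t"
      by (rule eker[OF st'(3) mult_carrier_mat[OF Q(1) cB[OF st'(2)]] z])
    have "transport K s t * (eL s * Q * eB t) = (eL t * eB t) * (transport K s t * (eL s * (Q * eB t)))"
      unfolding eLB[OF st'(2)] by (simp add: mat_alg D del: ext_dim_pos)
    also have "\<dots> = eL t * ((eB t * transport K s t) * (eL s * (Q * eB t)))" by (simp add: mat_alg D del: ext_dim_pos)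
    also have "\<dots> = eL t * (transport X s t * (eB s * (eL s * (Q * eB t))))" unfolding tB by (simp add: mat_alg D del: ext_dim_pos)
    also have "\<dots> = eL t * ((transport X s t * Q) * eB t)" unfolding k by (simp add: mat_alg D del: ext_dim_pos)
    also have "\<dots> = 1\<^sub>m (ext_dim K t)" unfolding Q(3) by (simp add: mat_alg D eLB[OF st'(2)] del: ext_dim_pos)
    finally have 2: "transport K s t * (eL s * Q * eB t) = 1\<^sub>m (ext_dim K t)" .
    have "eL s * Q * eB t \<in> carrier_mat (ext_dim K s) (ext_dim K t)"
      by (rule mult_carrier_mat[OF mult_carrier_mat[OF cL[OF st'(3)] Q(1)] cB[OF st'(2)]])
    then show ?thesis unfolding iso_on_def using 1 2 by blast
  qed
  then have KC: "K \<in> perp_cat n P" using K by (auto simp: perp_cat_def)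
  define z where "z v = (0\<^sub>m (rdim X v) (rdim K v) :: 'k mat)" for v
  have zh: "z \<in> rep_hom n K X"
    by (rule rep_homI) (simp_all add: z_def mat_alg carrier_matD[OF arrow_carrier[OF K]] carrier_matD[OF arrow_carrier[OF rX]])
  have "hom_eq n (m \<circ>\<^sub>r B) (m \<circ>\<^sub>r z)"
    unfolding hom_eq_def hom_comp_def
  proof
    fix v assume v: "v \<in> {1..n}"
    show "m v * B v = m v * z v" unfolding BL(4)[OF v] using cm[OF v] by (simp add: z_def dK mat_alg)
  qed
  then have "hom_eq n B z" using mono KC Bh zh unfolding mono_in_def by blast
  then have Bw: "B w = 0\<^sub>m (rdim X w) (d w)" using w by (simp add: hom_eq_def z_def dK)
  show ?thesis
  proof (rule left_inverse_exists[OF cm[OF w]])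
    fix Z assume Z: "Z \<in> carrier_mat (rdim X w) (rdim X w)" "m w * Z = 0\<^sub>m (rdim Y w) (rdim X w)"
    have "B w * (L w * Z) = 0\<^sub>m (rdim X w) (rdim X w)"
      unfolding Bw using Z(1) BL(2)[OF w] by (simp add: mat_alg)
    then show "Z = 0\<^sub>m (rdim X w) (rdim X w)" using ker[OF w Z] by simp
  qed
qed

section \<open>Interval modules in a perpendicular category\<close>

lemma transport_interval:
  assumes "k < s" "s \<le> t" "t \<le> l"
  shows "transport (interval_rep (k, l) :: 'k::field rep) s t = 1\<^sub>m 1"
  using assms(2,3)
proof (induction t rule: dec_induct)
  case base
  then show ?case using assms by (simp add: interval_rep_simps)
next
  case (step t)
  then have "transport (interval_rep (k, l) :: 'k rep) s t = 1\<^sub>m 1" by simp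
  then show ?case using step assms by (simp add: interval_rep_simps)
qed

lemma ext_dim_interval: "ext_dim (interval_rep (k, l)) v = (if k < v \<and> v \<le> l then 1 else 0)"
  by (simp add: ext_dim_def interval_rep_simps)

lemma iso_on_interval_iff:
  assumes "s < t" "t \<le> n"
  shows "iso_on (interval_rep (k, l) :: 'k::field rep) s t \<longleftrightarrow> ((k < s \<and> s \<le> l) \<longleftrightarrow> (k < t \<and> t \<le> l))"
proof -
  let ?I = "interval_rep (k, l) :: 'k rep"
  have c: "transport ?I s t \<in> carrier_mat (ext_dim ?I t) (ext_dim ?I s)"
    using transport_carrier[OF is_rep_interval[of n k l], of s t] assms by simp
  show ?thesis
  proof
    assume iso: "iso_on ?I s t"
    then obtain B where B: "B \<in> carrier_mat (ext_dim ?I s) (ext_dim ?I t)" "B * transport ?I s t = 1\<^sub>m (ext_dim ?I s)"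
      "transport ?I s t * B = 1\<^sub>m (ext_dim ?I t)" by (auto simp: iso_on_def)
    show "(k < s \<and> s \<le> l) \<longleftrightarrow> (k < t \<and> t \<le> l)"
    proof (rule ccontr)
      assume "\<not> ?thesis"
      then consider "ext_dim ?I s = 1" "ext_dim ?I t = 0" | "ext_dim ?I s = 0" "ext_dim ?I t = 1"
        unfolding ext_dim_interval by argo
      then show False
      proof cases
        case 1
        then have "(B * transport ?I s t) $$ (0, 0) = 0" using B(1) c by (simp add: scalar_prod_def)
        then show False unfolding B(2) using 1 by simp
      next
        case 2
        then have "(transport ?I s t * B) $$ (0, 0) = 0" using B(1) c by (simp add: scalar_prod_def)
        then show False unfolding B(3) using 2 by simp
      qed
    qed
  next
    assume e: "(k < s \<and> s \<le> l) \<longleftrightarrow> (k < t \<and> t \<le> l)"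
    show "iso_on ?I s t"
    proof (cases "k < s \<and> s \<le> l")
      case True
      then have "transport ?I s t = 1\<^sub>m 1" using e assms by (intro transport_interval) auto
      then show ?thesis using True e unfolding iso_on_def ext_dim_interval
        by (intro bexI[of _ "1\<^sub>m 1"]) simp_all
    next
      case False
      then have d: "ext_dim ?I s = 0" "ext_dim ?I t = 0" using e by (auto simp: ext_dim_interval)
      show ?thesis unfolding iso_on_def d
        by (intro bexI[of _ "0\<^sub>m 0 0"] conjI eq_mat_empty) (use c d in auto)
    qed
  qed
qed

lemma iso_on_trans:
  assumes W: "is_rep n W" and st: "s \<le> u" "u \<le> t" "t \<le> n" and i: "iso_on W s u" "iso_on W u t"
  shows "iso_on W s t"
proof -
  obtain B where B: "B \<in> carrier_mat (ext_dim W s) (ext_dim W u)" "B * transport W s u = 1\<^sub>m (ext_dim W s)"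
    "transport W s u * B = 1\<^sub>m (ext_dim W u)" using i(1) by (auto simp: iso_on_def)
  obtain B' where B': "B' \<in> carrier_mat (ext_dim W u) (ext_dim W t)" "B' * transport W u t = 1\<^sub>m (ext_dim W u)"
    "transport W u t * B' = 1\<^sub>m (ext_dim W t)" using i(2) by (auto simp: iso_on_def)
  note C = B(1) B'(1) transport_carrier[OF W st(1) order.trans[OF st(2,3)]] transport_carrier[OF W st(2,3)]
  note D = C[THEN carrier_matD(1)] C[THEN carrier_matD(2)]
  have "B * B' * transport W s t = B * ((B' * transport W u t) * transport W s u)"
    unfolding transport_trans[OF W st] by (simp add: mat_alg D del: ext_dim_pos)
  then have 1: "B * B' * transport W s t = 1\<^sub>m (ext_dim W s)" unfolding B'(2) using B(2) D by (simp add: mat_alg)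
  have "transport W s t * (B * B') = transport W u t * ((transport W s u * B) * B')"
    unfolding transport_trans[OF W st] by (simp add: mat_alg D del: ext_dim_pos)
  then have 2: "transport W s t * (B * B') = 1\<^sub>m (ext_dim W t)" unfolding B(3) using B'(3) D by (simp add: mat_alg)
  show ?thesis unfolding iso_on_def using 1 2 mult_carrier_mat[OF B(1) B'(1)] by blast
qed

lemma iso_on_rtrancl:
  assumes W: "is_rep n W" and P: "\<And>s t. (s, t) \<in> P \<Longrightarrow> s < t \<and> t \<le> n \<and> iso_on W s t"
    and x: "(x, i) \<in> P\<^sup>*" and i: "i \<le> n"
  shows "x \<le> i \<and> iso_on W x i"
  using x i
proof (induction rule: rtrancl_induct)
  case base
  show ?case unfolding iso_on_def by (auto intro!: bexI[of _ "1\<^sub>m (ext_dim W x)"])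
next
  case (step y z)
  then show ?case using P[OF step.hyps(2)] iso_on_trans[OF W, of x y z] by auto
qed

text \<open>
  \<open>W\<^sub>i\<close> has a complement in \<open>W\<^sub>j\<close>, natural in \<open>W\<close>: either \<open>W\<^sub>i = 0\<close>, or \<open>W\<^sub>x \<rightarrow> W\<^sub>i \<rightarrow> W\<^sub>j \<rightarrow> W\<^sub>z\<close>
  is an isomorphism.  Functionals on \<open>X\<^sub>j / X\<^sub>i\<close> are extended along it.
\<close>

lemma injective_in_interval:
  fixes P :: "(nat \<times> nat) set"
  assumes P: "\<And>s t. (s, t) \<in> P \<Longrightarrow> s < t \<and> t \<le> n" and ij: "i < j" "j \<le> n"
    and I: "interval_rep (i, j) \<in> (perp_cat n P :: 'k::field rep set)"
    and x: "(x, i) \<in> P\<^sup>*" "x = 0 \<or> (\<exists>z>j. (x, z) \<in> P)"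
  shows "injective_in n (perp_cat n P) (interval_rep (i, j) :: 'k rep)"
  unfolding injective_in_def
proof (intro conjI I ballI allI impI)
  fix X Y :: "'k rep" and m h
  assume X: "X \<in> perp_cat n P" and Y: "Y \<in> perp_cat n P" and mono: "mono_in n (perp_cat n P) X Y m"
    and h: "h \<in> rep_hom n X (interval_rep (i, j))"
  let ?I = "interval_rep (i, j) :: 'k rep"
  have rX: "is_rep n X" and rY: "is_rep n Y" using X Y by (auto simp: perp_cat_def)
  have m: "m \<in> rep_hom n X Y" using mono by (simp add: mono_in_def)
  have jn: "j \<in> {1..n}" "1 \<le> j" "i \<le> n" using ij by auto
  have xi: "x \<le> i \<and> iso_on W x i" if "W \<in> perp_cat n P" for W :: "'k rep"
    using that P by (intro iso_on_rtrancl[OF _ _ x(1) jn(3)]) (auto simp: perp_cat_def)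
  have xle: "x \<le> i" using xi[OF X] by simp
  \<comment> \<open>Through L the functional \<open>h j\<close> on X_j extends to Y_j; it remains to
    make the extension vanish on the image of Y_i.\<close>
  obtain L where L: "L \<in> carrier_mat (rdim X j) (rdim Y j)" "L * m j = 1\<^sub>m (rdim X j)"
    using mono_in_left_inverse[OF P X Y mono jn(1)] by blast
  have \<phi>: "h j \<in> carrier_mat 1 (rdim X j)" using rep_hom_carrier[OF h, of j] ij by (simp add: interval_rep_simps)
  have mj: "m j \<in> carrier_mat (rdim Y j) (rdim X j)" using rep_hom_carrier[OF m jn(2) ij(2)] .
  note h0 = hom_to_interval_determined[OF rX ij h]
  have "\<exists>\<psi>\<in>carrier_mat 1 (rdim Y j). \<psi> * transport Y i j = 0\<^sub>m 1 (ext_dim Y i) \<and> \<psi> * m j = h j"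
  proof (cases "x = 0")
    case True
    \<comment> \<open>Here Y_i is isomorphic to Y_0 = 0, so there is nothing to kill.\<close>
    obtain B where B: "B \<in> carrier_mat 0 (ext_dim Y i)" "transport Y 0 i * B = 1\<^sub>m (ext_dim Y i)"
      using xi[OF Y] True by (auto simp: iso_on_def)
    have "transport Y 0 i \<in> carrier_mat (ext_dim Y i) 0"
      using transport_carrier[OF rY, of 0 i] jn(3) by simp
    from mult_inner_zero[OF this B(1)] have "(1\<^sub>m (ext_dim Y i) :: 'k mat) = 0\<^sub>m (ext_dim Y i) (ext_dim Y i)"
      unfolding B(2) .
    then have "ext_dim Y i = 0" by (simp only: one_mat_eq_zero_iff)
    then have "h j * L * transport Y i j = 0\<^sub>m 1 (ext_dim Y i)"
      using transport_carrier[OF rY, of i j] ij \<phi> by (intro eq_mat_empty) auto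
    moreover have "h j * L * m j = h j" using \<phi> L mj by (simp add: mat_alg)
    ultimately show ?thesis using \<phi> L(1) by (intro bexI[of _ "h j * L"]) auto
  next
    case False
    then obtain z where z: "j < z" "(x, z) \<in> P" using x(2) by blast
    have zn: "z \<le> n" "x \<le> z" "j \<le> z" "x \<le> j" using P[OF z(2)] z(1) xle ij by auto
    obtain Q where Q: "Q \<in> carrier_mat (ext_dim X x) (ext_dim X z)" "Q * transport X x z = 1\<^sub>m (ext_dim X x)"
      "transport X x z * Q = 1\<^sub>m (ext_dim X z)" using X z(2) by (auto simp: perp_cat_def iso_on_def)
    obtain Q' where Q': "Q' \<in> carrier_mat (ext_dim Y x) (ext_dim Y z)" "Q' * transport Y x z = 1\<^sub>m (ext_dim Y x)"
      using Y z(2) by (auto simp: perp_cat_def iso_on_def)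
    obtain R where R: "R \<in> carrier_mat (ext_dim Y x) (ext_dim Y i)" "transport Y x i * R = 1\<^sub>m (ext_dim Y i)"
      using xi[OF Y] by (auto simp: iso_on_def)
    have xn: "x \<le> n" using xle jn by simp
    note C = Q(1) Q'(1) R(1) L(1) \<phi> mj transport_carrier[OF rX zn(4) ij(2)] transport_carrier[OF rX zn(3,1)] transport_carrier[OF rX zn(2,1)]
      transport_carrier[OF rY zn(4) ij(2)] transport_carrier[OF rY zn(3,1)] transport_carrier[OF rY zn(2,1)]
      transport_carrier[OF rY xle jn(3)] transport_carrier[OF rY less_imp_le[OF ij(1)] ij(2)]
      transport_carrier[OF rX xle jn(3)] transport_carrier[OF rX less_imp_le[OF ij(1)] ij(2)]
      ext_hom_carrier[OF m zn(1)] ext_hom_carrier[OF m xn]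
    have ej: "ext_dim W j = rdim W j" for W :: "'k rep" using ij by simp
    note D = C[THEN carrier_matD(1), unfolded ej] C[THEN carrier_matD(2), unfolded ej]
    have tz: "transport W x z = transport W j z * transport W x j" if "is_rep n W" for W :: "'k rep"
      using transport_trans[OF that zn(4,3,1)] .
    have ti: "transport W x j = transport W i j * transport W x i" if "is_rep n W" for W :: "'k rep"
      using transport_trans[OF that xle less_imp_le[OF ij(1)] ij(2)] .
    have nz: "ext_hom m z * transport X j z = transport Y j z * m j"
      using ext_hom_transport[OF rX rY m zn(3,1)] ij by (simp add: ext_hom_def)
    have nx: "m j * transport X x j = transport Y x j * ext_hom m x"
      using ext_hom_transport[OF rX rY m zn(4) ij(2)] ij by (simp add: ext_hom_def)
    have nxz: "ext_hom m z * transport X x z = transport Y x z * ext_hom m x"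
      using ext_hom_transport[OF rX rY m zn(2,1)] .
    have sQ: "Q' * ext_hom m z = ext_hom m x * Q"
    proof -
      have "ext_hom m x * Q = (Q' * transport Y x z) * (ext_hom m x * Q)" unfolding Q'(2) by (simp add: mat_alg D del: ext_dim_pos)
      also have "\<dots> = Q' * (transport Y x z * ext_hom m x) * Q" by (simp add: mat_alg D del: ext_dim_pos)
      also have "\<dots> = Q' * (ext_hom m z * (transport X x z * Q))" unfolding nxz[symmetric] by (simp add: mat_alg D del: ext_dim_pos)
      finally show ?thesis unfolding Q(3) by (simp add: mat_alg D del: ext_dim_pos)
    qed
    \<comment> \<open>The projection of Y_j onto the kernel of Y_j -> Y_z along the image of Y_x,
      which is also the image of Y_i. By naturality, inserting it does not change the restriction to
      X_j, as \<open>h j\<close> kills the image of X_x.\<close>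
    define \<rho> where "\<rho> = 1\<^sub>m (rdim Y j) - transport Y x j * (Q' * transport Y j z)"
    have c\<rho>: "\<rho> \<in> carrier_mat (rdim Y j) (rdim Y j)" unfolding \<rho>_def by (rule carrier_matI) (simp_all add: D)
    note D = D carrier_matD[OF c\<rho>]
    have "\<rho> * transport Y x j = transport Y x j - transport Y x j * (Q' * (transport Y j z * transport Y x j))"
      unfolding \<rho>_def by (simp add: mat_alg D del: ext_dim_pos)
    also have "\<dots> = 0\<^sub>m (rdim Y j) (ext_dim Y x)"
      unfolding tz[OF rY, symmetric] Q'(2) by (simp add: mat_alg D del: ext_dim_pos)
    finally have \<rho>x: "\<rho> * transport Y x j = 0\<^sub>m (rdim Y j) (ext_dim Y x)" .
    have "\<rho> * transport Y i j = \<rho> * (transport Y i j * (transport Y x i * R))" unfolding R(2) by (simp add: mat_alg D del: ext_dim_pos)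
    also have "\<dots> = (\<rho> * transport Y x j) * R" unfolding ti[OF rY] by (simp add: mat_alg D del: ext_dim_pos)
    finally have \<rho>i: "\<rho> * transport Y i j = 0\<^sub>m (rdim Y j) (ext_dim Y i)" unfolding \<rho>x by (simp add: mat_alg D del: ext_dim_pos)
    have hx: "h j * transport X x j = 0\<^sub>m 1 (ext_dim X x)"
      unfolding ti[OF rX] using mult_reduce[OF h0(2), of "transport X x i"] by (simp add: mat_alg D del: ext_dim_pos)
    have "\<rho> * m j = m j - transport Y x j * (Q' * (transport Y j z * m j))"
      unfolding \<rho>_def by (simp add: mat_alg D del: ext_dim_pos)
    also have "\<dots> = m j - transport Y x j * ((Q' * ext_hom m z) * transport X j z)"
      unfolding nz[symmetric] by (simp add: mat_alg D del: ext_dim_pos)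
    also have "\<dots> = m j - (transport Y x j * ext_hom m x) * (Q * transport X j z)"
      unfolding sQ by (simp add: mat_alg D del: ext_dim_pos)
    also have "\<dots> = m j - m j * (transport X x j * (Q * transport X j z))"
      unfolding nx[symmetric] by (simp add: mat_alg D del: ext_dim_pos)
    finally have \<rho>m: "\<rho> * m j = m j - m j * (transport X x j * (Q * transport X j z))" .
    have "h j * L * \<rho> * m j = h j * (L * (\<rho> * m j))" by (simp add: mat_alg D del: ext_dim_pos)
    also have "\<dots> = h j * ((L * m j) - (L * m j) * (transport X x j * (Q * transport X j z)))"
      unfolding \<rho>m by (simp add: mat_alg D del: ext_dim_pos)
    also have "\<dots> = h j - (h j * transport X x j) * (Q * transport X j z)"
      unfolding L(2) by (simp add: mat_alg D del: ext_dim_pos)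
    also have "\<dots> = h j" unfolding hx by (simp add: mat_alg D del: ext_dim_pos)
    finally have 2: "h j * L * \<rho> * m j = h j" .
    have "h j * L * \<rho> * transport Y i j = h j * (L * (\<rho> * transport Y i j))" by (simp add: mat_alg D del: ext_dim_pos)
    then have 1: "h j * L * \<rho> * transport Y i j = 0\<^sub>m 1 (ext_dim Y i)" unfolding \<rho>i by (simp add: mat_alg D del: ext_dim_pos)
    show ?thesis using 1 2 mult_carrier_mat[OF mult_carrier_mat[OF \<phi> L(1)] c\<rho>] by blast
  qed
  then obtain \<psi> where \<psi>: "\<psi> \<in> carrier_mat 1 (rdim Y j)" "\<psi> * transport Y i j = 0\<^sub>m 1 (ext_dim Y i)" "\<psi> * m j = h j" by blast
  have \<psi>1: "\<psi> \<in> carrier_mat 1 (ext_dim Y j)" using \<psi>(1) ij by simp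
  \<comment> \<open>A homomorphism into M_{i,j} is determined at j, so extending it there
    suffices.\<close>
  define h' where "h' = (\<lambda>v. if i < v \<and> v \<le> j then \<psi> * transport Y v j else 0\<^sub>m 0 (rdim Y v))"
  have h': "h' \<in> rep_hom n Y ?I" unfolding h'_def by (rule hom_to_interval[OF rY ij \<psi>1 \<psi>(2)])
  have h'm: "(\<lambda>v. h' v * m v) \<in> rep_hom n X ?I" by (rule hom_comp_in[OF rX rY is_rep_interval m h'])
  have hj: "h' j * m j = h j" using \<psi> ij by (simp add: h'_def)
  have "h' v * m v = h v" if v: "v \<in> {1..n}" for v
  proof (cases "i < v \<and> v \<le> j")
    case True
    then show ?thesis
      using hom_to_interval_determined(1)[OF rX ij h'm, of v] h0(1)[of v] hj by simp
  next
    case False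
    then show ?thesis using rep_hom_carrier[OF h'm, of v] rep_hom_carrier[OF h, of v] v
      by (intro eq_mat_empty) (auto simp: interval_rep_simps)
  qed
  then show "\<exists>h'\<in>rep_hom n Y ?I. hom_eq n (h' \<circ>\<^sub>r m) h"
    by (intro bexI[OF _ h']) (simp add: hom_eq_def hom_comp_def)
qed

text \<open>The inclusion of M_{i,j} into M_{u,j} has no retraction: at j it would be a functional
  that kills the image of the space at i, but that image is the whole line.\<close>

lemma not_injective_in_interval:
  assumes u: "u < i" "i < j" "j \<le> n"
    and I: "interval_rep (i, j) \<in> (perp_cat n P :: 'k::field rep set)" and Y: "interval_rep (u, j) \<in> (perp_cat n P :: 'k rep set)"
  shows "\<not> injective_in n (perp_cat n P) (interval_rep (i, j) :: 'k rep)"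
proof
  assume inj: "injective_in n (perp_cat n P) (interval_rep (i, j) :: 'k rep)"
  let ?I = "interval_rep (i, j) :: 'k rep" and ?Y = "interval_rep (u, j) :: 'k rep"
  define m where "m v = (if i < v \<and> v \<le> j then 1\<^sub>m 1 else 0\<^sub>m (rdim ?Y v) 0 :: 'k mat)" for v
  have m: "m \<in> rep_hom n ?I ?Y"
  proof (rule rep_homI)
    show c: "m v \<in> carrier_mat (rdim ?Y v) (rdim ?I v)" if "1 \<le> v" "v \<le> n" for v
      using u by (auto simp: m_def interval_rep_simps)
    fix v assume v: "1 \<le> v" "v < n"
    have aY: "arrow ?Y v \<in> carrier_mat (rdim ?Y (Suc v)) (rdim ?Y v)"
      and aI: "arrow ?I v \<in> carrier_mat (rdim ?I (Suc v)) (rdim ?I v)"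
      by (rule arrow_carrier[OF is_rep_interval v])+
    show "m (Suc v) * arrow ?I v = arrow ?Y v * m v"
    proof (cases "i < v \<and> Suc v \<le> j")
      case True
      then show ?thesis using u by (simp add: m_def interval_rep_simps)
    next
      case False
      then show ?thesis using aY aI c[of v] c[of "Suc v"] v u
        by (intro eq_mat_empty) (auto simp: interval_rep_simps)
    qed
  qed
  have "mono_in n (perp_cat n P) ?I ?Y m"
    unfolding mono_in_def
  proof (intro conjI m ballI impI)
    fix Z g h assume g: "g \<in> rep_hom n Z ?I" and h: "h \<in> rep_hom n Z ?I" and e: "hom_eq n (m \<circ>\<^sub>r g) (m \<circ>\<^sub>r h)"
    show "hom_eq n g h"
      unfolding hom_eq_def
    proof
      fix v assume v: "v \<in> {1..n}"
      have c: "g v \<in> carrier_mat (rdim ?I v) (rdim Z v)" "h v \<in> carrier_mat (rdim ?I v) (rdim Z v)"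
        using rep_hom_carrier[OF g, of v] rep_hom_carrier[OF h, of v] v by auto
      show "g v = h v"
      proof (cases "i < v \<and> v \<le> j")
        case True
        have "m v * g v = m v * h v" using e v by (simp add: hom_eq_def hom_comp_def)
        then have "1\<^sub>m 1 * g v = 1\<^sub>m 1 * h v" using True by (simp add: m_def)
        moreover have "1\<^sub>m 1 * g v = g v" "1\<^sub>m 1 * h v = h v"
          using c True by (auto intro!: left_mult_one_mat simp: interval_rep_simps)
        ultimately show ?thesis by simp
      next
        case False
        then show ?thesis using c by (intro eq_mat_empty) (auto simp: interval_rep_simps)
      qed
    qed
  qed
  then obtain h' where h': "h' \<in> rep_hom n ?Y ?I" "hom_eq n (h' \<circ>\<^sub>r m) (hom_id ?I)"
    using inj I Y hom_id_in[OF is_rep_interval] unfolding injective_in_def by blast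
  have c: "h' j \<in> carrier_mat 1 1"
    using rep_hom_carrier[OF h'(1), of j] u by (simp add: interval_rep_simps)
  have "h' j * transport ?Y i j = 0\<^sub>m 1 (ext_dim ?Y i)"
    by (rule hom_to_interval_determined(2)[OF is_rep_interval u(2,3) h'(1)])
  moreover have "transport ?Y i j = 1\<^sub>m 1" using u by (intro transport_interval) auto
  moreover have "ext_dim ?Y i = 1" using u by (simp add: ext_dim_interval)
  ultimately have 0: "h' j = 0\<^sub>m 1 1" using c by simp
  have "h' j * m j = 1\<^sub>m (rdim ?I j)" using h'(2) u by (simp add: hom_eq_def hom_comp_def hom_id_def)
  then have "(0\<^sub>m 1 1 :: 'k mat) = 1\<^sub>m 1" using 0 u by (simp add: m_def interval_rep_simps)
  then have "(0\<^sub>m 1 1 :: 'k mat) $$ (0, 0) = 1\<^sub>m 1 $$ (0, 0)" by (rule arg_cong)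
  then show False by simp
qed

lemma injective_in_iso:
  fixes I J :: "'k::field rep"
  assumes C: "\<And>W. W \<in> C \<Longrightarrow> is_rep n W" and J: "J \<in> C" and iso: "rep_iso n I J" and inj: "injective_in n C I"
  shows "injective_in n C J"
  unfolding injective_in_def
proof (intro conjI J ballI allI impI)
  have I: "I \<in> C" using inj by (simp add: injective_in_def)
  obtain f g where f: "f \<in> rep_hom n I J" and g: "g \<in> rep_hom n J I" and fg: "\<And>v. v \<in> {1..n} \<Longrightarrow> f v * g v = 1\<^sub>m (rdim J v)"
    using iso unfolding rep_iso_iff by blast
  fix X Y m h assume X: "X \<in> C" and Y: "Y \<in> C" and m: "mono_in n C X Y m" and h: "h \<in> rep_hom n X J"
  have gh: "(\<lambda>v. g v * h v) \<in> rep_hom n X I" by (rule hom_comp_in[OF C[OF X] C[OF J] C[OF I] h g])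
  obtain h' where h': "h' \<in> rep_hom n Y I" "hom_eq n (h' \<circ>\<^sub>r m) (\<lambda>v. g v * h v)"
    using inj X Y m gh unfolding injective_in_def by blast
  have mh: "m \<in> rep_hom n X Y" using m by (simp add: mono_in_def)
  have "(f v * h' v) * m v = h v" if v: "v \<in> {1..n}" for v
  proof -
    have v1: "1 \<le> v" "v \<le> n" using v by auto
    note c = f[THEN rep_hom_carrier, OF v1] g[THEN rep_hom_carrier, OF v1] h[THEN rep_hom_carrier, OF v1]
      h'(1)[THEN rep_hom_carrier, OF v1] mh[THEN rep_hom_carrier, OF v1]
    note D = c[THEN carrier_matD(1)] c[THEN carrier_matD(2)]
    have e: "h' v * m v = g v * h v" using h'(2) v by (simp add: hom_eq_def hom_comp_def)
    have "(f v * h' v) * m v = f v * (h' v * m v)" by (simp add: mat_alg D del: ext_dim_pos)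
    then show ?thesis unfolding e using mult_reduce[OF fg[OF v], of "h v"] D by (simp add: mat_alg)
  qed
  then show "\<exists>h'\<in>rep_hom n Y J. hom_eq n (h' \<circ>\<^sub>r m) h"
    by (intro bexI[OF _ hom_comp_in[OF C[OF Y] C[OF I] C[OF J] h'(1) f]]) (simp add: hom_eq_def hom_comp_def)
qed

section \<open>The bijection\<close>

definition interval_class :: "nat \<Rightarrow> nat \<times> nat \<Rightarrow> 'k::field rep set" where
  "interval_class n e = iso_class n (interval_rep e)"

lemma inj_on_interval_class: "inj_on (interval_class n :: _ \<Rightarrow> 'k::field rep set) (strands_in 0 n)"
  by (rule inj_onI) (auto simp: interval_class_def strands_in_def dest!: iso_class_interval_inj)

lemma is_rep_interval': "is_rep n (interval_rep e)"
  by (cases e) (simp add: is_rep_interval)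

lemma strands_interval_class:
  assumes "D \<subseteq> strands_in 0 n"
  shows "strands n (interval_class n ` D :: 'k::field rep set set) = D"
proof -
  have "e \<in> strands n (interval_class n ` D :: 'k rep set set) \<longleftrightarrow> e \<in> D" for e
  proof -
    have "e \<in> strands n (interval_class n ` D :: 'k rep set set) \<longleftrightarrow>
        e \<in> strands_in 0 n \<and> (interval_class n e :: 'k rep set) \<in> interval_class n ` D"
      by (cases e) (auto simp: strands_def strands_in_def interval_class_def)
    also have "\<dots> \<longleftrightarrow> e \<in> D"
      using assms inj_on_image_mem_iff[OF inj_on_interval_class _ assms] by blast
    finally show ?thesis .
  qed
  then show ?thesis by blast
qed

text \<open>The bridge between strands and modules: with \<open>orth_interval_iff'\<close>, the
  constraints of \<open>exc_list\<close> become those of an exceptional sequence.\<close>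

lemma iso_on_interval_iff_perp:
  assumes "X \<in> strands_in 0 n"
  shows "iso_on (interval_rep Y :: 'k::field rep) (fst X) (snd X) \<longleftrightarrow> perp Y X"
  using assms iso_on_interval_iff[of "fst X" "snd X" n "fst Y" "snd Y", where 'k='k]
  by (auto simp: strands_in_def perp_def)

lemma orth_interval_iff':
  assumes "is_rep n W" "X \<in> strands_in 0 n"
  shows "orth n W (interval_rep X) \<longleftrightarrow> iso_on W (fst X) (snd X)"
  using orth_interval_iff[OF assms(1), of "fst X" "snd X"] assms(2) by (auto simp: strands_in_def)

lemma orth_iso:
  assumes "is_rep n W" "is_rep n V" "is_rep n V'" "rep_iso n V V'"
  shows "orth n W V \<longleftrightarrow> orth n W V'"
  using retract_orth[OF assms(1,2,3)] retract_orth[OF assms(1,3,2)] rep_iso_retract[OF assms(4)] by blast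

lemma exceptional_seq_orth:
  assumes "exceptional_seq n Es"
  shows "p < n \<Longrightarrow> is_rep n (Es ! p)" "p < n \<Longrightarrow> indecomposable n (Es ! p)"
    "q < p \<Longrightarrow> p < n \<Longrightarrow> orth n (Es ! p) (Es ! q)" "length Es = n"
  using assms by (auto simp: exceptional_seq_def indecomposable_def orth_def)

lemma exceptional_seq_exc_list:
  fixes Es :: "'k::field rep list"
  assumes Es: "exceptional_seq n Es"
  obtains es where "exc_list n es" "\<And>p. p < n \<Longrightarrow> rep_iso n (Es ! p) (interval_rep (es ! p))"
proof -
  note E = exceptional_seq_orth[OF Es]
  have "\<forall>p\<in>{..<n}. \<exists>e. e \<in> strands_in 0 n \<and> rep_iso n (Es ! p) (interval_rep e)"
    using indecomposable_imp_interval[OF E(2)] by (fastforce simp: strands_in_def)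
  from bchoice[OF this] obtain e where
    e: "\<And>p. p < n \<Longrightarrow> e p \<in> strands_in 0 n" "\<And>p. p < n \<Longrightarrow> rep_iso n (Es ! p) (interval_rep (e p))" by blast
  define es where "es = map e [0..<n]"
  have nth: "es ! p = e p" if "p < n" for p using that by (simp add: es_def)
  have "exc_list n es"
    unfolding exc_list_def sorted_wrt_iff_nth_less
  proof (intro conjI allI impI)
    show "length es = n" by (simp add: es_def)
    show "set es \<subseteq> strands_in 0 n" using e by (auto simp: es_def)
    fix q p assume qp: "q < p" "p < length es"
    then have pn: "p < n" "q < n" by (auto simp: es_def)
    have "orth n (Es ! p) (interval_rep (e q))"
      using E(3)[OF qp(1) pn(1)] orth_iso[OF E(1)[OF pn(1)] E(1)[OF pn(2)] is_rep_interval' e(2)[OF pn(2)]] by blast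
    then have "iso_on (Es ! p) (fst (e q)) (snd (e q))"
      using orth_interval_iff'[OF E(1)[OF pn(1)] e(1)[OF pn(2)]] by blast
    then have "iso_on (interval_rep (e p) :: 'k rep) (fst (e q)) (snd (e q))"
      using retract_iso_on[OF E(1)[OF pn(1)] is_rep_interval' rep_iso_retract(2)[OF e(2)[OF pn(1)]]] e(1)[OF pn(2)]
      by (force simp: strands_in_def)
    then show "perp (es ! p) (es ! q)"
      by (simp add: iso_on_interval_iff_perp[OF e(1)[OF pn(2)]] nth pn)
  qed
  then show thesis using that e(2) nth by simp
qed

lemma exc_list_exceptional_seq:
  assumes es: "exc_list n es"
  shows "exceptional_seq n (map interval_rep es :: 'k::field rep list)"
  unfolding exceptional_seq_def
proof (intro conjI allI impI)
  have len: "length es = n" and st: "\<And>p. p < n \<Longrightarrow> es ! p \<in> strands_in 0 n"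
    using es by (auto simp: exc_list_def)
  show "length (map interval_rep es :: 'k rep list) = n" using len by simp
  fix p assume p: "p < n"
  obtain i j where ij: "es ! p = (i, j)" "i < j" "j \<le> n" using st[OF p] by (auto simp: strands_in_def)
  have nth: "(map interval_rep es :: 'k rep list) ! q = interval_rep (es ! q)" if "q < n" for q using that len by simp
  show "indecomposable n ((map interval_rep es :: 'k rep list) ! p)"
    unfolding nth[OF p] ij(1) using indecomposable_interval ij by blast
  show "ext_vanishes n ((map interval_rep es :: 'k rep list) ! p) (map interval_rep es ! p)"
    unfolding nth[OF p] ij(1) ext_vanishes_iff[OF is_rep_interval is_rep_interval]
      ext_splits_interval_iff[OF is_rep_interval ij(2,3)]
  proof
    fix \<psi> :: "'k mat" assume \<psi>: "\<psi> \<in> carrier_mat 1 (ext_dim (interval_rep (i, j) :: 'k rep) i)"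
    \<comment> \<open>M_{i,j} is zero at i, so psi has no entries and the module has no
      self-extensions.\<close>
    have d: "ext_dim (interval_rep (i, j) :: 'k rep) i = 0" by (simp add: ext_dim_interval)
    show "\<exists>\<phi>\<in>carrier_mat 1 (ext_dim (interval_rep (i, j) :: 'k rep) j). \<phi> * transport (interval_rep (i, j)) i j = \<psi>"
      using \<psi> transport_carrier[OF is_rep_interval[of n i j, where ?'a='k] less_imp_le[OF ij(2)] ij(3)]
      by (intro bexI[of _ "0\<^sub>m 1 (ext_dim (interval_rep (i, j) :: 'k rep) j)"] eq_mat_empty) (auto simp: d)
  qed
  fix q assume q: "q < p"
  then have qn: "q < n" using p by simp
  have "perp (es ! p) (es ! q)" using es q p by (auto simp: exc_list_def sorted_wrt_iff_nth_less)
  then have "orth n (interval_rep (es ! p) :: 'k rep) (interval_rep (es ! q))"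
    using orth_interval_iff'[OF is_rep_interval' st[OF qn]] iso_on_interval_iff_perp[OF st[OF qn]] by blast
  then show "hom_vanishes n ((map interval_rep es :: 'k rep list) ! p) (map interval_rep es ! q)"
    "ext_vanishes n ((map interval_rep es :: 'k rep list) ! p) (map interval_rep es ! q)"
    unfolding nth[OF p] nth[OF qn] by (auto simp: orth_def)
qed

lemma collection_of_interval_class:
  assumes Es: "exceptional_seq n Es" and es: "exc_list n es"
    and iso: "\<And>p. p < n \<Longrightarrow> rep_iso n (Es ! p) (interval_rep (es ! p))"
  shows "collection_of n Es = interval_class n ` set es"
proof -
  note E = exceptional_seq_orth[OF Es]
  have len: "length es = n" using es by (simp add: exc_list_def)
  have cl: "iso_class n (Es ! p) = interval_class n (es ! p)" if "p < n" for p
    using iso[OF that] iso_class_eq_iff[OF E(1)[OF that] is_rep_interval'] by (simp add: interval_class_def)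
  have "collection_of n Es = (\<lambda>p. iso_class n (Es ! p)) ` {..<n}"
    by (auto simp: collection_of_def set_conv_nth E(4))
  also have "\<dots> = (\<lambda>p. interval_class n (es ! p)) ` {..<n}" using cl by (intro image_cong) auto
  also have "\<dots> = interval_class n ` set es" by (auto simp: set_conv_nth len)
  finally show ?thesis .
qed

definition tree_collection :: "nat \<Rightarrow> tern \<Rightarrow> 'k::field rep set set" where
  "tree_collection n T = interval_class n ` diagram True 0 T"

lemma diagram_subset: "nnodes T = n \<Longrightarrow> diagram True 0 T \<subseteq> strands_in 0 n"
  using exc_list_exc_order[of T n] by (simp add: exc_list_def set_exc_order)

lemma strands_tree_collection: "nnodes T = n \<Longrightarrow> strands n (tree_collection n T :: 'k::field rep set set) = diagram True 0 T"
  unfolding tree_collection_def by (rule strands_interval_class[OF diagram_subset])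

lemma exceptional_collections_eq:
  "exceptional_collections n = (tree_collection n ` {T. nnodes T = n} :: 'k::field rep set set set)"
proof (intro equalityI subsetI)
  fix S :: "'k rep set set" assume "S \<in> exceptional_collections n"
  then obtain Es where Es: "exceptional_seq n Es" "S = collection_of n Es" by (auto simp: exceptional_collections_def)
  obtain es where es: "exc_list n es" "\<And>p. p < n \<Longrightarrow> rep_iso n (Es ! p) (interval_rep (es ! p))"
    using exceptional_seq_exc_list[OF Es(1)] by blast
  obtain T where "nnodes T = n" "diagram True 0 T = set es" using exc_list_diagram[OF es(1)] by blast
  then show "S \<in> tree_collection n ` {T. nnodes T = n}"
    using collection_of_interval_class[OF Es(1) es] Es(2) by (auto simp: tree_collection_def)
next
  fix S :: "'k rep set set" assume "S \<in> tree_collection n ` {T. nnodes T = n}"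
  then obtain T where T: "nnodes T = n" "S = tree_collection n T" by blast
  have "S = collection_of n (map interval_rep (exc_order T True 0))"
    by (simp add: T(2) tree_collection_def collection_of_def interval_class_def set_exc_order image_image)
  then show "S \<in> exceptional_collections n"
    using exc_list_exceptional_seq[OF exc_list_exc_order[OF T(1)]] unfolding exceptional_collections_def by blast
qed

lemma path_of_tree_collection:
  assumes "nnodes T = n" "n \<ge> 1"
  shows "path_of n (tree_collection n T :: 'k::field rep set set) = code T"
proof -
  have T: "T \<noteq> Leaf" using assms by auto
  show ?thesis
    unfolding path_of_def strands_tree_collection[OF assms(1)] tree_vertices_diagram[OF T] nodes_diagram[OF T]
    by (rule code_conv_preorder)
qed

lemma bij_betw_nth_subset:
  assumes "distinct xs" "A \<subseteq> set xs"
  shows "bij_betw (\<lambda>k. xs ! k) {k. k < length xs \<and> xs ! k \<in> A} A"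
  unfolding bij_betw_def
proof
  show "inj_on (\<lambda>k. xs ! k) {k. k < length xs \<and> xs ! k \<in> A}"
    using assms(1) by (auto intro!: inj_onI simp: nth_eq_iff_index_eq)
  show "(\<lambda>k. xs ! k) ` {k. k < length xs \<and> xs ! k \<in> A} = A"
    using assms(2) by (auto simp: in_set_conv_nth image_iff subset_iff)
qed

lemma edges_of_kind_code:
  "edges_of_kind Vertical (code T) = {k. k < length (preorder T) \<and> preorder T ! k \<in> node_words T}"
  "edges_of_kind Horizontal (code T) = {k. k < length (preorder T) \<and> preorder T ! k \<in> leaf_words T}"
proof -
  have "code T ! k = (if preorder T ! k \<in> node_words T then Vertical else Horizontal)" if "k < length (preorder T)" for k
    using that by (subst code_conv_preorder[symmetric]) simp
  moreover have "preorder T ! k \<in> leaf_words T \<longleftrightarrow> preorder T ! k \<notin> node_words T" if "k < length (preorder T)" for k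
    using nth_mem[OF that] leaf_words_iff[of _ T] by (auto simp: set_preorder)
  ultimately show "edges_of_kind Vertical (code T) = {k. k < length (preorder T) \<and> preorder T ! k \<in> node_words T}"
    "edges_of_kind Horizontal (code T) = {k. k < length (preorder T) \<and> preorder T ! k \<in> leaf_words T}"
    by (auto simp: edges_of_kind_def length_preorder split: if_splits)
qed

lemma card_leaf_words: "card (leaf_words T) = 2 * nnodes T + 1"
proof -
  have "leaf_words T = set (preorder T) - node_words T"
    using leaf_words_iff[of _ T] by (auto simp: set_preorder)
  then have "card (leaf_words T) = card (set (preorder T)) - card (node_words T)"
    using card_Diff_subset[OF finite_node_words node_words_subset] by simp
  then show ?thesis
    by (simp add: distinct_card[OF distinct_preorder] length_preorder length_code card_node_words)
qed

lemma card_diagram: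
  assumes "nnodes T = n"
  shows "card (diagram True 0 T) = n"
  using distinct_card[OF exc_list_distinct[OF exc_list_exc_order[OF assms]]] assms
  by (simp add: set_exc_order length_exc_order)

text \<open>Injectivity is a count: the n node words map onto the n strands.\<close>

lemma bij_strand_in: "bij_betw (\<lambda>w. the (strand_in T True 0 w)) (node_words T) (diagram True 0 T)"
proof -
  have im: "(\<lambda>w. the (strand_in T True 0 w)) ` node_words T = diagram True 0 T" by (rule strand_in_image)
  have "inj_on (\<lambda>w. the (strand_in T True 0 w)) (node_words T)"
    using card_diagram[of T] card_node_words[of T] im by (intro eq_card_imp_inj_on[OF finite_node_words]) simp
  then show ?thesis using im by (simp add: bij_betw_def)
qed

lemma edge_object_tree_collection:
  assumes "nnodes T = n" "n \<ge> 1"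
  shows "edge_object n (tree_collection n T :: 'k::field rep set set) k =
    interval_class n (the (strand_in T True 0 (preorder T ! k)))"
proof -
  have T: "T \<noteq> Leaf" using assms by auto
  show ?thesis
    unfolding edge_object_def strands_tree_collection[OF assms(1)] tree_vertices_diagram[OF T] strand_at_diagram[OF T]
      interval_class_def ..
qed

lemma bij_edge_object:
  assumes "nnodes T = n" "n \<ge> 1"
  shows "bij_betw (edge_object n (tree_collection n T :: 'k::field rep set set))
    (edges_of_kind Vertical (code T)) (tree_collection n T)"
proof -
  have "bij_betw (interval_class n :: _ \<Rightarrow> 'k rep set) (diagram True 0 T) (tree_collection n T)"
    unfolding tree_collection_def
    by (rule inj_on_imp_bij_betw[OF inj_on_subset[OF inj_on_interval_class diagram_subset[OF assms(1)]]])
  from bij_betw_trans[OF bij_betw_trans[OF bij_betw_nth_subset[OF distinct_preorder node_words_subset] bij_strand_in] this]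
  show ?thesis
    unfolding edges_of_kind_code by (rule bij_betw_cong[THEN iffD1, rotated])
      (simp add: edge_object_tree_collection[OF assms])
qed

lemma left_perp_eq:
  fixes Es :: "'k::field rep list"
  assumes Es: "exceptional_seq n Es" and es: "exc_list n es"
    and iso: "\<And>p. p < n \<Longrightarrow> rep_iso n (Es ! p) (interval_rep (es ! p))" and p: "p < n"
  shows "left_perp n (direct_sum (take p Es)) = perp_cat n (set (take p es))"
proof -
  note E = exceptional_seq_orth[OF Es]
  have len: "length es = n" and st: "\<And>p. p < n \<Longrightarrow> es ! p \<in> strands_in 0 n" using es by (auto simp: exc_list_def)
  have setp: "set (take p xs) = (\<lambda>q. xs ! q) ` {..<p}" if "length xs = n" for xs :: "'b list"
    using nth_image[of p xs] that p by (simp add: lessThan_atLeast0)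
  have "orth n W (direct_sum (take p Es)) \<longleftrightarrow> (\<forall>(s, t)\<in>set (take p es). iso_on W s t)" if W: "is_rep n W" for W
  proof -
    have "orth n W (direct_sum (take p Es)) \<longleftrightarrow> (\<forall>V\<in>set (take p Es). orth n W V)"
    proof (rule orth_direct_sum[OF W])
      fix V assume "V \<in> set (take p Es)"
      then show "is_rep n V" using setp[OF E(4)] E(1) p by auto
    qed
    also have "\<dots> \<longleftrightarrow> (\<forall>q<p. orth n W (Es ! q))" unfolding setp[OF E(4)] by blast
    also have "\<dots> \<longleftrightarrow> (\<forall>q<p. iso_on W (fst (es ! q)) (snd (es ! q)))"
    proof -
      have "orth n W (Es ! q) \<longleftrightarrow> iso_on W (fst (es ! q)) (snd (es ! q))" if "q < p" for q
        using orth_iso[OF W E(1) is_rep_interval' iso, of q] orth_interval_iff'[OF W st, of q] that p by simp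
      then show ?thesis by blast
    qed
    finally show ?thesis unfolding setp[OF len] by (auto simp: case_prod_beta)
  qed
  then show ?thesis unfolding left_perp_def perp_cat_def orth_def by blast
qed

lemma injective_in_perp_iff:
  assumes es: "exc_list n es" and T: "nnodes T = n" "diagram True 0 T = set es" and p: "p < n" and e: "es ! p = (i, j)"
    and arc: "if b then (i, j) \<in> arcs True 0 T else (j, i) \<in> arcs True 0 T"
  shows "injective_in n (perp_cat n (set (take p es))) (interval_rep (i, j) :: 'k::field rep) \<longleftrightarrow> b"
proof -
  let ?P = "set (take p es)" and ?I = "interval_rep (i, j) :: 'k rep"
  have len: "length es = n" and sub: "set es \<subseteq> strands_in 0 n" using es by (auto simp: exc_list_def)
  have ij: "i < j" "j \<le> n" using sub nth_mem[of p es] p len e by (auto simp: strands_in_def)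
  have Psub: "?P \<subseteq> set es" by (rule set_take_subset)
  have P: "s < t \<and> t \<le> n" if "(s, t) \<in> ?P" for s t using that Psub sub by (auto simp: strands_in_def)
  have Pq: "\<exists>q<p. X = es ! q" if "X \<in> ?P" for X using that len p by (auto simp: in_set_conv_nth)
  have perpP: "perp (i, j) X" if X: "X \<in> ?P" for X
  proof -
    obtain q where "q < p" "X = es ! q" using Pq[OF X] by blast
    then have "perp (es ! p) X" using es p by (auto simp: exc_list_def sorted_wrt_iff_nth_less)
    then show ?thesis unfolding e .
  qed
  have I: "?I \<in> perp_cat n ?P"
    unfolding perp_cat_def using is_rep_interval iso_on_interval_iff_perp[of _ n "(i, j)"] perpP Psub sub by fastforce
  show ?thesis
  proof (cases b)
    case True
    then have arc: "(i, j) \<in> arcs True 0 T" using arc by simp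
    obtain r where r: "excs r (set es)" "\<And>p. p < n \<Longrightarrow> r (es ! p) = p" using exc_list_rank[OF es] by blast
    have "anchored r (set es) i j (i, j)"
    proof (rule right_arcs_anchored[OF r(1) _ _ _ arc ij(1)])
      \<comment> \<open>At the base 0 the vertex 0 itself is the anchor, with the empty
        chain.\<close>
      show "\<forall>y. 0 < y \<and> y \<le> 0 + nnodes T \<and> (0, y) \<in> set es \<longrightarrow> anchored r (set es) 0 (0 + nnodes T) (0, y)"
        unfolding anchored_def by blast
    qed (use T in auto)
    moreover have "X \<in> ?P" if X: "X \<in> set es" "r X < r (i, j)" for X
    proof -
      obtain q where q: "q < n" "X = es ! q" using X(1) len by (auto simp: in_set_conv_nth)
      then have "q < p" using X(2) r(2) p e[symmetric] by simp
      then show ?thesis using q(2) nth_image[of p es] p len by auto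
    qed
    ultimately obtain x where x: "(x, i) \<in> ?P\<^sup>*" "x = 0 \<or> (\<exists>z>j. (x, z) \<in> ?P)"
      unfolding anchored_def using rtrancl_mono[of "{E \<in> set es. r E < r (i, j)}" ?P] by blast
    have "injective_in n (perp_cat n ?P) ?I"
      by (rule injective_in_interval[OF _ ij I x]) (rule P)
    then show ?thesis using True by simp
  next
    case False
    then have arc: "(j, i) \<in> arcs True 0 T" using arc by simp
    from left_arcs_component[OF block_whole _ this ij(1)] obtain u u' where
      u: "1 \<le> u" "u \<le> i" "i \<le> u'" "u' < j" "\<And>E. E \<in> set es \<Longrightarrow> E \<noteq> (i, j) \<Longrightarrow> fst E \<in> {u..u'} \<longleftrightarrow> snd E \<in> {u..u'}"
      unfolding T(2) by blast
    \<comment> \<open>The support (u - 1, j] is the union of [u, u'] and (i, j], and X has both or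
      none of its ends in each of the two.\<close>
    have "perp (u - 1, j) X" if X: "X \<in> ?P" for X
    proof -
      obtain q where q: "q < p" "X = es ! q" using Pq[OF X] by blast
      then have "X \<noteq> (i, j)" using exc_list_distinct[OF es] p len e by (metis less_trans nat_neq_iff nth_eq_iff_index_eq)
      then have "fst X \<in> {u..u'} \<longleftrightarrow> snd X \<in> {u..u'}" using u(5) X Psub by blast
      then show ?thesis using perpP[OF X] u(1-4) unfolding perp_def by auto
    qed
    then have "(interval_rep (u - 1, j) :: 'k rep) \<in> perp_cat n ?P"
      unfolding perp_cat_def using is_rep_interval iso_on_interval_iff_perp[of _ n "(u - 1, j)"] Psub sub by fastforce
    moreover have "u - 1 < i" using u by simp
    ultimately have "\<not> injective_in n (perp_cat n ?P) ?I" using not_injective_in_interval[OF _ ij I] by blast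
    then show ?thesis using False by simp
  qed
qed

lemma relatively_injective_iff:
  fixes Es :: "'k::field rep list"
  assumes Es: "exceptional_seq n Es" and n: "n \<ge> 1" and p: "p < n"
    and k: "k \<in> edges_of_kind Vertical (path_of n (collection_of n Es))"
    and obj: "edge_object n (collection_of n Es) k = iso_class n (Es ! p)"
  shows "relatively_injective n Es p \<longleftrightarrow> even (fst (point (path_of n (collection_of n Es)) k))"
proof -
  note E = exceptional_seq_orth[OF Es]
  obtain es where es: "exc_list n es" and iso: "\<And>p. p < n \<Longrightarrow> rep_iso n (Es ! p) (interval_rep (es ! p))"
    using exceptional_seq_exc_list[OF Es] by blast
  obtain T where T: "nnodes T = n" "diagram True 0 T = set es" using exc_list_diagram[OF es] by blast
  have S: "collection_of n Es = tree_collection n T"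
    using collection_of_interval_class[OF Es es iso] T by (simp add: tree_collection_def)
  note path = path_of_tree_collection[OF T(1) n, where 'k='k, folded S]
  define w where "w = preorder T ! k"
  have kl: "k < length (code T)" and w: "w \<in> node_words T"
    using k unfolding path edges_of_kind_code by (auto simp: w_def length_preorder)
  define e where "e = the (strand_in T True 0 w)"
  have se: "strand_in T True 0 w = Some e" using w strand_in_neq_None[of T True 0 w] by (auto simp: e_def)
  have eD: "e \<in> diagram True 0 T" unfolding e_def using bij_betwE[OF bij_strand_in] w by blast
  have st: "es ! p \<in> set es" "set es \<subseteq> strands_in 0 n" using es p by (auto simp: exc_list_def)
  have "(interval_class n e :: 'k rep set) = interval_class n (es ! p)"
    using obj edge_object_tree_collection[OF T(1) n, where 'k='k, of k] iso[OF p] iso_class_eq_iff[OF E(1)[OF p] is_rep_interval']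
    by (simp add: S e_def w_def interval_class_def)
  \<comment> \<open>Distinct strands have non-isomorphic interval modules, so the node at edge k is
    the strand at position p.\<close>
  then have e: "e = es ! p"
    using inj_onD[OF inj_on_interval_class] eD T(2) st by blast
  obtain i j where ij: "es ! p = (i, j)" by fastforce
  have arc: "if word_right w then (i, j) \<in> arcs True 0 T else (j, i) \<in> arcs True 0 T"
    using strand_in_arcs[of T True 0 w i j] se e ij by auto
  let ?C = "perp_cat n (set (take p es)) :: 'k rep set"
  have C: "left_perp n (direct_sum (take p Es)) = ?C" by (rule left_perp_eq[OF Es es iso p])
  have rC: "is_rep n W" if "W \<in> ?C" for W using that by (simp add: perp_cat_def)
  have len: "length es = n" using es by (simp add: exc_list_def)
  have EC: "Es ! p \<in> ?C"
  proof -
    have "orth n (Es ! p) (direct_sum (take p Es))"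
    proof (subst orth_direct_sum[OF E(1)[OF p]])
      show "is_rep n V" if "V \<in> set (take p Es)" for V
        using that E(1,4) p by (auto simp: in_set_conv_nth)
      show "\<forall>V\<in>set (take p Es). orth n (Es ! p) V"
        using E(3)[OF _ p] E(4) by (auto simp: in_set_conv_nth)
    qed
    then show ?thesis unfolding C[symmetric] left_perp_def orth_def using E(1)[OF p] by blast
  qed
  have IC: "interval_rep (es ! p) \<in> ?C"
    unfolding perp_cat_def
  proof (intro CollectI conjI is_rep_interval' ballI)
    fix X assume X: "X \<in> set (take p es)"
    then have "iso_on (Es ! p) (fst X) (snd X)" "fst X \<le> snd X" "snd X \<le> n"
      using EC set_take_subset[of p es] st(2) by (auto simp: perp_cat_def strands_in_def)
    then show "case X of (s, t) \<Rightarrow> iso_on (interval_rep (es ! p) :: 'k rep) s t"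
      using retract_iso_on[OF E(1)[OF p] is_rep_interval' rep_iso_retract(2)[OF iso[OF p]]] by (auto simp: case_prod_beta)
  qed
  have "relatively_injective n Es p \<longleftrightarrow> injective_in n ?C (interval_rep (es ! p))"
    unfolding relatively_injective_def C
    using injective_in_iso[OF rC IC iso[OF p]] injective_in_iso[OF rC EC rep_iso_sym[OF iso[OF p]]] by blast
  also have "\<dots> \<longleftrightarrow> word_right w" unfolding ij by (rule injective_in_perp_iff[OF es T p ij arc])
  also have "\<dots> \<longleftrightarrow> even (fst (point (code T) k))"
    using even_leaves_before[OF kl] by (simp add: point_def w_def)
  finally show ?thesis unfolding path .
qed

theorem theorem6p11:
  fixes n :: nat
  assumes "n \<ge> 1"
  shows
    "bij_betw (path_of n) (exceptional_collections n :: 'k::field rep set set set) (lattice_paths n)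
     \<and> (\<forall>S \<in> (exceptional_collections n :: 'k rep set set set).
          bij_betw (\<lambda>k. tree_vertices (strands n S) ! k)
            (edges_of_kind Vertical (path_of n S)) (nodes (strands n S))
        \<and> bij_betw (\<lambda>k. tree_vertices (strands n S) ! k)
            (edges_of_kind Horizontal (path_of n S)) (leaves (strands n S))
        \<and> card (nodes (strands n S)) = n
        \<and> card (leaves (strands n S)) = 2 * n + 1
        \<and> bij_betw (edge_object n S) (edges_of_kind Vertical (path_of n S)) S)
     \<and> (\<forall>Es :: 'k rep list. exceptional_seq n Es \<longrightarrow>
          (\<forall>p<n. \<forall>k \<in> edges_of_kind Vertical (path_of n (collection_of n Es)).
             edge_object n (collection_of n Es) k = iso_class n (Es ! p) \<longrightarrow>
             (relatively_injective n Es p \<longleftrightarrow>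
                even (fst (point (path_of n (collection_of n Es)) k)))))"
proof (intro conjI ballI allI impI)
  let ?F = "tree_collection n :: tern \<Rightarrow> 'k rep set set" and ?\<T> = "{T. nnodes T = n}"
  note path = path_of_tree_collection[OF _ assms, where 'k='k]
  \<comment> \<open>The path of a collection is the code of any tree that yields it, so equal paths
    come from the same tree and hence from the same collection.\<close>
  have "inj_on (path_of n) (?F ` ?\<T>)"
  proof (rule inj_onI)
    fix S S' assume "S \<in> ?F ` ?\<T>" "S' \<in> ?F ` ?\<T>" "path_of n S = path_of n S'"
    then obtain T T' where "nnodes T = n" "nnodes T' = n" "S = ?F T" "S' = ?F T'" "code T = code T'"
      using path by auto
    then show "S = S'" using inj_code by (simp add: inj_eq)
  qed
  moreover have "path_of n ` (?F ` ?\<T>) = code ` ?\<T>"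
    unfolding image_image by (intro image_cong) (auto simp: path)
  ultimately show "bij_betw (path_of n) (exceptional_collections n :: 'k rep set set set) (lattice_paths n)"
    using bij_code[of n] by (simp add: bij_betw_def exceptional_collections_eq)
next
  fix S :: "'k rep set set" assume "S \<in> exceptional_collections n"
  then obtain T where T: "nnodes T = n" "S = tree_collection n T" by (auto simp: exceptional_collections_eq)
  have nl: "T \<noteq> Leaf" using T(1) assms by auto
  note D = strands_tree_collection[OF T(1), where 'k='k, folded T(2)]
  note path = path_of_tree_collection[OF T(1) assms, where 'k='k, folded T(2)]
  note eqs = D path tree_vertices_diagram[OF nl] nodes_diagram[OF nl] leaves_diagram[OF nl] edges_of_kind_code
  show "bij_betw (\<lambda>k. tree_vertices (strands n S) ! k) (edges_of_kind Vertical (path_of n S)) (nodes (strands n S))"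
    unfolding eqs by (rule bij_betw_nth_subset[OF distinct_preorder node_words_subset])
  show "bij_betw (\<lambda>k. tree_vertices (strands n S) ! k) (edges_of_kind Horizontal (path_of n S)) (leaves (strands n S))"
    unfolding eqs by (rule bij_betw_nth_subset[OF distinct_preorder]) (simp add: set_preorder)
  show "card (nodes (strands n S)) = n" "card (leaves (strands n S)) = 2 * n + 1"
    unfolding eqs by (simp_all add: card_node_words card_leaf_words T(1))
  show "bij_betw (edge_object n S) (edges_of_kind Vertical (path_of n S)) S"
    using bij_edge_object[OF T(1) assms, where 'k='k] unfolding path T(2) path[unfolded T(2)] .
next
  fix Es :: "'k rep list" and p k
  assume "exceptional_seq n Es" "p < n" "k \<in> edges_of_kind Vertical (path_of n (collection_of n Es))"
    "edge_object n (collection_of n Es) k = iso_class n (Es ! p)"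
  then show "relatively_injective n Es p \<longleftrightarrow> even (fst (point (path_of n (collection_of n Es)) k))"
    using relatively_injective_iff assms by blast
qed

end
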